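(* The subspace lattice $\mathrm{Lat}\,\mathcal{A}_p$ is not synthetic relative to $M_{H^\infty(\mathbb{R})}$. Equivalently, there exists a weak$^*$-closed operator algebra $\mathcal{A}$ on $L^2(\mathbb{R})$ with $M_{H^\infty(\mathbb{R})}\subseteq\mathcal{A}$ and $\mathrm{Lat}\,\mathcal{A}=\mathrm{Lat}\,\mathcal{A}_p$ but $\mathcal{A}\neq\mathcal{A}_p$.
   Context: On $L^2(\mathbb{R})$ let $(M_\lambda f)(x)=e^{i\lambda x}f(x)$ and $(D_\mu f)(x)=f(x-\mu)$. The parabolic algebra $\mathcal{A}_p$ is the weak operator topology closed algebra generated by $\{M_\lambda:\lambda\geq0\}\cup\{D_\mu:\mu\geq0\}$; it is reflexive, i.e. $\mathcal{A}_p=\mathrm{Alg}\,\mathrm{Lat}\,\mathcal{A}_p$, where $\mathrm{Lat}$ denotes the lattice of closed invariant subspaces and $\mathrm{Alg}\,\mathcal{L}$ the algebra of operators leaving every subspace of $\mathcal{L}$ invariant. $H^\infty(\mathbb{R})$ is the algebra of boundary values of bounded analytic functions on the upper half-plane and $M_{H^\infty(\mathbb{R})}=\{M_h:h\in H^\infty(\mathbb{R})\}$ the corresponding multiplication operators, a maximal abelian subalgebra of $\mathcal{A}_p$. Definition: a reflexive subspace lattice $\mathcal{L}$ is synthetic relative to a maximal abelian subalgebra $\mathcal{B}$ of $\mathrm{Alg}\,\mathcal{L}$ if $\mathrm{Alg}\,\mathcal{L}$ is the unique weak$^*$-closed operator algebra $\mathcal{A}$ with $\mathrm{Lat}\,\mathcal{A}=\mathcal{L}$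 and $\mathcal{B}\subseteq\mathcal{A}$. *)

theory Defs
  imports "HOL-Analysis.Analysis" "HOL-Complex_Analysis.Complex_Analysis"
begin

text \<open>Concrete model of L2(R): complex functions on the reals, square integrable
  w.r.t. Lebesgue measure, identified up to almost-everywhere equality.
  Operators are maps on such functions that respect a.e. equality.\<close>

type_synonym fn = "real \<Rightarrow> complex"
type_synonym op = "fn \<Rightarrow> fn"

definition L2 :: "fn set" where
  "L2 = {f. f \<in> borel_measurable lborel \<and> integrable lborel (\<lambda>x. (cmod (f x))\<^sup>2)}"

definition aeq :: "fn \<Rightarrow> fn \<Rightarrow> bool" where
  "aeq f g \<longleftrightarrow> (AE x in lborel. f x = g x)"

definition inner2 :: "fn \<Rightarrow> fn \<Rightarrow> complex" where
  "inner2 f g = (LINT x|lborel. f x * cnj (g x))"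

definition norm2 :: "fn \<Rightarrow> real" where
  "norm2 f = sqrt (LINT x|lborel. (cmod (f x))\<^sup>2)"

definition bop :: "op \<Rightarrow> bool" where
  "bop T \<longleftrightarrow>
     (\<forall>f\<in>L2. T f \<in> L2) \<and>
     (\<forall>f\<in>L2. \<forall>g\<in>L2. aeq f g \<longrightarrow> aeq (T f) (T g)) \<and>
     (\<forall>f\<in>L2. \<forall>g\<in>L2. \<forall>a b. aeq (T (\<lambda>x. a * f x + b * g x)) (\<lambda>x. a * T f x + b * T g x)) \<and>
     (\<exists>C. \<forall>f\<in>L2. norm2 (T f) \<le> C * norm2 f)"

definition closed_subspace :: "fn set \<Rightarrow> bool" where
  "closed_subspace K \<longleftrightarrow>
     K \<subseteq> L2 \<and> (\<lambda>x. 0) \<in> K \<and>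
     (\<forall>f\<in>K. \<forall>g\<in>K. \<forall>a b. (\<lambda>x. a * f x + b * g x) \<in> K) \<and>
     (\<forall>f\<in>K. \<forall>g\<in>L2. aeq f g \<longrightarrow> g \<in> K) \<and>
     (\<forall>s f. (\<forall>n. s n \<in> K) \<longrightarrow> f \<in> L2 \<longrightarrow>
        ((\<lambda>n. norm2 (\<lambda>x. s n x - f x)) \<longlonglongrightarrow> 0) \<longrightarrow> f \<in> K)"

definition Lat :: "op set \<Rightarrow> fn set set" where
  "Lat A = {K. closed_subspace K \<and> (\<forall>T\<in>A. \<forall>f\<in>K. T f \<in> K)}"

definition op_algebra :: "op set \<Rightarrow> bool" where
  "op_algebra A \<longleftrightarrow> A \<noteq> {} \<and> (\<forall>T\<in>A. bop T) \<and>
     (\<forall>T\<in>A. \<forall>S\<in>A. (\<lambda>f x. T f x + S f x) \<in> A) \<and>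
     (\<forall>T\<in>A. \<forall>c. (\<lambda>f x. c * T f x) \<in> A) \<and>
     (\<forall>T\<in>A. \<forall>S\<in>A. T \<circ> S \<in> A)"

definition wot_closed :: "op set \<Rightarrow> bool" where
  "wot_closed A \<longleftrightarrow> A \<subseteq> Collect bop \<and>
     (\<forall>T. bop T \<longrightarrow>
        (\<forall>vs :: (fn \<times> fn) list. \<forall>e>0. set vs \<subseteq> L2 \<times> L2 \<longrightarrow>
           (\<exists>S\<in>A. \<forall>(f,g)\<in>set vs. cmod (inner2 (S f) g - inner2 (T f) g) < e))
        \<longrightarrow> T \<in> A)"

definition ultraweak_data :: "(nat \<Rightarrow> fn) \<Rightarrow> (nat \<Rightarrow> fn) \<Rightarrow> bool" where
  "ultraweak_data x y \<longleftrightarrow> (\<forall>n. x n \<in> L2 \<and> y n \<in> L2) \<and>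
     summable (\<lambda>n. (norm2 (x n))\<^sup>2) \<and> summable (\<lambda>n. (norm2 (y n))\<^sup>2)"

definition ultraweak_fun :: "(nat \<Rightarrow> fn) \<Rightarrow> (nat \<Rightarrow> fn) \<Rightarrow> op \<Rightarrow> complex" where
  "ultraweak_fun x y T = (\<Sum>n. inner2 (T (x n)) (y n))"

definition weak_star_closed :: "op set \<Rightarrow> bool" where
  "weak_star_closed A \<longleftrightarrow> A \<subseteq> Collect bop \<and>
     (\<forall>T. bop T \<longrightarrow>
        (\<forall>ps :: ((nat \<Rightarrow> fn) \<times> (nat \<Rightarrow> fn)) list. \<forall>e>0.
           (\<forall>(x,y)\<in>set ps. ultraweak_data x y) \<longrightarrow>
           (\<exists>S\<in>A. \<forall>(x,y)\<in>set ps. cmod (ultraweak_fun x y S - ultraweak_fun x y T) < e))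
        \<longrightarrow> T \<in> A)"

definition Mop :: "real \<Rightarrow> op" where
  "Mop l = (\<lambda>f x. exp (\<i> * complex_of_real (l * x)) * f x)"

definition Dop :: "real \<Rightarrow> op" where
  "Dop m = (\<lambda>f x. f (x - m))"

definition parabolic_algebra :: "op set" where
  "parabolic_algebra = \<Inter>{B. op_algebra B \<and> wot_closed B \<and>
      (\<forall>l\<ge>0. Mop l \<in> B) \<and> (\<forall>m\<ge>0. Dop m \<in> B)}"

definition Hinf :: "fn set" where
  "Hinf = {h. h \<in> borel_measurable lborel \<and>
     (\<exists>F. F holomorphic_on {z. 0 < Im z} \<and> bounded (F ` {z. 0 < Im z}) \<and>
        (AE x in lborel. ((\<lambda>y. F (Complex x y)) \<longlongrightarrow> h x) (at_right 0)))}"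

definition mult_op :: "fn \<Rightarrow> op" where
  "mult_op h = (\<lambda>f x. h x * f x)"

end

theory Submission
  imports Defs "HOL-Probability.Sinc_Integral" "HOL-Real_Asymp.Real_Asymp"
begin

text \<open>
  For \<open>c > 0\<close> the operators \<open>M\<^sub>l D\<^sub>m\<close> with \<open>l, m \<ge> 0\<close> and (\<open>m = 0\<close> or \<open>l \<ge> c\<close>) form a
  semigroup up to scalars. The closure of its span is an algebra containing all \<open>M\<^sub>h\<close> with \<open>h\<close> in
  \<open>H\<^sup>\<infinity>\<close>, and a functional of rank two separates it from \<open>D\<^sub>1\<close>.

  It has the same invariant subspaces as the parabolic algebra. Let \<open>K\<close> be invariant, \<open>f \<in> K\<close>,
  \<open>\<psi>\<close> orthogonal to \<open>K\<close>, and \<open>\<phi>\<^sub>m(x) = f(x - m) \<psi>(x)\<^sup>*\<close>. Then \<open>\<phi>\<^sub>0\<close> and all \<open>exp (\<i> c x) \<phi>\<^sub>m\<close> belong to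
  the Hardy space \<open>H\<^sup>1\<close> of the upper half-plane, and the identity
  \<open>\<phi>\<^sub>m(x) \<phi>\<^sub>m(x - m) = \<phi>\<^bsub>2m\<^esub>(x) \<phi>\<^sub>0(x - m)\<close> persists for the analytic extensions by an argument of
  Beurling. Comparing exponential types as in Titchmarsh's convolution theorem gives
  \<open>exp (\<i> c x / 2) \<phi>\<^sub>m \<in> H\<^sup>1\<close>. So \<open>c\<close> may be replaced by \<open>c / 2\<close>, and in the limit \<open>K\<close> is
  invariant under \<open>D\<^sub>m\<close>.
\<close>

section \<open>The Hilbert space of square integrable functions\<close>

text \<open>The obstacle is the passage of the identity for the functions \<phi>_m to the
  half-plane. On the line it is trivial, but its sides are products of two integrable functions and
  need not be integrable, so they have no Cauchy integral of their own. Instead, the four Cauchy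
  integrals are treated as entries of one 2 by 2 matrix, whose determinant is shown to vanish. The
  gain comes from counting exponentials. Both factors on the left and both on the right carry exp(i
  c x), but \<phi>_0 is in H^1 without it, so the right side has a spare factor exp(i c z). The
  product on the left therefore decays like exp(- c Im z). A function and its horizontal translate
  share this decay equally, up to bounded factors, which is why \<open>c\<close> is halved in each
  step and not removed at once. The value of \<open>c\<close> is fixed only at the end, by a
  nonvanishing Fourier coefficient of a product of resolvents.\<close>

lemma borel_measurable_cnj [measurable]:
  "f \<in> borel_measurable M \<Longrightarrow> (\<lambda>x. cnj (f x)) \<in> borel_measurable M"
  by (rule borel_measurable_continuous_on) (auto intro: continuous_intros)

lemma L2_meas [measurable_dest]: "f \<in> L2 \<Longrightarrow> f \<in> borel_measurable borel"
  by (simp add: L2_def)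

lemma L2_sq_integrable: "f \<in> L2 \<Longrightarrow> integrable lborel (\<lambda>x. (cmod (f x))\<^sup>2)"
  by (simp add: L2_def)

lemma L2_I: "f \<in> borel_measurable lborel \<Longrightarrow> integrable lborel (\<lambda>x. (cmod (f x))\<^sup>2) \<Longrightarrow> f \<in> L2"
  by (simp add: L2_def)

lemma L2_integrable_mult:
  assumes "f \<in> L2" "g \<in> L2"
  shows "integrable lborel (\<lambda>x. f x * g x)"
proof (rule Bochner_Integration.integrable_bound)
  show "integrable lborel (\<lambda>x. (cmod (f x))\<^sup>2 + (cmod (g x))\<^sup>2)"
    using assms by (intro Bochner_Integration.integrable_add L2_sq_integrable)
  show "(\<lambda>x. f x * g x) \<in> borel_measurable lborel"
    using assms[THEN L2_meas] by simp
  have "cmod (f x) * cmod (g x) \<le> (cmod (f x))\<^sup>2 + (cmod (g x))\<^sup>2" for x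
  proof -
    have "2 * (cmod (f x) * cmod (g x)) \<le> (cmod (f x))\<^sup>2 + (cmod (g x))\<^sup>2"
      using sum_squares_bound[of "cmod (f x)" "cmod (g x)"] by (simp add: mult.assoc)
    moreover have "0 \<le> cmod (f x) * cmod (g x)" by simp
    ultimately show ?thesis by linarith
  qed
  then show "AE x in lborel. norm (f x * g x) \<le> norm ((cmod (f x))\<^sup>2 + (cmod (g x))\<^sup>2)"
    by (simp add: norm_mult)
qed

lemma L2_cnj: "f \<in> L2 \<Longrightarrow> (\<lambda>x. cnj (f x)) \<in> L2"
  by (auto simp: L2_def)

lemma L2_integrable_inner:
  "f \<in> L2 \<Longrightarrow> g \<in> L2 \<Longrightarrow> integrable lborel (\<lambda>x. f x * cnj (g x))"
  using L2_integrable_mult[OF _ L2_cnj] .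

lemma L2_bounded_mult:
  assumes "f \<in> L2" "u \<in> borel_measurable lborel" "AE x in lborel. cmod (u x) \<le> C"
  shows "(\<lambda>x. u x * f x) \<in> L2"
proof (rule L2_I)
  show "(\<lambda>x. u x * f x) \<in> borel_measurable lborel"
    using assms by (auto dest: L2_meas)
  show "integrable lborel (\<lambda>x. (cmod (u x * f x))\<^sup>2)"
  proof (rule Bochner_Integration.integrable_bound)
    show "integrable lborel (\<lambda>x. C\<^sup>2 * (cmod (f x))\<^sup>2)"
      using L2_sq_integrable[OF assms(1)] by simp
    show "(\<lambda>x. (cmod (u x * f x))\<^sup>2) \<in> borel_measurable lborel"
      using assms by (auto dest: L2_meas)
    show "AE x in lborel. norm ((cmod (u x * f x))\<^sup>2) \<le> norm (C\<^sup>2 * (cmod (f x))\<^sup>2)"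
      using assms(3) by eventually_elim (auto simp: norm_mult power_mult_distrib intro!: mult_right_mono power_mono)
  qed
qed

lemma L2_zero [simp]: "(\<lambda>x. 0) \<in> L2"
  by (simp add: L2_def)

lemma L2_scale: "f \<in> L2 \<Longrightarrow> (\<lambda>x. a * f x) \<in> L2"
  by (rule L2_bounded_mult[where C = "cmod a"]) auto

lemma L2_add:
  assumes "f \<in> L2" "g \<in> L2"
  shows "(\<lambda>x. f x + g x) \<in> L2"
proof (rule L2_I)
  show "(\<lambda>x. f x + g x) \<in> borel_measurable lborel"
    using assms[THEN L2_meas] by simp
  show "integrable lborel (\<lambda>x. (cmod (f x + g x))\<^sup>2)"
  proof (rule Bochner_Integration.integrable_bound)
    show "integrable lborel (\<lambda>x. 2 * (cmod (f x))\<^sup>2 + 2 * (cmod (g x))\<^sup>2)"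
      using assms by (auto intro!: L2_sq_integrable)
    show "(\<lambda>x. (cmod (f x + g x))\<^sup>2) \<in> borel_measurable lborel"
      using assms by (auto dest: L2_meas)
    have "(cmod (f x + g x))\<^sup>2 \<le> 2 * (cmod (f x))\<^sup>2 + 2 * (cmod (g x))\<^sup>2" for x
    proof -
      have "(cmod (f x + g x))\<^sup>2 \<le> (cmod (f x) + cmod (g x))\<^sup>2"
        by (intro power_mono norm_triangle_ineq) auto
      also have "\<dots> \<le> 2 * (cmod (f x))\<^sup>2 + 2 * (cmod (g x))\<^sup>2"
        using sum_squares_bound[of "cmod (f x)" "cmod (g x)"] by (simp add: power2_sum)
      finally show ?thesis .
    qed
    then show "AE x in lborel. norm ((cmod (f x + g x))\<^sup>2) \<le> norm (2 * (cmod (f x))\<^sup>2 + 2 * (cmod (g x))\<^sup>2)"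
      by simp
  qed
qed

lemma L2_lincomb: "f \<in> L2 \<Longrightarrow> g \<in> L2 \<Longrightarrow> (\<lambda>x. a * f x + b * g x) \<in> L2"
  by (intro L2_add L2_scale)

lemma L2_diff: "f \<in> L2 \<Longrightarrow> g \<in> L2 \<Longrightarrow> (\<lambda>x. f x - g x) \<in> L2"
  using L2_lincomb[of f g 1 "-1"] by simp

lemma L2_shift:
  assumes "f \<in> L2" shows "(\<lambda>x. f (x - m)) \<in> L2"
proof (rule L2_I)
  show "(\<lambda>x. f (x - m)) \<in> borel_measurable lborel"
    using assms[THEN L2_meas] by simp
  show "integrable lborel (\<lambda>x. (cmod (f (x - m)))\<^sup>2)"
    using lborel_integrable_real_affine[OF L2_sq_integrable[OF assms], of 1 "-m"] by simp
qed

lemma lborel_integral_shift: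
  fixes f :: "real \<Rightarrow> 'a :: {banach, second_countable_topology}"
  shows "(LINT x|lborel. f (x - m)) = (LINT x|lborel. f x)"
  using lborel_integral_real_affine[of 1 f "-m"] by simp

lemma inner2_lincomb_left:
  assumes "f \<in> L2" "g \<in> L2" "h \<in> L2"
  shows "inner2 (\<lambda>x. a * f x + b * g x) h = a * inner2 f h + b * inner2 g h"
  using L2_integrable_inner[of f h] L2_integrable_inner[of g h] assms
  by (simp add: inner2_def algebra_simps)

lemma inner2_diff_left:
  assumes "f \<in> L2" "g \<in> L2" "h \<in> L2"
  shows "inner2 (\<lambda>x. f x - g x) h = inner2 f h - inner2 g h"
  using inner2_lincomb_left[OF assms, of 1 "-1"] by simp

lemma inner2_add_left:
  assumes "f \<in> L2" "g \<in> L2" "h \<in> L2"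
  shows "inner2 (\<lambda>x. f x + g x) h = inner2 f h + inner2 g h"
  using inner2_lincomb_left[OF assms, of 1 1] by simp

lemma inner2_scale_left: "inner2 (\<lambda>x. a * f x) h = a * inner2 f h"
  by (simp add: inner2_def mult.assoc)

lemma inner2_commute: "inner2 g f = cnj (inner2 f g)"
proof -
  have "inner2 g f = (LINT x|lborel. cnj (f x * cnj (g x)))"
    by (simp add: inner2_def mult.commute)
  also have "\<dots> = cnj (inner2 f g)"
    unfolding inner2_def by (rule Bochner_Integration.integral_cnj)
  finally show ?thesis .
qed

lemma inner2_self: "inner2 f f = of_real ((norm2 f)\<^sup>2)"
proof -
  have "inner2 f f = (LINT x|lborel. complex_of_real ((cmod (f x))\<^sup>2))"
    by (simp only: inner2_def complex_norm_square)
  also have "\<dots> = of_real (LINT x|lborel. (cmod (f x))\<^sup>2)"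
    by (rule integral_complex_of_real)
  finally show ?thesis by (simp add: norm2_def)
qed

lemma norm2_nonneg [simp]: "0 \<le> norm2 f"
  by (simp add: norm2_def)

lemma norm2_sq: "(norm2 f)\<^sup>2 = (LINT x|lborel. (cmod (f x))\<^sup>2)"
  by (simp add: norm2_def)

lemma norm2_sq_add_scaled:
  assumes "f \<in> L2" "g \<in> L2"
  shows "(norm2 (\<lambda>x. f x + t * g x))\<^sup>2 = (norm2 f)\<^sup>2 + 2 * Re (cnj t * inner2 f g) + (cmod t)\<^sup>2 * (norm2 g)\<^sup>2"
proof -
  have "(cmod (f x + t * g x))\<^sup>2
      = (cmod (f x))\<^sup>2 + 2 * Re (cnj t * (f x * cnj (g x))) + (cmod t)\<^sup>2 * (cmod (g x))\<^sup>2" for x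
    unfolding cmod_power2 by (simp add: power2_eq_square algebra_simps)
  then have "(norm2 (\<lambda>x. f x + t * g x))\<^sup>2
      = (LINT x|lborel. (cmod (f x))\<^sup>2 + 2 * Re (cnj t * (f x * cnj (g x))) + (cmod t)\<^sup>2 * (cmod (g x))\<^sup>2)"
    by (simp add: norm2_sq)
  also have "\<dots> = (norm2 f)\<^sup>2 + 2 * (LINT x|lborel. Re (cnj t * (f x * cnj (g x)))) + (cmod t)\<^sup>2 * (norm2 g)\<^sup>2"
    using L2_sq_integrable[OF assms(1)] L2_sq_integrable[OF assms(2)] L2_integrable_inner[OF assms]
    by (simp add: norm2_sq del: Re_divide times_complex.sel)
  also have "(LINT x|lborel. Re (cnj t * (f x * cnj (g x)))) = Re (cnj t * inner2 f g)"
    using L2_integrable_inner[OF assms] by (simp add: inner2_def del: times_complex.sel)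
  finally show ?thesis .
qed

lemma norm2_scale: "norm2 (\<lambda>x. a * f x) = cmod a * norm2 f"
  by (simp add: norm2_def norm_mult power_mult_distrib real_sqrt_mult)

lemma norm2_eq_0_iff:
  assumes "f \<in> L2" shows "norm2 f = 0 \<longleftrightarrow> (AE x in lborel. f x = 0)"
  unfolding norm2_def using integral_nonneg_eq_0_iff_AE[OF L2_sq_integrable[OF assms]] by simp

lemma Cauchy_Schwarz_L2:
  assumes "f \<in> L2" "g \<in> L2"
  shows "cmod (inner2 f g) \<le> norm2 f * norm2 g"
proof (cases "norm2 g = 0")
  case True
  then have "AE x in lborel. g x = 0" using norm2_eq_0_iff assms by blast
  then have "inner2 f g = 0"
    unfolding inner2_def by (intro integral_eq_zero_AE) (auto elim!: eventually_mono)
  then show ?thesis using True by simp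
next
  case False
  \<comment> \<open>The scalar that minimises the norm of \<open>f + t g\<close>.\<close>
  define t where "t = - inner2 f g / of_real ((norm2 g)\<^sup>2)"
  have ng: "(norm2 g)\<^sup>2 > 0" using False by simp
  have "0 \<le> (norm2 f)\<^sup>2 + 2 * Re (cnj t * inner2 f g) + (cmod t)\<^sup>2 * (norm2 g)\<^sup>2"
    using norm2_sq_add_scaled[OF assms, of t] by (metis zero_le_power2)
  also have "cnj t * inner2 f g = - of_real ((cmod (inner2 f g))\<^sup>2 / (norm2 g)\<^sup>2)"
    by (simp only: t_def of_real_divide complex_norm_square) (simp add: mult.commute)
  also have "(cmod t)\<^sup>2 * (norm2 g)\<^sup>2 = (cmod (inner2 f g))\<^sup>2 / (norm2 g)\<^sup>2"
    using ng by (simp add: t_def norm_divide norm_mult power_divide power2_eq_square)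
  finally have "(cmod (inner2 f g))\<^sup>2 / (norm2 g)\<^sup>2 \<le> (norm2 f)\<^sup>2" by simp
  then have "(cmod (inner2 f g))\<^sup>2 \<le> (norm2 f * norm2 g)\<^sup>2"
    using ng by (simp add: field_simps power_mult_distrib)
  then show ?thesis by (rule power2_le_imp_le) simp
qed

lemma norm2_triangle:
  assumes "f \<in> L2" "g \<in> L2"
  shows "norm2 (\<lambda>x. f x + g x) \<le> norm2 f + norm2 g"
proof -
  have "(norm2 (\<lambda>x. f x + g x))\<^sup>2 = (norm2 f)\<^sup>2 + 2 * Re (inner2 f g) + (norm2 g)\<^sup>2"
    using norm2_sq_add_scaled[OF assms, of 1] by simp
  also have "\<dots> \<le> (norm2 f)\<^sup>2 + 2 * (norm2 f * norm2 g) + (norm2 g)\<^sup>2"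
    using Cauchy_Schwarz_L2[OF assms] complex_Re_le_cmod[of "inner2 f g"] by simp
  also have "\<dots> = (norm2 f + norm2 g)\<^sup>2" by (simp add: power2_sum)
  finally show ?thesis by (rule power2_le_imp_le) simp
qed

lemma inner2_cong_AE:
  assumes "f \<in> L2" "g \<in> L2" "h \<in> L2" "aeq f g" shows "inner2 f h = inner2 g h"
  unfolding inner2_def using assms[unfolded aeq_def] 
  by (intro integral_cong_AE) (auto intro!: borel_measurable_times borel_measurable_cnj L2_meas)

lemma inner2_tendsto:
  assumes "\<And>n. s n \<in> L2" "f \<in> L2" "g \<in> L2" "(\<lambda>n. norm2 (\<lambda>x. s n x - f x)) \<longlonglongrightarrow> 0"
  shows "(\<lambda>n. inner2 (s n) g) \<longlonglongrightarrow> inner2 f g"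
proof (rule LIM_zero_cancel, rule Lim_null_comparison)
  show "\<forall>\<^sub>F n in sequentially. cmod (inner2 (s n) g - inner2 f g) \<le> norm2 (\<lambda>x. s n x - f x) * norm2 g"
    using Cauchy_Schwarz_L2[OF L2_diff[OF assms(1,2)] assms(3)] assms
    by (intro always_eventually) (simp add: inner2_diff_left)
  show "(\<lambda>n. norm2 (\<lambda>x. s n x - f x) * norm2 g) \<longlonglongrightarrow> 0"
    using tendsto_mult_right[OF assms(4), of "norm2 g"] by simp
qed

section \<open>Completeness and orthogonal projections\<close>

text \<open>The weights 2^n still leave integrals of at most (1/2)^n, so \<open>D n x\<close> is
  summable in \<open>n\<close> for almost every \<open>x\<close>. In particular it is bounded in
  \<open>n\<close> there, which makes the increments decay like (1 / sqrt 2)^n.\<close>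

lemma L2_fast_Cauchy_limit:
  assumes s: "\<And>n. s n \<in> L2" and d: "\<And>n. (norm2 (\<lambda>x. s (Suc n) x - s n x))\<^sup>2 \<le> (1/4)^n"
  shows "\<exists>f. f \<in> borel_measurable borel \<and> (AE x in lborel. (\<lambda>n. s n x) \<longlonglongrightarrow> f x)"
proof -
  have [measurable]: "s n \<in> borel_measurable borel" for n using s L2_meas by blast
  define D where "D = (\<lambda>n x. 2 ^ n * (cmod (s (Suc n) x - s n x))\<^sup>2)"
  have [measurable]: "D n \<in> borel_measurable borel" for n unfolding D_def by measurable
  have int: "integrable lborel (D n)" for n
    unfolding D_def using L2_sq_integrable[OF L2_diff[OF s s]] by simp
  have nn: "0 \<le> D n x" for n x by (simp add: D_def)
  have le: "(\<integral>\<^sup>+ x. ennreal (D n x) \<partial>lborel) \<le> ennreal ((1/2)^n)" for n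
  proof -
    have "(\<integral>\<^sup>+ x. ennreal (D n x) \<partial>lborel) = ennreal (LINT x|lborel. D n x)"
      using int nn by (intro nn_integral_eq_integral) auto
    also have "(LINT x|lborel. D n x) = 2 ^ n * (norm2 (\<lambda>x. s (Suc n) x - s n x))\<^sup>2"
      by (simp add: D_def norm2_sq)
    also have "\<dots> \<le> 2 ^ n * (1/4)^n" using d by simp
    also have "\<dots> = (1/2)^n" by (simp flip: power_mult_distrib)
    finally show ?thesis by (simp add: ennreal_leI)
  qed
  have "(\<integral>\<^sup>+ x. (\<Sum>n. ennreal (D n x)) \<partial>lborel) = (\<Sum>n. \<integral>\<^sup>+ x. ennreal (D n x) \<partial>lborel)"
    by (intro nn_integral_suminf) simp
  also have "\<dots> \<le> (\<Sum>n. ennreal ((1/2)^n))"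
    using le by (intro suminf_le) auto
  also have "\<dots> = ennreal (\<Sum>n. (1/2)^n)"
    by (rule suminf_ennreal_eq[OF _ summable_sums]) (auto simp: summable_geometric)
  also have "\<dots> < \<infinity>" by simp
  finally have "(\<integral>\<^sup>+ x. (\<Sum>n. ennreal (D n x)) \<partial>lborel) \<noteq> \<infinity>" by simp
  then have "AE x in lborel. (\<Sum>n. ennreal (D n x)) \<noteq> \<infinity>"
    by (intro nn_integral_PInf_AE) auto
  then have conv: "AE x in lborel. convergent (\<lambda>n. s n x)"
  proof eventually_elim
    case (elim x)
    then have sD: "summable (\<lambda>n. D n x)"
      using nn by (intro summable_suminf_not_top) auto
    have C: "D n x \<le> (\<Sum>n. D n x)" for n
      using sum_le_suminf[OF sD, of "{n}"] nn by simp
    define C where "C = (\<Sum>n. D n x)"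
    have b: "cmod (s (Suc n) x - s n x) \<le> sqrt C * (1 / sqrt 2) ^ n" for n
    proof -
      have "(cmod (s (Suc n) x - s n x))\<^sup>2 \<le> C / 2 ^ n"
        using C[of n] unfolding C_def[symmetric] by (simp add: D_def field_simps)
      then have "sqrt ((cmod (s (Suc n) x - s n x))\<^sup>2) \<le> sqrt (C / 2 ^ n)"
        by (rule real_sqrt_le_mono)
      then show ?thesis by (simp add: real_sqrt_divide real_sqrt_power power_divide)
    qed
    have "summable (\<lambda>n. sqrt C * (1 / sqrt 2) ^ n)"
      by (intro summable_mult summable_geometric) simp
    then have "summable (\<lambda>n. s (Suc n) x - s n x)"
      using b by (rule summable_comparison_test'[where N = 0])
    then have "(\<lambda>n. \<Sum>k<n. s (Suc k) x - s k x) \<longlonglongrightarrow> (\<Sum>n. s (Suc n) x - s n x)"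
      by (rule summable_LIMSEQ)
    then have "(\<lambda>n. s n x - s 0 x) \<longlonglongrightarrow> (\<Sum>n. s (Suc n) x - s n x)"
      using sum_lessThan_telescope[of "\<lambda>n. s n x"] by simp
    from tendsto_add[OF this tendsto_const[of "s 0 x"]] show ?case
      by (auto simp: convergent_def)
  qed
  define f where "f = (\<lambda>x. lim (\<lambda>n. s n x))"
  have "f \<in> borel_measurable borel" unfolding f_def by measurable
  moreover have "AE x in lborel. (\<lambda>n. s n x) \<longlonglongrightarrow> f x"
    using conv by eventually_elim (simp add: f_def convergent_LIMSEQ_iff)
  ultimately show ?thesis by blast
qed

lemma L2_Fatou:
  assumes g: "\<And>k. g k \<in> L2" and b: "\<forall>\<^sub>F k in sequentially. norm2 (g k) \<le> B" and B: "0 \<le> B"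
    and f[measurable]: "f \<in> borel_measurable borel" and lim: "AE x in lborel. (\<lambda>k. g k x) \<longlonglongrightarrow> f x"
  shows "f \<in> L2" "norm2 f \<le> B"
proof -
  have [measurable]: "g n \<in> borel_measurable borel" for n using g L2_meas by blast
  have "(\<integral>\<^sup>+ x. ennreal ((cmod (f x))\<^sup>2) \<partial>lborel) = (\<integral>\<^sup>+ x. liminf (\<lambda>k. ennreal ((cmod (g k x))\<^sup>2)) \<partial>lborel)"
  proof (rule nn_integral_cong_AE)
    show "AE x in lborel. ennreal ((cmod (f x))\<^sup>2) = liminf (\<lambda>k. ennreal ((cmod (g k x))\<^sup>2))"
      using lim
    proof eventually_elim
      case (elim x)
      then have "(\<lambda>k. ennreal ((cmod (g k x))\<^sup>2)) \<longlonglongrightarrow> ennreal ((cmod (f x))\<^sup>2)"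
        by (intro tendsto_intros)
      then show ?case by (rule lim_imp_Liminf[OF sequentially_bot, symmetric])
    qed
  qed
  also have "\<dots> \<le> liminf (\<lambda>k. \<integral>\<^sup>+ x. ennreal ((cmod (g k x))\<^sup>2) \<partial>lborel)"
    by (intro nn_integral_liminf) measurable
  also have "\<dots> = liminf (\<lambda>k. ennreal ((norm2 (g k))\<^sup>2))"
    using L2_sq_integrable[OF g] by (subst nn_integral_eq_integral) (auto simp: norm2_sq)
  also have "\<dots> \<le> liminf (\<lambda>k. ennreal (B\<^sup>2))"
    using b by (intro Liminf_mono) (auto elim!: eventually_mono intro!: ennreal_leI power_mono)
  also have "\<dots> = ennreal (B\<^sup>2)" by (simp add: Liminf_const)
  finally have le: "(\<integral>\<^sup>+ x. ennreal ((cmod (f x))\<^sup>2) \<partial>lborel) \<le> ennreal (B\<^sup>2)" .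
  then have int: "integrable lborel (\<lambda>x. (cmod (f x))\<^sup>2)"
    by (intro integrableI_bounded) (auto simp: le_less_trans[OF le])
  then show "f \<in> L2" by (simp add: L2_def)
  have "ennreal ((norm2 f)\<^sup>2) \<le> ennreal (B\<^sup>2)"
    using le int by (simp add: norm2_sq nn_integral_eq_integral)
  then have "(norm2 f)\<^sup>2 \<le> B\<^sup>2" by simp
  then show "norm2 f \<le> B" by (rule power2_le_imp_le) (rule B)
qed

text \<open>A subsequence with fast decreasing increments converges almost everywhere; Fatou's lemma
  turns this pointwise limit into a norm limit of the whole sequence.\<close>

lemma L2_complete:
  assumes s: "\<And>n. s n \<in> L2"
    and C: "\<And>e. e > 0 \<Longrightarrow> \<exists>N. \<forall>m\<ge>N. \<forall>n\<ge>N. norm2 (\<lambda>x. s m x - s n x) < e"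
  shows "\<exists>f\<in>L2. (\<lambda>n. norm2 (\<lambda>x. s n x - f x)) \<longlonglongrightarrow> 0"
proof -
  have "\<forall>k. \<exists>N. \<forall>m\<ge>N. \<forall>n\<ge>N. norm2 (\<lambda>x. s m x - s n x) < (1/2)^k"
    using C by simp
  then obtain N where N: "\<And>k m n. m \<ge> N k \<Longrightarrow> n \<ge> N k \<Longrightarrow> norm2 (\<lambda>x. s m x - s n x) < (1/2)^k"
    by metis
  \<comment> \<open>Summing the thresholds makes \<open>r\<close> monotone while keeping
    \<open>N k \<le> r k\<close>.\<close>
  define r where "r = (\<lambda>k. sum N {..k})"
  have rN: "N k \<le> r k" for k unfolding r_def by (intro member_le_sum) auto
  have rm: "r k \<le> r l" if "k \<le> l" for k l unfolding r_def using that by (intro sum_mono2) auto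
  have "\<exists>f. f \<in> borel_measurable borel \<and> (AE x in lborel. (\<lambda>n. s (r n) x) \<longlonglongrightarrow> f x)"
  proof (rule L2_fast_Cauchy_limit)
    fix n
    have "N n \<le> r n" "N n \<le> r (Suc n)" using rN[of n] rm[of n "Suc n"] by auto
    then have "norm2 (\<lambda>x. s (r (Suc n)) x - s (r n) x) \<le> (1/2)^n" using N[of n] less_imp_le by blast
    then have "(norm2 (\<lambda>x. s (r (Suc n)) x - s (r n) x))\<^sup>2 \<le> ((1/2)^n)\<^sup>2" by (intro power_mono) auto
    also have "\<dots> = (1/4)^n" by (simp add: power2_eq_square flip: power_mult_distrib)
    finally show "(norm2 (\<lambda>x. s (r (Suc n)) x - s (r n) x))\<^sup>2 \<le> (1/4)^n" .
  qed (rule s)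
  then obtain f where f: "f \<in> borel_measurable borel" "AE x in lborel. (\<lambda>n. s (r n) x) \<longlonglongrightarrow> f x" by blast
  have F: "(\<lambda>x. s n x - f x) \<in> L2 \<and> norm2 (\<lambda>x. s n x - f x) \<le> (1/2)^k" if "n \<ge> N k" for n k
  proof -
    have b: "\<forall>\<^sub>F l in sequentially. norm2 (\<lambda>x. s n x - s (r l) x) \<le> (1/2)^k"
      using eventually_ge_at_top[of k]
    proof eventually_elim
      case (elim l)
      then have "N k \<le> r l" using rN[of k] rm[of k l] by simp
      then show ?case using N[OF that] less_imp_le by blast
    qed
    have m: "(\<lambda>x. s n x - f x) \<in> borel_measurable borel" using f(1) s[THEN L2_meas] by simp
    have l: "AE x in lborel. (\<lambda>l. s n x - s (r l) x) \<longlonglongrightarrow> s n x - f x"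
      using f(2) by eventually_elim (intro tendsto_intros)
    show ?thesis
      using L2_Fatou[OF L2_diff[OF s s] b _ m l] by simp
  qed
  have "f \<in> L2"
    using L2_diff[OF s[of "N 0"] conjunct1[OF F[of 0 "N 0"]]] by simp
  moreover have "(\<lambda>n. norm2 (\<lambda>x. s n x - f x)) \<longlonglongrightarrow> 0"
  proof (rule LIMSEQ_I)
    fix e :: real assume "e > 0"
    then obtain k where "(1/2)^k < e" using real_arch_pow_inv[of e "1/2"] by auto
    then have "\<forall>n\<ge>N k. norm (norm2 (\<lambda>x. s n x - f x) - 0) < e" using F[of k] by fastforce
    then show "\<exists>no. \<forall>n\<ge>no. norm (norm2 (\<lambda>x. s n x - f x) - 0) < e" by blast
  qed
  ultimately show ?thesis by blast
qed

lemma norm2_parallelogram: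
  assumes "f \<in> L2" "g \<in> L2"
  shows "(norm2 (\<lambda>x. f x - g x))\<^sup>2 + (norm2 (\<lambda>x. f x + g x))\<^sup>2 = 2 * (norm2 f)\<^sup>2 + 2 * (norm2 g)\<^sup>2"
  using norm2_sq_add_scaled[OF assms, of 1] norm2_sq_add_scaled[OF assms, of "-1"] by simp

lemma closed_subspaceD:
  assumes "closed_subspace K"
  shows "K \<subseteq> L2" "(\<lambda>x. 0) \<in> K" "\<And>f g a b. f \<in> K \<Longrightarrow> g \<in> K \<Longrightarrow> (\<lambda>x. a * f x + b * g x) \<in> K"
    "\<And>f g. f \<in> K \<Longrightarrow> g \<in> L2 \<Longrightarrow> aeq f g \<Longrightarrow> g \<in> K"
    "\<And>s f. (\<And>n. s n \<in> K) \<Longrightarrow> f \<in> L2 \<Longrightarrow> (\<lambda>n. norm2 (\<lambda>x. s n x - f x)) \<longlonglongrightarrow> 0 \<Longrightarrow> f \<in> K"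
  using assms unfolding closed_subspace_def by blast+

text \<open>The parallelogram law makes a minimising sequence Cauchy. At the minimiser, a nonzero
  inner product with some \<open>h\<close> would allow a strictly shorter difference.\<close>

lemma orthogonal_projection:
  assumes K: "closed_subspace K" and v: "v \<in> L2"
  shows "\<exists>k\<in>K. \<forall>h\<in>K. inner2 (\<lambda>x. v x - k x) h = 0"
proof -
  note KL = subsetD[OF closed_subspaceD(1)[OF K]]
  define q where "q = (\<lambda>k. (norm2 (\<lambda>x. v x - k x))\<^sup>2)"
  define d where "d = Inf (q ` K)"
  have bb: "bdd_below (q ` K)" by (intro bdd_belowI[of _ 0]) (auto simp: q_def)
  have dle: "d \<le> q k" if "k \<in> K" for k unfolding d_def using that bb by (intro cInf_lower) auto
  have "\<exists>k\<in>K. q k < d + 1 / real (Suc n)" for n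
  proof -
    have "q ` K \<noteq> {}" using closed_subspaceD(2)[OF K] by blast
    then have "\<exists>y\<in>q ` K. y < d + 1 / real (Suc n)"
      unfolding d_def using bb by (subst cInf_less_iff[symmetric]) auto
    then show ?thesis by blast
  qed
  then obtain k where k: "\<And>n. k n \<in> K" "\<And>n. q (k n) < d + 1 / real (Suc n)" by metis
  have dist: "(norm2 (\<lambda>x. k m x - k n x))\<^sup>2 \<le> 2 / real (Suc m) + 2 / real (Suc n)" for m n
  proof -
    have "(norm2 (\<lambda>x. (v x - k n x) - (v x - k m x)))\<^sup>2 + (norm2 (\<lambda>x. (v x - k n x) + (v x - k m x)))\<^sup>2
        = 2 * q (k n) + 2 * q (k m)"
      unfolding q_def by (intro norm2_parallelogram L2_diff v KL[OF k(1)])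
    moreover have "(\<lambda>x. (v x - k n x) + (v x - k m x)) = (\<lambda>x. 2 * (v x - (1/2 * k n x + 1/2 * k m x)))"
      by (auto simp: algebra_simps)
    then have "(norm2 (\<lambda>x. (v x - k n x) + (v x - k m x)))\<^sup>2 = 4 * q (\<lambda>x. 1/2 * k n x + 1/2 * k m x)"
      by (simp only: norm2_scale q_def) (simp add: power_mult_distrib)
    moreover have "d \<le> q (\<lambda>x. 1/2 * k n x + 1/2 * k m x)"
      by (intro dle closed_subspaceD(3)[OF K] k)
    ultimately show ?thesis using k(2)[of n] k(2)[of m] by simp
  qed
  have "\<exists>f\<in>L2. (\<lambda>n. norm2 (\<lambda>x. k n x - f x)) \<longlonglongrightarrow> 0"
  proof (rule L2_complete)
    fix e :: real assume e: "e > 0"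
    then obtain N where N: "4 / e\<^sup>2 < real N" using reals_Archimedean2 by blast
    have "norm2 (\<lambda>x. k m x - k n x) < e" if "m \<ge> N" "n \<ge> N" for m n
    proof -
      have "real N > 0" using N e by (meson divide_pos_pos less_trans zero_less_numeral zero_less_power)
      then have "2 / real (Suc m) \<le> 2 / real N" "2 / real (Suc n) \<le> 2 / real N"
        using that by (auto intro!: divide_left_mono)
      then have "(norm2 (\<lambda>x. k m x - k n x))\<^sup>2 \<le> 4 / real N" using dist[of m n] by simp
      also have "\<dots> < e\<^sup>2" using N e \<open>real N > 0\<close> by (simp add: field_simps)
      finally show ?thesis using e by (simp add: power2_less_imp_less)
    qed
    then show "\<exists>N. \<forall>m\<ge>N. \<forall>n\<ge>N. norm2 (\<lambda>x. k m x - k n x) < e" by blast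
  qed (use k KL in blast)
  then obtain f where f: "f \<in> L2" "(\<lambda>n. norm2 (\<lambda>x. k n x - f x)) \<longlonglongrightarrow> 0" by blast
  have fK: "f \<in> K" using closed_subspaceD(5)[OF K k(1) f] .
  have qf: "q f \<le> d"
  proof -
    have "norm2 (\<lambda>x. v x - f x) \<le> sqrt (d + 1 / real (Suc n)) + norm2 (\<lambda>x. k n x - f x)" for n
    proof -
      have "norm2 (\<lambda>x. (v x - k n x) + (k n x - f x)) \<le> norm2 (\<lambda>x. v x - k n x) + norm2 (\<lambda>x. k n x - f x)"
        by (intro norm2_triangle L2_diff v KL[OF k(1)] f(1))
      moreover have "norm2 (\<lambda>x. v x - k n x) \<le> sqrt (d + 1 / real (Suc n))"
        using k(2)[of n] by (intro real_le_rsqrt) (simp add: q_def)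
      ultimately show ?thesis by simp
    qed
    moreover have "(\<lambda>n. sqrt (d + 1 / real (Suc n)) + norm2 (\<lambda>x. k n x - f x)) \<longlonglongrightarrow> sqrt (d + 0) + 0"
      by (intro tendsto_intros f LIMSEQ_Suc[OF lim_1_over_n])
    ultimately have "norm2 (\<lambda>x. v x - f x) \<le> sqrt d"
      by (intro LIMSEQ_le_const[where X = "\<lambda>n. sqrt (d + 1 / real (Suc n)) + norm2 (\<lambda>x. k n x - f x)"]) auto
    moreover have "0 \<le> d" unfolding d_def using closed_subspaceD(2)[OF K]
      by (intro cInf_greatest) (auto simp: q_def)
    ultimately have "(norm2 (\<lambda>x. v x - f x))\<^sup>2 \<le> (sqrt d)\<^sup>2" by (intro power_mono) auto
    then show ?thesis using \<open>0 \<le> d\<close> by (simp add: q_def)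
  qed
  have "inner2 (\<lambda>x. v x - f x) h = 0" if h: "h \<in> K" for h
  proof (rule ccontr)
    define e where "e = (\<lambda>x. v x - f x)"
    assume "inner2 (\<lambda>x. v x - f x) h \<noteq> 0"
    then have i: "inner2 e h \<noteq> 0" by (simp add: e_def)
    have e: "e \<in> L2" unfolding e_def by (intro L2_diff v f)
    have hL: "h \<in> L2" using h KL by blast
    define a where "a = cmod (inner2 e h)"
    \<comment> \<open>The summand 1 keeps the denominator positive and makes \<open>t\<close> times
      the squared norm of \<open>h\<close> smaller than 1, so that the linear gain outweighs the
      quadratic loss.\<close>
    define t where "t = 1 / ((norm2 h)\<^sup>2 + 1)"
    have t: "t > 0" "t * (norm2 h)\<^sup>2 < 1"
      using add_nonneg_pos[OF zero_le_power2[of "norm2 h"] zero_less_one] by (simp_all add: t_def)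
    have "d \<le> q (\<lambda>x. 1 * f x + (of_real t * inner2 e h) * h x)"
      by (intro dle closed_subspaceD(3)[OF K] fK h)
    also have "\<dots> = (norm2 (\<lambda>x. e x + (- of_real t * inner2 e h) * h x))\<^sup>2"
      unfolding q_def e_def by (intro arg_cong[where f = "\<lambda>u. (norm2 u)\<^sup>2"]) (auto simp: algebra_simps)
    also have "\<dots> = (norm2 e)\<^sup>2 + 2 * Re (cnj (- of_real t * inner2 e h) * inner2 e h)
         + (cmod (- of_real t * inner2 e h))\<^sup>2 * (norm2 h)\<^sup>2"
      by (rule norm2_sq_add_scaled[OF e hL])
    also have "cnj (- of_real t * inner2 e h) * inner2 e h = of_real (- t * a\<^sup>2)"
      unfolding a_def of_real_mult complex_norm_square by simp
    also have "(cmod (- of_real t * inner2 e h))\<^sup>2 = t\<^sup>2 * a\<^sup>2"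
      using t by (simp add: norm_mult a_def power_mult_distrib)
    finally have "d \<le> (norm2 e)\<^sup>2 - 2 * t * a\<^sup>2 + t\<^sup>2 * a\<^sup>2 * (norm2 h)\<^sup>2" by simp
    also have "t\<^sup>2 * a\<^sup>2 * (norm2 h)\<^sup>2 = t * a\<^sup>2 * (t * (norm2 h)\<^sup>2)" by (simp add: power2_eq_square)
    also have "t * a\<^sup>2 * (t * (norm2 h)\<^sup>2) \<le> t * a\<^sup>2 * 1" using t by (intro mult_left_mono) auto
    finally have "t * a\<^sup>2 \<le> (norm2 e)\<^sup>2 - d" by simp
    also have "\<dots> \<le> 0" using qf by (simp add: q_def e_def)
    finally show False using t i by (simp add: a_def mult_le_0_iff)
  qed
  then show ?thesis using fK by blast
qed

text \<open>Projecting \<open>v\<close> to \<open>K\<close> leaves a remainder orthogonal to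
  \<open>K\<close>, hence to \<open>v\<close> and to itself. The invariance proofs below rest on
  this: membership in \<open>K\<close> becomes the vanishing of inner products.\<close>

lemma closed_subspace_mem_iff:
  assumes K: "closed_subspace K" and v: "v \<in> L2"
  shows "v \<in> K \<longleftrightarrow> (\<forall>g\<in>L2. (\<forall>h\<in>K. inner2 h g = 0) \<longrightarrow> inner2 v g = 0)"
proof
  assume R: "\<forall>g\<in>L2. (\<forall>h\<in>K. inner2 h g = 0) \<longrightarrow> inner2 v g = 0"
  obtain k where k: "k \<in> K" "\<And>h. h \<in> K \<Longrightarrow> inner2 (\<lambda>x. v x - k x) h = 0"
    using orthogonal_projection[OF assms] by blast
  have kL: "k \<in> L2" using k closed_subspaceD(1)[OF K] by blast
  define e where "e = (\<lambda>x. v x - k x)"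
  have e: "e \<in> L2" unfolding e_def by (intro L2_diff v kL)
  have p: "inner2 h e = 0" if "h \<in> K" for h
    using k(2)[OF that] inner2_commute[of h e] by (simp add: e_def)
  have "inner2 e e = inner2 v e - inner2 k e"
    unfolding e_def by (intro inner2_diff_left v kL L2_diff)
  also have "\<dots> = 0" using R e p k(1) by simp
  finally have "norm2 e = 0" by (simp add: inner2_self)
  then have "AE x in lborel. e x = 0" using norm2_eq_0_iff[OF e] by simp
  then have "aeq k v" unfolding aeq_def by eventually_elim (simp add: e_def)
  then show "v \<in> K" using closed_subspaceD(4)[OF K k(1) v] by simp
qed auto

section \<open>Cauchy integrals and Fourier transforms on the real line\<close>

lemma integral_abs_bound_mult:
  fixes \<phi> u :: "real \<Rightarrow> complex"
  assumes "integrable lborel \<phi>" "u \<in> borel_measurable borel" "\<And>x. cmod (u x) \<le> C"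
  shows "integrable lborel (\<lambda>x. u x * \<phi> x)" "cmod (LINT x|lborel. u x * \<phi> x) \<le> C * (LINT x|lborel. cmod (\<phi> x))"
proof -
  have C: "0 \<le> C" using assms(3)[of 0] norm_ge_zero order_trans by blast
  have [measurable]: "\<phi> \<in> borel_measurable borel" using assms(1) borel_measurable_integrable by force
  have b: "AE x in lborel. norm (u x * \<phi> x) \<le> norm (C * cmod (\<phi> x))"
    using assms(3) C by (auto simp: norm_mult intro!: mult_right_mono)
  show i: "integrable lborel (\<lambda>x. u x * \<phi> x)"
    by (rule Bochner_Integration.integrable_bound[OF _ _ b]) (use assms in auto)
  have "cmod (LINT x|lborel. u x * \<phi> x) \<le> (LINT x|lborel. C * cmod (\<phi> x))"
    by (rule order_trans[OF integral_norm_bound integral_mono])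
      (use assms integrable_norm[OF i] i C in \<open>auto simp: norm_mult intro!: mult_right_mono\<close>)
  then show "cmod (LINT x|lborel. u x * \<phi> x) \<le> C * (LINT x|lborel. cmod (\<phi> x))" by simp
qed

text \<open>\<open>cauchy \<phi> z\<close> is, up to the factor \<open>2 \<pi> \<i>\<close>, the Cauchy integral of \<open>\<phi>\<close>; the Hardy space \<open>H\<^sup>1\<close> of the upper
  half-plane consists of the integrable \<open>\<phi>\<close> with \<open>fourier \<phi> l = 0\<close> for all \<open>l \<ge> 0\<close>.\<close>

definition cauchy :: "fn \<Rightarrow> complex \<Rightarrow> complex" where
  "cauchy \<phi> z = (LINT x|lborel. inverse (of_real x - z) * \<phi> x)"

definition fourier :: "fn \<Rightarrow> real \<Rightarrow> complex" where
  "fourier \<phi> l = (LINT x|lborel. exp (\<i> * of_real (l * x)) * \<phi> x)"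

lemma norm_exp_i_times_real [simp]: "cmod (exp (\<i> * complex_of_real x)) = 1"
  by (simp add: norm_exp_eq_Re)

lemma inverse_eq_inverse_plus:
  fixes a b :: complex
  assumes "a \<noteq> 0" "b \<noteq> 0"
  shows "inverse a = inverse b + (b - a) * (inverse a * inverse b)"
  using assms by (simp add: field_simps)

lemma cauchy_kernel_bound:
  assumes "Im z \<noteq> 0"
  shows "cmod (inverse (of_real x - z)) \<le> 1 / \<bar>Im z\<bar>"
proof -
  have "\<bar>Im z\<bar> \<le> cmod (of_real x - z)" using abs_Im_le_cmod[of "of_real x - z"] by simp
  then show ?thesis using assms by (simp add: norm_inverse inverse_eq_divide[of "cmod _"] frac_le)
qed

lemma cauchy_integrable:
  assumes "integrable lborel \<phi>" "Im z \<noteq> 0"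
  shows "integrable lborel (\<lambda>x. inverse (of_real x - z) * \<phi> x)"
  by (rule integral_abs_bound_mult(1)[OF assms(1) _ cauchy_kernel_bound[OF assms(2)]]) simp

lemma cauchy_bound:
  assumes "integrable lborel \<phi>" "Im z \<noteq> 0"
  shows "cmod (cauchy \<phi> z) \<le> (LINT x|lborel. cmod (\<phi> x)) / \<bar>Im z\<bar>"
  using integral_abs_bound_mult(2)[OF assms(1) _ cauchy_kernel_bound[OF assms(2)]] by (simp add: cauchy_def)

lemma cauchy_bound_Im_ge_1:
  assumes "integrable lborel \<phi>" "1 \<le> Im z"
  shows "cmod (cauchy \<phi> z) \<le> (LINT x|lborel. cmod (\<phi> x))"
proof -
  have "cmod (cauchy \<phi> z) \<le> (LINT x|lborel. cmod (\<phi> x)) / \<bar>Im z\<bar>"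
    using assms by (intro cauchy_bound) auto
  also have "\<dots> \<le> (LINT x|lborel. cmod (\<phi> x)) / 1"
    using assms(2) by (intro divide_left_mono) auto
  finally show ?thesis by simp
qed

lemma fourier_integrable:
  assumes "integrable lborel \<phi>"
  shows "integrable lborel (\<lambda>x. exp (\<i> * of_real (l * x)) * \<phi> x)"
  by (rule integral_abs_bound_mult(1)[OF assms, of _ 1]) (auto simp del: of_real_mult)

lemma fourier_bound:
  assumes "integrable lborel \<phi>"
  shows "cmod (fourier \<phi> l) \<le> (LINT x|lborel. cmod (\<phi> x))"
  using integral_abs_bound_mult(2)[OF assms, of "\<lambda>x. exp (\<i> * of_real (l * x))" 1]
  by (auto simp: fourier_def simp del: of_real_mult)

lemma fourier_tendsto:
  assumes "integrable lborel \<phi>" "l \<longlonglongrightarrow> a"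
  shows "(\<lambda>n. fourier \<phi> (l n)) \<longlonglongrightarrow> fourier \<phi> a"
  unfolding fourier_def
proof (rule integral_dominated_convergence[where w = "\<lambda>x. cmod (\<phi> x)"])
  have [measurable]: "\<phi> \<in> borel_measurable borel" using assms(1) borel_measurable_integrable by force
  show "(\<lambda>x. exp (\<i> * of_real (a * x)) * \<phi> x) \<in> borel_measurable lborel" by simp
  show "(\<lambda>x. exp (\<i> * of_real (l n * x)) * \<phi> x) \<in> borel_measurable lborel" for n by simp
  show "integrable lborel (\<lambda>x. cmod (\<phi> x))" using assms(1) by simp
  show "AE x in lborel. (\<lambda>n. exp (\<i> * of_real (l n * x)) * \<phi> x) \<longlonglongrightarrow> exp (\<i> * of_real (a * x)) * \<phi> x"
    by (intro AE_I2 tendsto_intros assms(2))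
  show "AE x in lborel. norm (exp (\<i> * of_real (l n * x)) * \<phi> x) \<le> cmod (\<phi> x)" for n
    by (intro AE_I2) (simp add: norm_mult del: of_real_mult)
qed

lemma fourier_continuous:
  assumes "integrable lborel \<phi>"
  shows "continuous_on UNIV (fourier \<phi>)"
  by (auto simp: continuous_on_sequentially o_def intro!: fourier_tendsto[OF assms])

text \<open>The difference quotient minus the candidate derivative is \<open>w - z\<close> times an
  integral against a kernel bounded for \<open>w\<close> near \<open>z\<close>, which gives an
  explicit linear bound.\<close>

lemma cauchy_holomorphic:
  assumes \<phi>: "integrable lborel \<phi>"
  shows "cauchy \<phi> holomorphic_on {z. 0 < Im z}"
proof -
  have "(cauchy \<phi> has_field_derivative (LINT x|lborel. (inverse (of_real x - z))\<^sup>2 * \<phi> x)) (at z)" if z: "0 < Im z" for z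
  proof -
    have b2: "cmod ((inverse (of_real x - z))\<^sup>2) \<le> (1 / Im z)\<^sup>2" for x
      using cauchy_kernel_bound[of z x] z by (simp only: norm_power) (auto intro!: power_mono)
    define B where "B = (1 / Im z)\<^sup>2 * (2 / Im z) * (LINT x|lborel. cmod (\<phi> x))"
    have ev: "\<forall>\<^sub>F w in at z. cmod ((cauchy \<phi> w - cauchy \<phi> z) / (w - z) - (LINT x|lborel. (inverse (of_real x - z))\<^sup>2 * \<phi> x)) \<le> B * cmod (w - z)"
    proof -
      have "open {w. Im z / 2 < Im w}" by (rule open_halfspace_Im_gt)
      then have "\<forall>\<^sub>F w in at z. w \<in> {w. Im z / 2 < Im w}" using z by (intro eventually_at_in_open') auto
      then show ?thesis using eventually_neq_at_within[of z z UNIV]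
      proof eventually_elim
        case (elim w)
        then have w: "Im w > Im z / 2" "w \<noteq> z" "Im w > 0" using z by auto
        have nz: "of_real x - w \<noteq> 0" "of_real x - z \<noteq> 0" for x
          using w z by (auto simp: complex_eq_iff)
        have key: "inverse (of_real x - w) = inverse (of_real x - z) + (w - z) * (inverse (of_real x - w) * inverse (of_real x - z))" for x
          using inverse_eq_inverse_plus[OF nz(1)[of x] nz(2)[of x]] by simp
        have "cauchy \<phi> w - cauchy \<phi> z = (LINT x|lborel. inverse (of_real x - w) * \<phi> x - inverse (of_real x - z) * \<phi> x)"
          unfolding cauchy_def using z w by (intro Bochner_Integration.integral_diff[symmetric] cauchy_integrable \<phi>) auto
        then have "(cauchy \<phi> w - cauchy \<phi> z) / (w - z) =
            (LINT x|lborel. (inverse (of_real x - w) * \<phi> x - inverse (of_real x - z) * \<phi> x) / (w - z))"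
          by simp
        also have "\<dots> = (LINT x|lborel. (inverse (of_real x - w) * inverse (of_real x - z)) * \<phi> x)"
        proof (intro Bochner_Integration.integral_cong refl)
          fix x
          have "inverse (of_real x - w) * \<phi> x - inverse (of_real x - z) * \<phi> x
             = (w - z) * ((inverse (of_real x - w) * inverse (of_real x - z)) * \<phi> x)"
            by (subst key) (simp add: algebra_simps)
          then show "(inverse (of_real x - w) * \<phi> x - inverse (of_real x - z) * \<phi> x) / (w - z)
             = (inverse (of_real x - w) * inverse (of_real x - z)) * \<phi> x"
            using w by simp
        qed
        finally have q: "(cauchy \<phi> w - cauchy \<phi> z) / (w - z) = (LINT x|lborel. (inverse (of_real x - w) * inverse (of_real x - z)) * \<phi> x)" .
        have bw: "cmod (inverse (of_real x - w)) \<le> 2 / Im z" for x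
        proof -
          have "cmod (inverse (of_real x - w)) \<le> 1 / \<bar>Im w\<bar>" using w by (intro cauchy_kernel_bound) auto
          also have "\<dots> \<le> 2 / Im z" using w z by (simp add: field_simps)
          finally show ?thesis .
        qed
        have bz: "cmod (inverse (of_real x - z)) \<le> 1 / Im z" for x
          using cauchy_kernel_bound[of z x] z by simp
        have i1: "integrable lborel (\<lambda>x. (inverse (of_real x - w) * inverse (of_real x - z)) * \<phi> x)"
          using z by (intro integral_abs_bound_mult(1)[OF \<phi>, of _ "2 / Im z * (1 / Im z)"])
            (auto simp only: norm_mult intro!: mult_mono bw bz, auto)
        have i2: "integrable lborel (\<lambda>x. (inverse (of_real x - z))\<^sup>2 * \<phi> x)"
          by (rule integral_abs_bound_mult(1)[OF \<phi> _ b2]) simp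
        have "(cauchy \<phi> w - cauchy \<phi> z) / (w - z) - (LINT x|lborel. (inverse (of_real x - z))\<^sup>2 * \<phi> x)
           = (LINT x|lborel. (inverse (of_real x - w) * inverse (of_real x - z)) * \<phi> x - (inverse (of_real x - z))\<^sup>2 * \<phi> x)"
          unfolding q using i1 i2 by simp
        also have "\<dots> = (LINT x|lborel. ((w - z) * ((inverse (of_real x - z))\<^sup>2 * inverse (of_real x - w))) * \<phi> x)"
          by (intro Bochner_Integration.integral_cong refl, subst key) (simp add: algebra_simps power2_eq_square)
        also have "cmod \<dots> \<le> (cmod (w - z) * ((1 / Im z)\<^sup>2 * (2 / Im z))) * (LINT x|lborel. cmod (\<phi> x))"
        proof (rule integral_abs_bound_mult(2)[OF \<phi>])
          fix x show "cmod ((w - z) * ((inverse (of_real x - z))\<^sup>2 * inverse (of_real x - w))) \<le> cmod (w - z) * ((1 / Im z)\<^sup>2 * (2 / Im z))"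
            unfolding norm_mult using z by (intro mult_mono b2[unfolded norm_mult] bw) auto
        qed simp
        finally show ?case by (simp add: B_def algebra_simps)
      qed
    qed
    show ?thesis
      unfolding has_field_derivative_iff
    proof (rule LIM_zero_cancel, rule Lim_null_comparison[OF ev])
      have "((\<lambda>w. B * cmod (w - z)) \<longlongrightarrow> B * cmod (z - z)) (at z)" by (intro tendsto_intros)
      then show "((\<lambda>w. B * cmod (w - z)) \<longlongrightarrow> 0) (at z)" by simp
    qed
  qed
  then show ?thesis
    by (intro holomorphic_onI) (auto simp: field_differentiable_def intro: has_field_derivative_at_within)
qed

text \<open>Boundedness of the kernel makes the double integrand absolutely integrable. The kernels
  inserted later are exponentials, Poisson kernels and Cauchy kernels off the line.\<close>

lemma Fubini_kernel:
  fixes \<phi> g :: "real \<Rightarrow> complex" and k :: "real \<Rightarrow> real \<Rightarrow> complex"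
  assumes \<phi>: "integrable lborel \<phi>" and g: "integrable lborel g"
    and k[measurable]: "(\<lambda>(s, t). k s t) \<in> borel_measurable (borel \<Otimes>\<^sub>M borel)"
    and b: "\<And>s t. cmod (k s t) \<le> C"
  shows "(LINT s|lborel. g s * (LINT t|lborel. k s t * \<phi> t)) = (LINT t|lborel. (LINT s|lborel. g s * k s t) * \<phi> t)"
proof -
  have [measurable]: "\<phi> \<in> borel_measurable borel" "g \<in> borel_measurable borel"
    using \<phi> g borel_measurable_integrable by force+
  have C: "0 \<le> C" using b[of 0 0] norm_ge_zero order_trans by blast
  have int: "integrable (lborel \<Otimes>\<^sub>M lborel) (\<lambda>(s, t). g s * (k s t * \<phi> t))"
  proof (rule lborel_pair.Fubini_integrable)
    have i: "integrable lborel (\<lambda>t. g s * (k s t * \<phi> t))" for s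
      using integral_abs_bound_mult(1)[OF \<phi>, of "k s" C] b by simp
    then show "AE s in lborel. integrable lborel (\<lambda>t. case (s, t) of (s, t) \<Rightarrow> g s * (k s t * \<phi> t))"
      by simp
    show "integrable lborel (\<lambda>s. LINT t|lborel. norm (case (s, t) of (s, t) \<Rightarrow> g s * (k s t * \<phi> t)))"
    proof (rule Bochner_Integration.integrable_bound)
      show "integrable lborel (\<lambda>s. cmod (g s) * (C * (LINT t|lborel. cmod (\<phi> t))))"
        using g by (intro integrable_mult_left) simp
      have "(LINT t|lborel. cmod (g s * (k s t * \<phi> t))) \<le> cmod (g s) * (C * (LINT t|lborel. cmod (\<phi> t)))" for s
      proof -
        have "(LINT t|lborel. cmod (g s * (k s t * \<phi> t))) \<le> (LINT t|lborel. cmod (g s) * (C * cmod (\<phi> t)))"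
          using \<phi> integrable_norm[OF i[of s]] by (intro integral_mono) (auto simp: norm_mult intro!: mult_left_mono mult_right_mono b)
        then show ?thesis by simp
      qed
      then show "AE s in lborel. norm (LINT t|lborel. norm (case (s, t) of (s, t) \<Rightarrow> g s * (k s t * \<phi> t)))
          \<le> norm (cmod (g s) * (C * (LINT t|lborel. cmod (\<phi> t))))"
        using C by (intro AE_I2) (auto simp: integral_nonneg_AE)
    qed simp
  qed simp
  have "(LINT s|lborel. g s * (LINT t|lborel. k s t * \<phi> t)) = (LINT s|lborel. LINT t|lborel. g s * (k s t * \<phi> t))"
    by simp
  also have "\<dots> = (LINT t|lborel. LINT s|lborel. g s * (k s t * \<phi> t))"
    by (rule lborel_pair.Fubini_integral[OF int, symmetric])
  also have "\<dots> = (LINT t|lborel. LINT s|lborel. (g s * k s t) * \<phi> t)"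
    by (simp only: mult.assoc)
  also have "\<dots> = (LINT t|lborel. (LINT s|lborel. g s * k s t) * \<phi> t)"
    by simp
  finally show ?thesis .
qed

section \<open>Cauchy integrals as Laplace transforms of Fourier transforms\<close>

lemma exp_halfline:
  assumes a: "Re a < 0"
  shows "integrable lborel (\<lambda>l. indicator {0<..} l *\<^sub>R exp (a * of_real l))"
    and "(LINT l|lborel. indicator {0<..} l *\<^sub>R exp (a * of_real l)) = - inverse a"
proof -
  have a0: "a \<noteq> 0" using a by auto
  have "set_integrable lborel {0<..} (\<lambda>l. exp (- (l * (- Re a))))"
    using a by (intro integrable_I0i_exp_mscale) simp
  then have si: "set_integrable lborel {0<..} (\<lambda>l. exp (a * of_real l))"
    by (rule set_integrable_bound) (auto simp: set_borel_measurable_def mult.commute)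
  then show "integrable lborel (\<lambda>l. indicator {0<..} l *\<^sub>R exp (a * of_real l))"
    by (simp add: set_integrable_def)
  have ei: "einterval 0 \<infinity> = {0<..}" by (auto simp: einterval_def)
  have "(LBINT l=0..\<infinity>. exp (a * of_real l)) = 0 - inverse a"
  proof (rule interval_integral_FTC_integrable[where F = "\<lambda>l. exp (a * of_real l) / a"])
    show "((\<lambda>l. exp (a * of_real l) / a) has_vector_derivative exp (a * of_real x)) (at x)" for x
      by (rule has_vector_derivative_real_field) (use a0 in \<open>auto intro!: derivative_eq_intros\<close>)
    show "isCont (\<lambda>l. exp (a * complex_of_real l)) x" for x by (intro continuous_intros)
    show "set_integrable lborel (einterval 0 \<infinity>) (\<lambda>l. exp (a * complex_of_real l))" using si by (simp add: ei)
    have "((\<lambda>l. exp (a * complex_of_real l) / a) \<longlongrightarrow> exp (a * complex_of_real 0) / a) (at_right 0)"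
      by (intro tendsto_intros a0)
    then show "(((\<lambda>l. exp (a * complex_of_real l) / a) \<circ> real_of_ereal) \<longlongrightarrow> inverse a) (at_right 0)"
      by (simp add: ereal_tendsto_simps zero_ereal_def inverse_eq_divide)
    have "((\<lambda>l. exp (Re a * l) / cmod a) \<longlongrightarrow> 0) at_top"
      using a a0 by real_asymp
    then have "((\<lambda>l. exp (a * complex_of_real l) / a) \<longlongrightarrow> 0) at_top"
      by (rule Lim_null_comparison[rotated]) (simp add: norm_divide)
    then show "(((\<lambda>l. exp (a * complex_of_real l) / a) \<circ> real_of_ereal) \<longlongrightarrow> 0) (at_left \<infinity>)"
      by (simp add: ereal_tendsto_simps)
  qed simp
  then show "(LINT l|lborel. indicator {0<..} l *\<^sub>R exp (a * of_real l)) = - inverse a"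
    by (simp add: interval_lebesgue_integral_def ei set_lebesgue_integral_def)
qed

text \<open>With \<open>s = 1\<close> this covers the lower half-plane and with \<open>s = -1\<close> the upper one.\<close>

lemma cauchy_eq_laplace_fourier:
  fixes s :: real
  assumes \<phi>: "integrable lborel \<phi>" and s: "s = 1 \<or> s = -1" and w: "s * Im w < 0"
  shows "cauchy \<phi> w = - \<i> * of_real s *
    (LINT l|lborel. (indicator {0<..} l *\<^sub>R exp (- \<i> * of_real s * w * of_real l)) * fourier \<phi> (s * l))"
proof -
  define g where "g = (\<lambda>l::real. indicator {0<..} l *\<^sub>R exp (- \<i> * of_real s * w * of_real l))"
  have "Re (- \<i> * of_real s * w) < 0" using w by simp
  note E = exp_halfline[OF this]
  have g: "integrable lborel g" unfolding g_def using E(1) .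
  have "(LINT l|lborel. g l * fourier \<phi> (s * l)) =
      (LINT t|lborel. (LINT l|lborel. g l * exp (\<i> * of_real (s * l * t))) * \<phi> t)"
    unfolding fourier_def
    by (rule Fubini_kernel[OF \<phi> g, where C = 1]) (auto simp del: of_real_mult)
  also have "(\<lambda>t. LINT l|lborel. g l * exp (\<i> * of_real (s * l * t))) = (\<lambda>t. \<i> * of_real s * inverse (of_real t - w))"
  proof
    fix t :: real
    have r: "Re (\<i> * of_real s * (of_real t - w)) < 0" using w by simp
    have "(LINT l|lborel. g l * exp (\<i> * of_real (s * l * t)))
        = (LINT l|lborel. indicator {0<..} l *\<^sub>R exp (\<i> * of_real s * (of_real t - w) * of_real l))"
      unfolding g_def by (intro Bochner_Integration.integral_cong refl) (simp add: indicator_def mult_exp_exp algebra_simps)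
    also have "\<dots> = - inverse (\<i> * of_real s * (of_real t - w))" by (rule exp_halfline(2)[OF r])
    also have "\<dots> = \<i> * of_real s * inverse (of_real t - w)" using s by auto
    finally show "(LINT l|lborel. g l * exp (\<i> * of_real (s * l * t))) = \<i> * of_real s * inverse (of_real t - w)" .
  qed
  also have "(LINT t|lborel. \<i> * of_real s * inverse (of_real t - w) * \<phi> t) = \<i> * of_real s * cauchy \<phi> w"
    by (simp add: cauchy_def mult.assoc)
  finally show ?thesis using s unfolding g_def by auto
qed

text \<open>Below the real line the Laplace representation involves only frequencies
  \<open>l > 0\<close>.\<close>

lemma cauchy_eq_0_of_fourier_eq_0:
  assumes "integrable lborel \<phi>" "\<And>l. 0 \<le> l \<Longrightarrow> fourier \<phi> l = 0" "Im w < 0"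
  shows "cauchy \<phi> w = 0"
proof -
  have "(indicator {0<..} l *\<^sub>R exp (- \<i> * of_real 1 * w * of_real l)) * fourier \<phi> (1 * l) = 0" for l
    using assms(2)[of l] by (auto simp: indicator_def)
  then have "(LINT l|lborel. (indicator {0<..} l *\<^sub>R exp (- \<i> * of_real 1 * w * of_real l)) * fourier \<phi> (1 * l)) = 0"
    by (simp only: integral_zero)
  then show ?thesis using cauchy_eq_laplace_fourier[of \<phi> 1 w] assms(1,3) by simp
qed

section \<open>Uniqueness for Cauchy integrals and Fourier transforms\<close>

text \<open>Open intervals form an intersection-stable generator of the Borel sets, so Dynkin's
  lemma extends the vanishing to all of them. Complements need the total integral, which is a limit
  over growing intervals.\<close>

lemma AE_eq_0_of_interval_integrals:
  fixes \<phi> :: "real \<Rightarrow> complex"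
  assumes \<phi>: "integrable lborel \<phi>" and z: "\<And>a b. a < b \<Longrightarrow> (LINT x|lborel. indicator {a<..<b} x *\<^sub>R \<phi> x) = 0"
  shows "AE x in lborel. \<phi> x = 0"
proof (rule sigma_finite_measure.density_zero[OF lborel.sigma_finite_measure_axioms \<phi>])
  have ii: "integrable lborel (\<lambda>x. indicator A x *\<^sub>R \<phi> x)" if "A \<in> sets borel" for A
    using that \<phi> by (intro integrable_mult_indicator) auto
  have iv: "(LINT x|lborel. indicator A x *\<^sub>R \<phi> x) = 0" if A: "A \<in> range (\<lambda>(a, b). {a<..<b::real})" for A
  proof -
    obtain a b where "A = {a<..<b}" using A by auto
    then show ?thesis using z[of a b] by (cases "a < b") auto
  qed
  have G: "sets borel = sigma_sets UNIV (range (\<lambda>(a, b). {a<..<b::real}))"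
    by (subst borel_eq_box[where 'a = real, unfolded box_real]) simp
  have U: "(LINT x|lborel. \<phi> x) = 0"
  proof -
    have "(\<lambda>n. LINT x|lborel. indicator {- real (Suc n)<..<real (Suc n)} x *\<^sub>R \<phi> x) \<longlonglongrightarrow> (LINT x|lborel. \<phi> x)"
    proof (rule integral_dominated_convergence[where w = "\<lambda>x. cmod (\<phi> x)"])
      show "AE x in lborel. (\<lambda>n. indicator {- real (Suc n)<..<real (Suc n)} x *\<^sub>R \<phi> x) \<longlonglongrightarrow> \<phi> x"
      proof (rule AE_I2, rule tendsto_eventually)
        fix x :: real
        obtain N where "\<bar>x\<bar> < real N" using reals_Archimedean2 by blast
        then show "\<forall>\<^sub>F n in sequentially. indicator {- real (Suc n)<..<real (Suc n)} x *\<^sub>R \<phi> x = \<phi> x"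
          by (intro eventually_sequentiallyI[of N]) (auto simp: indicator_def)
      qed
    qed (use \<phi> ii in \<open>auto simp: indicator_def\<close>)
    moreover have "(LINT x|lborel. indicator {- real (Suc n)<..<real (Suc n)} x *\<^sub>R \<phi> x) = 0" for n
      by (rule z) simp
    ultimately show ?thesis by (simp add: LIMSEQ_const_iff)
  qed
  fix A :: "real set" assume "A \<in> sets lborel"
  then have A: "A \<in> sigma_sets UNIV (range (\<lambda>(a, b). {a<..<b::real}))"
    by (simp add: G)
  have "(LINT x|lborel. indicator A x *\<^sub>R \<phi> x) = 0"
  proof (rule sigma_sets_induct_disjoint[OF _ _ A, where P = "\<lambda>A. (LINT x|lborel. indicator A x *\<^sub>R \<phi> x) = 0"])
    show "Int_stable (range (\<lambda>(a, b). {a<..<b::real}))"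
      by (auto simp: Int_stable_def)
  next
    fix B assume B': "B \<in> sigma_sets UNIV (range (\<lambda>(a, b). {a<..<b::real}))" and IH: "(LINT x|lborel. indicator B x *\<^sub>R \<phi> x) = 0"
    then have B: "B \<in> sets borel" by (simp add: G)
    have "(LINT x|lborel. indicator (UNIV - B) x *\<^sub>R \<phi> x) = (LINT x|lborel. \<phi> x - indicator B x *\<^sub>R \<phi> x)"
      by (intro Bochner_Integration.integral_cong refl) (auto simp: indicator_def)
    also have "\<dots> = 0" using IH U ii[OF B] \<phi> by simp
    finally show "(LINT x|lborel. indicator (UNIV - B) x *\<^sub>R \<phi> x) = 0" .
  next
    fix B :: "nat \<Rightarrow> real set"
    assume d: "disjoint_family B" and B': "range B \<subseteq> sigma_sets UNIV (range (\<lambda>(a, b). {a<..<b::real}))"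
      and IH: "\<And>i. (LINT x|lborel. indicator (B i) x *\<^sub>R \<phi> x) = 0"
    then have B: "B i \<in> sets borel" for i by (auto simp: G)
    then have "(\<Union>i. B i) \<in> sets borel" by blast
    then have "(\<integral>x\<in>(\<Union>i. B i). \<phi> x \<partial>lborel) = (\<Sum>i. (\<integral>x\<in>B i. \<phi> x \<partial>lborel))"
      using B d ii by (intro lebesgue_integral_countable_add) (auto simp: disjoint_family_on_def set_integrable_def)
    then show "(LINT x|lborel. indicator (\<Union>i. B i) x *\<^sub>R \<phi> x) = 0" using IH by (simp add: set_lebesgue_integral_def)
  qed (use iv in auto)
  then show "set_lebesgue_integral lborel A \<phi> = 0" by (simp add: set_lebesgue_integral_def)
qed

lemma arctan_scaled_tendsto:
  fixes u :: real
  shows "u > 0 \<Longrightarrow> (\<lambda>n. arctan (u * real (Suc n))) \<longlonglongrightarrow> pi / 2"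
    and "u < 0 \<Longrightarrow> (\<lambda>n. arctan (u * real (Suc n))) \<longlonglongrightarrow> - (pi / 2)"
  by real_asymp+

text \<open>The jump of the Cauchy integral across the real line is the Poisson integral.\<close>

lemma AE_eq_0_of_cauchy_eq_0:
  assumes \<phi>: "integrable lborel \<phi>" and c0: "\<And>w. Im w \<noteq> 0 \<Longrightarrow> cauchy \<phi> w = 0"
  shows "AE x in lborel. \<phi> x = 0"
proof (rule AE_eq_0_of_interval_integrals[OF \<phi>])
  fix a b :: real assume ab: "a < b"
  have [measurable]: "\<phi> \<in> borel_measurable borel" using \<phi> borel_measurable_integrable by force
  \<comment> \<open>Up to the factor \<pi>, the Poisson kernel at height
    \<open>1 / real (Suc n)\<close>.\<close>
  define P where "P = (\<lambda>n s t. complex_of_real (real (Suc n) / (1 + ((t - s) * real (Suc n))\<^sup>2)))"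
  have Pc: "(LINT t|lborel. P n s t * \<phi> t) = 0" for n s
  proof -
    define y where "y = 1 / real (Suc n)"
    have y: "y > 0" by (simp add: y_def)
    have e: "P n s t = (inverse (of_real t - Complex s y) - inverse (of_real t - Complex s (- y))) / (2 * \<i>)" for t
    proof -
      have 1: "real (Suc n) / (1 + ((t - s) * real (Suc n))\<^sup>2) = y / ((t - s)\<^sup>2 + y\<^sup>2)"
      proof -
        have "1 + ((t - s) * real (Suc n))\<^sup>2 = (real (Suc n))\<^sup>2 * ((t - s)\<^sup>2 + y\<^sup>2)"
          by (simp add: y_def power_mult_distrib power_divide distrib_left del: of_nat_Suc)
        then show ?thesis by (simp only:) (simp add: y_def power2_eq_square del: of_nat_Suc)
      qed
      have nz: "of_real t - Complex s y \<noteq> 0" "of_real t - Complex s (- y) \<noteq> 0"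
        using y by (auto simp: complex_eq_iff)
      have "(of_real t - Complex s y) * (of_real t - Complex s (- y)) = of_real ((t - s)\<^sup>2 + y\<^sup>2)"
        by (simp add: complex_eq_iff power2_eq_square algebra_simps)
      moreover have "inverse (of_real t - Complex s y) - inverse (of_real t - Complex s (- y))
        = (2 * \<i> * of_real y) / ((of_real t - Complex s y) * (of_real t - Complex s (- y)))"
      proof -
        have "(of_real t - Complex s (- y)) - (of_real t - Complex s y) = 2 * \<i> * of_real y"
          by (simp add: complex_eq_iff)
        with inverse_eq_inverse_plus[OF nz] show ?thesis
          by (simp only: divide_inverse inverse_mult_distrib) (metis add_diff_cancel_left')
      qed
      ultimately have 2: "inverse (of_real t - Complex s y) - inverse (of_real t - Complex s (- y))
          = 2 * \<i> * of_real y / of_real ((t - s)\<^sup>2 + y\<^sup>2)" by (simp only:)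
      have "P n s t = of_real y / of_real ((t - s)\<^sup>2 + y\<^sup>2)" unfolding P_def 1 by (rule of_real_divide)
      also have "\<dots> = 2 * \<i> * of_real y / of_real ((t - s)\<^sup>2 + y\<^sup>2) / (2 * \<i>)"
      proof -
        have *: "a / b = c * a / b / c" if "c \<noteq> 0" for a b c :: complex using that by simp
        show ?thesis by (rule *) simp
      qed
      finally show ?thesis by (simp only: 2)
    qed
    have i: "integrable lborel (\<lambda>t. inverse (of_real t - Complex s y) * \<phi> t)"
       "integrable lborel (\<lambda>t. inverse (of_real t - Complex s (- y)) * \<phi> t)"
      using y by (auto intro!: cauchy_integrable \<phi>)
    have "(LINT t|lborel. P n s t * \<phi> t) = (LINT t|lborel. (inverse (of_real t - Complex s y) * \<phi> t - inverse (of_real t - Complex s (- y)) * \<phi> t) / (2 * \<i>))"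
      by (simp only: e) (simp add: algebra_simps)
    also have "\<dots> = (cauchy \<phi> (Complex s y) - cauchy \<phi> (Complex s (- y))) / (2 * \<i>)"
      using i by (simp add: cauchy_def)
    also have "\<dots> = 0" using c0 y by simp
    finally show ?thesis .
  qed
  \<comment> \<open>Integrating the kernel over \<open>s\<close> in the interval first gives a
    difference of arctangents, bounded by \<pi> and tending to \<pi> times the indicator off the end
    points. Dominated convergence then applies directly to the integral against
    \<open>\<phi>\<close>.\<close>
  define A where "A = (\<lambda>n t. arctan ((b - t) * real (Suc n)) - arctan ((a - t) * real (Suc n)))"
  have Pint: "(LINT s|lborel. complex_of_real (indicator {a..b} s) * P n s t) = of_real (A n t)" for n t
  proof -
    have "(LINT s|lborel. complex_of_real (indicator {a..b} s) * P n s t)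
       = (LINT s|lborel. complex_of_real (indicator {a..b} s *\<^sub>R (real (Suc n) / (1 + ((t - s) * real (Suc n))\<^sup>2))))"
      by (simp add: P_def)
    also have "\<dots> = of_real (LINT s|lborel. indicator {a..b} s *\<^sub>R (real (Suc n) / (1 + ((t - s) * real (Suc n))\<^sup>2)))"
      by (rule integral_complex_of_real)
    also have "(LINT s|lborel. indicator {a..b} s *\<^sub>R (real (Suc n) / (1 + ((t - s) * real (Suc n))\<^sup>2))) = A n t"
    proof -
      have "(LINT s|lborel. indicator {a..b} s *\<^sub>R (real (Suc n) / (1 + ((t - s) * real (Suc n))\<^sup>2)))
          = arctan ((b - t) * real (Suc n)) - arctan ((a - t) * real (Suc n))"
      proof (rule integral_FTC_Icc)
        show "a \<le> b" using ab by simp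
        show "((\<lambda>s. arctan ((s - t) * real (Suc n))) has_vector_derivative real (Suc n) / (1 + ((t - s) * real (Suc n))\<^sup>2)) (at s within {a..b})" for s
          unfolding has_real_derivative_iff_has_vector_derivative[symmetric]
          by (auto intro!: derivative_eq_intros simp: field_simps power2_eq_square)
        show "continuous_on {a..b} (\<lambda>s. real (Suc n) / (1 + ((t - s) * real (Suc n))\<^sup>2))"
          by (intro continuous_intros) (auto simp: add_nonneg_eq_0_iff)
      qed
      then show ?thesis by (simp add: A_def)
    qed
    finally show ?thesis .
  qed
  have zero: "(LINT t|lborel. of_real (A n t) * \<phi> t) = 0" for n
  proof -
    have "(LINT s|lborel. complex_of_real (indicator {a..b} s) * (LINT t|lborel. P n s t * \<phi> t))
       = (LINT t|lborel. (LINT s|lborel. complex_of_real (indicator {a..b} s) * P n s t) * \<phi> t)"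
    proof (rule Fubini_kernel[OF \<phi>, where C = "real (Suc n)"])
      show "integrable lborel (\<lambda>s. complex_of_real (indicator {a..b} s))"
        using ab by (intro integrable_of_real integrable_real_indicator) auto
      show "cmod (P n s t) \<le> real (Suc n)" for s t
      proof -
        have "1 \<le> 1 + ((t - s) * real (Suc n))\<^sup>2" by simp
        then have "real (Suc n) / (1 + ((t - s) * real (Suc n))\<^sup>2) \<le> real (Suc n) / 1"
          by (intro divide_left_mono) (auto intro!: add_pos_nonneg)
        moreover have "cmod (P n s t) = real (Suc n) / (1 + ((t - s) * real (Suc n))\<^sup>2)"
          unfolding P_def norm_of_real by simp
        ultimately show ?thesis by simp
      qed
      show "(\<lambda>(s, t). P n s t) \<in> borel_measurable (borel \<Otimes>\<^sub>M borel)"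
        unfolding P_def by measurable
    qed
    then show ?thesis by (simp only: Pc Pint) simp
  qed
  have "(\<lambda>n. LINT t|lborel. of_real (A n t) * \<phi> t) \<longlonglongrightarrow> (LINT t|lborel. of_real pi * (indicator {a<..<b} t *\<^sub>R \<phi> t))"
  proof (rule integral_dominated_convergence[where w = "\<lambda>x. pi * cmod (\<phi> x)"])
    show "integrable lborel (\<lambda>x. pi * cmod (\<phi> x))" using \<phi> by simp
    show "AE t in lborel. norm (complex_of_real (A n t) * \<phi> t) \<le> pi * cmod (\<phi> t)" for n
    proof (rule AE_I2)
      fix t
      have "\<bar>A n t\<bar> \<le> pi"
        using arctan_bounded[of "(b - t) * real (Suc n)"] arctan_bounded[of "(a - t) * real (Suc n)"]
        unfolding A_def by linarith
      then show "norm (complex_of_real (A n t) * \<phi> t) \<le> pi * cmod (\<phi> t)"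
        unfolding norm_mult norm_of_real by (intro mult_right_mono) auto
    qed
    have "AE t in lborel. t \<noteq> a" "AE t in lborel. t \<noteq> b"
      by (auto intro: AE_lborel_singleton)
    then show "AE t in lborel. (\<lambda>n. complex_of_real (A n t) * \<phi> t) \<longlonglongrightarrow> of_real pi * (indicator {a<..<b} t *\<^sub>R \<phi> t)"
    proof eventually_elim
      case (elim t)
      have L: "(\<lambda>n. A n t) \<longlonglongrightarrow> pi * indicator {a<..<b} t"
      proof -
        consider "t < a" | "a < t" "t < b" | "b < t" using elim by linarith
        then show ?thesis
        proof cases
          case 1
          then have "(\<lambda>n. A n t) \<longlonglongrightarrow> pi / 2 - pi / 2"
            unfolding A_def using ab by (intro tendsto_diff arctan_scaled_tendsto) auto
          then show ?thesis using 1 ab by simp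
        next
          case 2
          then have "(\<lambda>n. A n t) \<longlonglongrightarrow> pi / 2 - (- (pi / 2))"
            unfolding A_def using ab by (intro tendsto_diff arctan_scaled_tendsto) auto
          then show ?thesis using 2 ab by simp
        next
          case 3
          then have "(\<lambda>n. A n t) \<longlonglongrightarrow> - (pi / 2) - (- (pi / 2))"
            unfolding A_def using ab by (intro tendsto_diff arctan_scaled_tendsto) auto
          then show ?thesis using 3 ab by simp
        qed
      qed
      have "(\<lambda>n. complex_of_real (A n t) * \<phi> t) \<longlonglongrightarrow> of_real (pi * indicator {a<..<b} t) * \<phi> t"
        by (intro tendsto_intros L)
      then show ?case by (simp add: scaleR_conv_of_real mult.assoc)
    qed
    show "(\<lambda>t. complex_of_real pi * (indicator {a<..<b} t *\<^sub>R \<phi> t)) \<in> borel_measurable lborel" by simp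
    show "(\<lambda>t. complex_of_real (A n t) * \<phi> t) \<in> borel_measurable lborel" for n unfolding A_def by simp
  qed
  then have "(LINT t|lborel. of_real pi * (indicator {a<..<b} t *\<^sub>R \<phi> t)) = 0"
    unfolding zero by (simp only: LIMSEQ_const_iff)
  then show "(LINT x|lborel. indicator {a<..<b} x *\<^sub>R \<phi> x) = 0"
    by (simp only: integral_mult_right_zero mult_eq_0_iff of_real_eq_0_iff pi_neq_zero simp_thms)
qed

lemma AE_eq_0_of_fourier_eq_0:
  assumes \<phi>: "integrable lborel \<phi>" and f0: "\<And>l. fourier \<phi> l = 0"
  shows "AE x in lborel. \<phi> x = 0"
proof (rule AE_eq_0_of_cauchy_eq_0[OF \<phi>])
  fix w :: complex assume "Im w \<noteq> 0"
  then consider "Im w < 0" | "Im w > 0" by linarith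
  then show "cauchy \<phi> w = 0"
  proof cases
    case 1 then show ?thesis using cauchy_eq_laplace_fourier[OF \<phi>, of 1 w] f0 by simp
  next
    case 2 then show ?thesis using cauchy_eq_laplace_fourier[OF \<phi>, of "-1" w] f0 by simp
  qed
qed

section \<open>The rank one property of Cauchy integrals\<close>

lemma cauchy_lincomb:
  assumes "integrable lborel \<phi>" "integrable lborel \<theta>" "Im w \<noteq> 0"
  shows "cauchy (\<lambda>x. a * \<phi> x + b * \<theta> x) w = a * cauchy \<phi> w + b * cauchy \<theta> w"
proof -
  have "cauchy (\<lambda>x. a * \<phi> x + b * \<theta> x) w
      = (LINT x|lborel. a * (inverse (of_real x - w) * \<phi> x) + b * (inverse (of_real x - w) * \<theta> x))"
    by (simp add: cauchy_def algebra_simps)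
  also have "\<dots> = a * cauchy \<phi> w + b * cauchy \<theta> w"
    using cauchy_integrable[OF assms(1,3)] cauchy_integrable[OF assms(2,3)] by (simp add: cauchy_def)
  finally show ?thesis .
qed

lemma cauchy_cong_AE:
  assumes "integrable lborel \<phi>" "integrable lborel \<theta>" "AE x in lborel. \<phi> x = \<theta> x"
  shows "cauchy \<phi> w = cauchy \<theta> w"
proof -
  have [measurable]: "\<phi> \<in> borel_measurable borel" "\<theta> \<in> borel_measurable borel"
    using assms(1,2) borel_measurable_integrable by force+
  show ?thesis
    unfolding cauchy_def by (rule integral_cong_AE) (use assms(3) in auto)
qed

lemma cauchy_cnj: "cauchy (\<lambda>x. cnj (\<phi> x)) w = cnj (cauchy \<phi> (cnj w))"
proof -
  have "cauchy (\<lambda>x. cnj (\<phi> x)) w = (LINT x|lborel. cnj (inverse (of_real x - cnj w) * \<phi> x))"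
    by (simp add: cauchy_def)
  also have "\<dots> = cnj (cauchy \<phi> (cnj w))"
    unfolding cauchy_def by (rule Bochner_Integration.integral_cnj)
  finally show ?thesis .
qed

lemma inner2_Mop: "inner2 (Mop l f) g = fourier (\<lambda>x. f x * cnj (g x)) l"
  by (simp add: inner2_def Mop_def fourier_def mult.assoc)

lemma fourier_shift_frequency:
  "fourier (\<lambda>x. exp (\<i> * of_real (a * x)) * \<phi> x) l = fourier \<phi> (a + l)"
proof -
  have "exp (\<i> * of_real (l * x)) * exp (\<i> * of_real (a * x)) = exp (\<i> * of_real ((a + l) * x))" for x
    by (simp add: mult_exp_exp algebra_simps)
  then show ?thesis by (simp only: fourier_def mult.assoc[symmetric])
qed

lemma Mop_L2: "f \<in> L2 \<Longrightarrow> Mop l f \<in> L2"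
  unfolding Mop_def by (rule L2_bounded_mult[where C = 1]) (auto simp del: of_real_mult)

lemma resolvent_L2:
  assumes "f \<in> L2" "Im w \<noteq> 0" shows "(\<lambda>x. inverse (of_real x - w) * f x) \<in> L2"
  using cauchy_kernel_bound[OF assms(2)] by (intro L2_bounded_mult[OF assms(1)]) auto

text \<open>Each product of \<open>h\<close> with the conjugate of some \<open>\<psi>\<close> in
  \<open>\<Psi>\<close> is asked to lie in H^1. Equivalently, this is the largest module for the
  operators \<open>Mop l\<close>, \<open>l \<ge> 0\<close>, that is orthogonal to
  \<open>\<Psi>\<close>, which is the setting of Beurling's argument.\<close>

definition hardy_annihilator :: "fn set \<Rightarrow> fn set" where
  "hardy_annihilator \<Psi> = {h \<in> L2. \<forall>\<psi>\<in>\<Psi>. \<forall>l\<ge>0. inner2 (Mop l h) \<psi> = 0}"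

lemma hardy_annihilatorD:
  "h \<in> hardy_annihilator \<Psi> \<Longrightarrow> h \<in> L2"
  "h \<in> hardy_annihilator \<Psi> \<Longrightarrow> \<psi> \<in> \<Psi> \<Longrightarrow> 0 \<le> l \<Longrightarrow> inner2 (Mop l h) \<psi> = 0"
  by (auto simp: hardy_annihilator_def)

lemma Mop_diff: "Mop l (\<lambda>x. f x - g x) = (\<lambda>x. Mop l f x - Mop l g x)"
  by (simp add: Mop_def algebra_simps)

lemma Mop_lincomb: "Mop l (\<lambda>x. a * f x + b * g x) = (\<lambda>x. a * Mop l f x + b * Mop l g x)"
  by (simp add: Mop_def algebra_simps)

lemma norm2_unimodular:
  assumes "\<And>x. cmod (u x) = 1" shows "norm2 (\<lambda>x. u x * f x) = norm2 f"
  using assms by (simp add: norm2_def norm_mult)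

lemma closed_subspace_hardy_annihilator:
  assumes \<Psi>: "\<Psi> \<subseteq> L2"
  shows "closed_subspace (hardy_annihilator \<Psi>)"
  unfolding closed_subspace_def
proof (intro conjI allI impI ballI)
  let ?K = "hardy_annihilator \<Psi>"
  show "?K \<subseteq> L2" by (auto simp: hardy_annihilator_def)
  show "(\<lambda>x. 0) \<in> ?K" by (auto simp: hardy_annihilator_def inner2_def Mop_def)
  show "(\<lambda>x. a * f x + b * g x) \<in> ?K" if "f \<in> ?K" "g \<in> ?K" for f g a b
    using that \<Psi> by (auto simp: hardy_annihilator_def Mop_lincomb inner2_lincomb_left Mop_L2 subset_iff intro!: L2_lincomb)
  show "g \<in> ?K" if f: "f \<in> ?K" and g: "g \<in> L2" "aeq f g" for f g
  proof -
    have "inner2 (Mop l g) \<psi> = inner2 (Mop l f) \<psi>" if "\<psi> \<in> \<Psi>" for l \<psi>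
    proof (rule inner2_cong_AE)
      show "aeq (Mop l g) (Mop l f)" using g(2) unfolding aeq_def by eventually_elim (simp add: Mop_def)
    qed (use that \<Psi> f g in \<open>auto intro!: Mop_L2 dest: hardy_annihilatorD\<close>)
    then show ?thesis using f g by (auto simp: hardy_annihilator_def)
  qed
  show "f \<in> ?K" if s: "\<forall>n. s n \<in> ?K" and f: "f \<in> L2" and l: "(\<lambda>n. norm2 (\<lambda>x. s n x - f x)) \<longlonglongrightarrow> 0" for s f
  proof -
    have "inner2 (Mop l f) \<psi> = 0" if \<psi>: "\<psi> \<in> \<Psi>" "0 \<le> l" for \<psi> l
    proof -
      have "norm2 (\<lambda>x. Mop l (s n) x - Mop l f x) = norm2 (\<lambda>x. s n x - f x)" for n
        unfolding Mop_diff[symmetric] unfolding Mop_def by (rule norm2_unimodular) (simp del: of_real_mult)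
      then have "(\<lambda>n. inner2 (Mop l (s n)) \<psi>) \<longlonglongrightarrow> inner2 (Mop l f) \<psi>"
        using l s f \<psi> \<Psi> by (intro inner2_tendsto Mop_L2) (auto dest: hardy_annihilatorD)
      moreover have "inner2 (Mop l (s n)) \<psi> = 0" for n using s \<psi> hardy_annihilatorD(2) by blast
      ultimately show ?thesis by (simp add: LIMSEQ_const_iff)
    qed
    then show ?thesis using f by (auto simp: hardy_annihilator_def)
  qed
qed

lemma hardy_annihilator_cauchy:
  assumes h: "h \<in> hardy_annihilator \<Psi>" and \<psi>: "\<psi> \<in> \<Psi>" "\<Psi> \<subseteq> L2" and w: "Im w < 0"
  shows "cauchy (\<lambda>x. h x * cnj (\<psi> x)) w = 0"
  using h \<psi> w
  by (intro cauchy_eq_0_of_fourier_eq_0 L2_integrable_inner)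
    (auto simp: inner2_Mop[symmetric] dest: hardy_annihilatorD)

text \<open>With \<open>w\<close> in the lower half-plane, the reciprocal of x - w is bounded and
  analytic above the line. The modulated product still has no nonnegative frequencies, so its Cauchy
  integral at \<open>w\<close>, which is the inner product in question, vanishes.\<close>

lemma hardy_annihilator_resolvent:
  assumes h: "h \<in> hardy_annihilator \<Psi>" and \<Psi>: "\<Psi> \<subseteq> L2" and w: "Im w < 0"
  shows "(\<lambda>x. inverse (of_real x - w) * h x) \<in> hardy_annihilator \<Psi>"
proof -
  have L: "(\<lambda>x. inverse (of_real x - w) * h x) \<in> L2" using h w by (intro resolvent_L2) (auto dest: hardy_annihilatorD)
  have "inner2 (Mop l (\<lambda>x. inverse (of_real x - w) * h x)) \<psi> = 0" if \<psi>: "\<psi> \<in> \<Psi>" and l: "0 \<le> l" for \<psi> l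
  proof -
    define \<phi> where "\<phi> = (\<lambda>x. h x * cnj (\<psi> x))"
    have \<phi>: "integrable lborel \<phi>" unfolding \<phi>_def using h \<psi> \<Psi> by (intro L2_integrable_inner) (auto dest: hardy_annihilatorD)
    have "inner2 (Mop l (\<lambda>x. inverse (of_real x - w) * h x)) \<psi> = cauchy (\<lambda>x. exp (\<i> * of_real (l * x)) * \<phi> x) w"
      by (simp add: inner2_def Mop_def cauchy_def \<phi>_def algebra_simps)
    also have "\<dots> = 0"
    proof (rule cauchy_eq_0_of_fourier_eq_0[OF fourier_integrable[OF \<phi>] _ w])
      fix k :: real assume "0 \<le> k"
      then have "inner2 (Mop (l + k) h) \<psi> = 0" using l by (intro hardy_annihilatorD(2)[OF h \<psi>]) simp
      then show "fourier (\<lambda>x. exp (\<i> * of_real (l * x)) * \<phi> x) k = 0"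
        by (simp only: fourier_shift_frequency) (simp add: inner2_Mop \<phi>_def)
    qed
    finally show ?thesis .
  qed
  then show ?thesis using L by (auto simp: hardy_annihilator_def)
qed

text \<open>Beurling's argument: modulo \<open>b K\<close>, with \<open>b(x) = (x - z) / (x - z\<^sup>*)\<close>, the module \<open>K\<close> is at most
  one-dimensional, because products \<open>e e'\<^sup>*\<close> of vectors in \<open>K\<close> orthogonal to \<open>b K\<close> have a Cauchy integral
  depending only on \<open>\<langle>e, e'\<rangle>\<close>. Hence the Cauchy integrals at \<open>z\<close> form a matrix of rank one.\<close>

lemma cauchy_rank_one:
  assumes \<Psi>: "\<Psi> \<subseteq> L2" and g1: "g1 \<in> hardy_annihilator \<Psi>" and g2: "g2 \<in> hardy_annihilator \<Psi>"
    and p1: "\<psi>1 \<in> \<Psi>" and p2: "\<psi>2 \<in> \<Psi>" and z: "0 < Im z"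
  shows "cauchy (\<lambda>x. g1 x * cnj (\<psi>1 x)) z * cauchy (\<lambda>x. g2 x * cnj (\<psi>2 x)) z
       = cauchy (\<lambda>x. g2 x * cnj (\<psi>1 x)) z * cauchy (\<lambda>x. g1 x * cnj (\<psi>2 x)) z"
proof -
  define K where "K = hardy_annihilator \<Psi>"
  have K: "closed_subspace K" unfolding K_def by (rule closed_subspace_hardy_annihilator[OF \<Psi>])
  have KL: "f \<in> L2" if "f \<in> K" for f using that by (simp add: K_def hardy_annihilator_def)
  have Kres: "(\<lambda>x. inverse (of_real x - w) * h x) \<in> K" if "h \<in> K" "Im w < 0" for h w
    using that hardy_annihilator_resolvent \<Psi> by (simp add: K_def)
  \<comment> \<open>This uses (x - v) / (x - w) = 1 + (w - v) / (x - w): the pole must lie below the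
    line, while the zero \<open>v\<close> is arbitrary.\<close>
  have Kmob: "(\<lambda>x. (of_real x - v) * inverse (of_real x - w) * h x) \<in> K" if h: "h \<in> K" and w: "Im w < 0" for h v w
  proof -
    have "(\<lambda>x. 1 * h x + (w - v) * (inverse (of_real x - w) * h x)) \<in> K"
      by (intro closed_subspaceD(3)[OF K] Kres h w)
    also have "(\<lambda>x. 1 * h x + (w - v) * (inverse (of_real x - w) * h x)) = (\<lambda>x. (of_real x - v) * inverse (of_real x - w) * h x)"
    proof
      fix x :: real
      have "of_real x - w \<noteq> 0" using w by (auto simp: complex_eq_iff)
      then have "(of_real x - v) * inverse (of_real x - w) = 1 + (w - v) * inverse (of_real x - w)"
        by (simp add: field_simps)
      then show "1 * h x + (w - v) * (inverse (of_real x - w) * h x) = (of_real x - v) * inverse (of_real x - w) * h x"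
        by (simp only:) (simp add: algebra_simps)
    qed
    finally show ?thesis .
  qed
  \<comment> \<open>\<open>B\<close> is the Blaschke factor b of the half-plane and \<open>C\<close>
    its inverse, both unimodular on the line. Hence \<open>bK\<close> below, described through
    \<open>C\<close>, is the closed subspace b K.\<close>
  define B where "B = (\<lambda>x. (of_real x - z) * inverse (of_real x - cnj z))"
  define C where "C = (\<lambda>x. (of_real x - cnj z) * inverse (of_real x - z))"
  have nz: "of_real x - z \<noteq> 0" "of_real x - cnj z \<noteq> 0" for x
    using z by (auto simp: complex_eq_iff)
  have nC: "cmod (C x) = 1" for x
  proof -
    have "cmod (of_real x - cnj z) = cmod (of_real x - z)"
      using complex_mod_cnj[of "of_real x - z"] by simp
    then show ?thesis using nz by (simp add: C_def norm_mult norm_inverse)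
  qed
  have inv: "(a * inverse b) * (b * inverse a) = 1" if "a \<noteq> 0" "b \<noteq> 0" for a b :: complex
    using that by (simp add: field_simps)
  have BC: "B x * C x = 1" for x unfolding B_def C_def by (rule inv[OF nz])
  have mC: "C \<in> borel_measurable lborel" unfolding C_def by simp
  define bK where "bK = {f \<in> L2. (\<lambda>x. C x * f x) \<in> K}"
  have bK: "closed_subspace bK"
    unfolding closed_subspace_def
  proof (intro conjI allI impI ballI)
    show "bK \<subseteq> L2" "(\<lambda>x. 0) \<in> bK" using closed_subspaceD(2)[OF K] by (auto simp: bK_def)
    show "(\<lambda>x. a * f x + b * g x) \<in> bK" if "f \<in> bK" "g \<in> bK" for f g a b
      using that closed_subspaceD(3)[OF K, of "\<lambda>x. C x * f x" "\<lambda>x. C x * g x" a b]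
      by (auto simp: bK_def algebra_simps intro: L2_lincomb)
    show "g \<in> bK" if f: "f \<in> bK" and g: "g \<in> L2" "aeq f g" for f g
    proof -
      have "aeq (\<lambda>x. C x * f x) (\<lambda>x. C x * g x)" using g(2) unfolding aeq_def by eventually_elim simp
      moreover have "(\<lambda>x. C x * g x) \<in> L2" using nC by (intro L2_bounded_mult[OF g(1) mC, of 1]) auto
      ultimately show ?thesis using f g closed_subspaceD(4)[OF K] by (auto simp: bK_def)
    qed
    show "f \<in> bK" if s: "\<forall>n. s n \<in> bK" and f: "f \<in> L2" and l: "(\<lambda>n. norm2 (\<lambda>x. s n x - f x)) \<longlonglongrightarrow> 0" for s f
    proof -
      have e: "norm2 (\<lambda>x. C x * s n x - C x * f x) = norm2 (\<lambda>x. s n x - f x)" for n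
        using norm2_unimodular[of C "\<lambda>x. s n x - f x", OF nC] by (simp add: right_diff_distrib)
      have "(\<lambda>x. C x * f x) \<in> K"
      proof (rule closed_subspaceD(5)[OF K, where s = "\<lambda>n x. C x * s n x"])
        show "(\<lambda>x. C x * f x) \<in> L2" using nC by (intro L2_bounded_mult[OF f mC, of 1]) auto
      qed (use s l e in \<open>auto simp: bK_def\<close>)
      then show ?thesis using f by (simp add: bK_def)
    qed
  qed
  have bK_sub: "f \<in> K" if "f \<in> bK" for f
  proof -
    have "(\<lambda>x. (of_real x - z) * inverse (of_real x - cnj z) * (C x * f x)) \<in> K"
      using that z by (intro Kmob) (auto simp: bK_def)
    moreover have "(\<lambda>x. (of_real x - z) * inverse (of_real x - cnj z) * (C x * f x)) = f"
      using BC by (auto simp: B_def mult.assoc[symmetric])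
    ultimately show ?thesis by simp
  qed
  \<comment> \<open>Multiplication by \<open>C\<close> exchanges the pole \<open>z\<close> of the
    kernel for \<open>cnj z\<close>, where the Cauchy integrals of the module vanish.\<close>
  have bK_cauchy: "cauchy (\<lambda>x. f x * cnj (\<psi> x)) z = 0" if f: "f \<in> bK" and \<psi>: "\<psi> \<in> \<Psi>" for f \<psi>
  proof -
    have "cauchy (\<lambda>x. f x * cnj (\<psi> x)) z = cauchy (\<lambda>x. (C x * f x) * cnj (\<psi> x)) (cnj z)"
      unfolding cauchy_def
    proof (intro Bochner_Integration.integral_cong refl)
      fix x
      have "inverse (of_real x - cnj z) * C x = inverse (of_real x - z)" using nz by (simp add: C_def)
      then show "inverse (of_real x - z) * (f x * cnj (\<psi> x)) = inverse (of_real x - cnj z) * ((C x * f x) * cnj (\<psi> x))"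
        by (simp only: mult.assoc[symmetric])
    qed
    also have "\<dots> = 0"
      using f \<psi> \<Psi> z by (intro hardy_annihilator_cauchy[of _ \<Psi>]) (auto simp: bK_def K_def)
    finally show ?thesis .
  qed
  define E where "E = {e \<in> K. \<forall>h\<in>bK. inner2 e h = 0}"
  have E_L: "e \<in> L2" if "e \<in> E" for e using that KL by (auto simp: E_def)
  have split: "\<exists>e\<in>E. \<forall>\<psi>\<in>\<Psi>. cauchy (\<lambda>x. g x * cnj (\<psi> x)) z = cauchy (\<lambda>x. e x * cnj (\<psi> x)) z" if g: "g \<in> K" for g
  proof -
    obtain k where k: "k \<in> bK" "\<forall>h\<in>bK. inner2 (\<lambda>x. g x - k x) h = 0"
      using orthogonal_projection[OF bK KL[OF g]] by blast
    have kL: "k \<in> L2" using k KL bK_sub by blast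
    have "(\<lambda>x. 1 * g x + (- 1) * k x) \<in> K" by (intro closed_subspaceD(3)[OF K] g bK_sub k)
    then have "(\<lambda>x. g x - k x) \<in> E" using k by (simp add: E_def)
    moreover have "cauchy (\<lambda>x. g x * cnj (\<psi> x)) z = cauchy (\<lambda>x. (g x - k x) * cnj (\<psi> x)) z" if \<psi>: "\<psi> \<in> \<Psi>" for \<psi>
    proof -
      have "cauchy (\<lambda>x. 1 * (g x * cnj (\<psi> x)) + (-1) * (k x * cnj (\<psi> x))) z = 1 * cauchy (\<lambda>x. g x * cnj (\<psi> x)) z + (-1) * cauchy (\<lambda>x. k x * cnj (\<psi> x)) z"
        using z \<psi> \<Psi> kL KL[OF g] by (intro cauchy_lincomb L2_integrable_inner) auto
      moreover have "(\<lambda>x. (g x - k x) * cnj (\<psi> x)) = (\<lambda>x. 1 * (g x * cnj (\<psi> x)) + (-1) * (k x * cnj (\<psi> x)))"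
        by (simp add: left_diff_distrib)
      ultimately show ?thesis using bK_cauchy[OF k(1) \<psi>] by simp
    qed
    ultimately show ?thesis by (intro bexI[of _ "\<lambda>x. g x - k x"] ballI)
  qed
  \<comment> \<open>The function h = (x - z) / (x - w) e lies in \<open>bK\<close>, since
    \<open>C\<close> only moves its zero from \<open>z\<close> to \<open>cnj z\<close>.
    Orthogonality of \<open>e'\<close> to \<open>h\<close> is then a linear equation for the Cauchy
    integral.\<close>
  have Ec: "cauchy (\<lambda>x. e x * cnj (e' x)) w = inner2 e e' * inverse (z - w)" if e: "e \<in> E" "e' \<in> E" and w: "Im w < 0" for e e' w
  proof -
    have nzw: "z - w \<noteq> 0" using z w by (auto simp: complex_eq_iff)
    have nx: "of_real x - w \<noteq> 0" for x using w by (auto simp: complex_eq_iff)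
    define h where "h = (\<lambda>x. (of_real x - z) * inverse (of_real x - w) * e x)"
    have hK: "h \<in> K" unfolding h_def using e w by (intro Kmob) (auto simp: E_def)
    have "(\<lambda>x. C x * h x) = (\<lambda>x. (of_real x - cnj z) * inverse (of_real x - w) * e x)"
      using nz by (auto simp: C_def h_def)
    moreover have "(\<lambda>x. (of_real x - cnj z) * inverse (of_real x - w) * e x) \<in> K"
      using e w by (intro Kmob) (auto simp: E_def)
    ultimately have "h \<in> bK" using KL[OF hK] by (simp add: bK_def)
    then have "inner2 e' h = 0" using e by (simp add: E_def)
    then have "inner2 h e' = 0" using inner2_commute[of h e'] by simp
    moreover have "h = (\<lambda>x. 1 * e x + (w - z) * (inverse (of_real x - w) * e x))"
    proof
      fix x
      have "(of_real x - z) * inverse (of_real x - w) = 1 + (w - z) * inverse (of_real x - w)"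
        using nx[of x] by (simp add: field_simps)
      then show "h x = 1 * e x + (w - z) * (inverse (of_real x - w) * e x)"
        unfolding h_def by (simp only:) (simp add: algebra_simps)
    qed
    moreover have "inner2 (\<lambda>x. 1 * e x + (w - z) * (inverse (of_real x - w) * e x)) e'
        = 1 * inner2 e e' + (w - z) * inner2 (\<lambda>x. inverse (of_real x - w) * e x) e'"
      using e w by (intro inner2_lincomb_left resolvent_L2 E_L) auto
    moreover have "inner2 (\<lambda>x. inverse (of_real x - w) * e x) e' = cauchy (\<lambda>x. e x * cnj (e' x)) w"
      by (simp add: inner2_def cauchy_def mult.assoc)
    ultimately have "inner2 e e' + (w - z) * cauchy (\<lambda>x. e x * cnj (e' x)) w = 0" by simp
    then have "(z - w) * cauchy (\<lambda>x. e x * cnj (e' x)) w = inner2 e e'" by (simp add: algebra_simps)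
    then show ?thesis using nzw by (simp add: divide_inverse[symmetric] eq_divide_eq mult.commute)
  qed
  have Ec': "cauchy (\<lambda>x. e x * cnj (e' x)) w = inner2 e e' * inverse (cnj z - w)" if e: "e \<in> E" "e' \<in> E" and w: "Im w > 0" for e e' w
  proof -
    have "cauchy (\<lambda>x. e x * cnj (e' x)) w = cauchy (\<lambda>x. cnj (e' x * cnj (e x))) w"
      by (simp add: mult.commute)
    also have "\<dots> = cnj (inner2 e' e * inverse (z - cnj w))"
      unfolding cauchy_cnj using Ec[OF e(2,1), of "cnj w"] w by simp
    also have "\<dots> = inner2 e e' * inverse (cnj z - w)"
      using inner2_commute[of e e'] by simp
    finally show ?thesis .
  qed
  \<comment> \<open>The Cauchy integrals on both sides of the line are \<open>inner2 e e'\<close>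
    times a factor independent of the vectors. By uniqueness, a linear relation between inner
    products passes to the products of functions.\<close>
  have E_AE: "AE x in lborel. a * (e x * cnj (e' x)) + b * (d x * cnj (d' x)) = 0"
    if E: "e \<in> E" "e' \<in> E" "d \<in> E" "d' \<in> E" and ab: "a * inner2 e e' + b * inner2 d d' = 0" for e e' d d' a b
  proof (rule AE_eq_0_of_cauchy_eq_0)
    have i: "integrable lborel (\<lambda>x. e x * cnj (e' x))" "integrable lborel (\<lambda>x. d x * cnj (d' x))"
      using E E_L by (auto intro: L2_integrable_inner)
    then show "integrable lborel (\<lambda>x. a * (e x * cnj (e' x)) + b * (d x * cnj (d' x)))" by simp
    fix w :: complex assume w: "Im w \<noteq> 0"
    then have "\<exists>u. cauchy (\<lambda>x. e x * cnj (e' x)) w = inner2 e e' * u \<and> cauchy (\<lambda>x. d x * cnj (d' x)) w = inner2 d d' * u"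
      using Ec[OF E(1,2), of w] Ec[OF E(3,4), of w] Ec'[OF E(1,2), of w] Ec'[OF E(3,4), of w] by (cases "Im w < 0") auto
    then obtain u where u: "cauchy (\<lambda>x. e x * cnj (e' x)) w = inner2 e e' * u" "cauchy (\<lambda>x. d x * cnj (d' x)) w = inner2 d d' * u" by blast
    have "cauchy (\<lambda>x. a * (e x * cnj (e' x)) + b * (d x * cnj (d' x))) w = (a * inner2 e e' + b * inner2 d d') * u"
      by (subst cauchy_lincomb[OF i w]) (simp add: u algebra_simps)
    then show "cauchy (\<lambda>x. a * (e x * cnj (e' x)) + b * (d x * cnj (d' x))) w = 0" using ab by simp
  qed
  obtain e1 where e1: "e1 \<in> E" "\<And>\<psi>. \<psi> \<in> \<Psi> \<Longrightarrow> cauchy (\<lambda>x. g1 x * cnj (\<psi> x)) z = cauchy (\<lambda>x. e1 x * cnj (\<psi> x)) z"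
    using split[of g1] g1 unfolding K_def by blast
  obtain e2 where e2: "e2 \<in> E" "\<And>\<psi>. \<psi> \<in> \<Psi> \<Longrightarrow> cauchy (\<lambda>x. g2 x * cnj (\<psi> x)) z = cauchy (\<lambda>x. e2 x * cnj (\<psi> x)) z"
    using split[of g2] g2 unfolding K_def by blast
  have cz: "cauchy (\<lambda>x. v x * cnj (\<psi> x)) z = s * cauchy (\<lambda>x. u x * cnj (\<psi> x)) z"
    if "AE x in lborel. v x = s * u x" "u \<in> L2" "v \<in> L2" "\<psi> \<in> \<Psi>" for u v s \<psi>
  proof -
    have \<psi>: "\<psi> \<in> L2" using that \<Psi> by auto
    have "cauchy (\<lambda>x. v x * cnj (\<psi> x)) z = cauchy (\<lambda>x. s * (u x * cnj (\<psi> x))) z"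
      using that(1) \<psi> that(2,3)
      by (intro cauchy_cong_AE integrable_mult_right L2_integrable_inner) (auto elim!: eventually_mono simp: mult.assoc)
    also have "\<dots> = s * cauchy (\<lambda>x. u x * cnj (\<psi> x)) z" by (simp add: cauchy_def mult.left_commute)
    finally show ?thesis .
  qed
  show ?thesis
  proof (cases "norm2 e1 = 0")
    case True
    then have a: "AE x in lborel. e1 x = 0 * e1 x" using norm2_eq_0_iff[OF E_L[OF e1(1)]] by simp
    have "cauchy (\<lambda>x. e1 x * cnj (\<psi> x)) z = 0" if "\<psi> \<in> \<Psi>" for \<psi>
      using cz[OF a E_L[OF e1(1)] E_L[OF e1(1)] that] by simp
    then show ?thesis using e1(2) p1 p2 by simp
  next
    case False
    \<comment> \<open>\<open>d\<close> is the component of \<open>e2\<close> orthogonal to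
      \<open>e1\<close>. Its product with the conjugate of \<open>e1\<close> vanishes almost
      everywhere, yet |d|^2 and |e1|^2 are proportional, so \<open>d\<close> must vanish.\<close>
    define s where "s = inner2 e2 e1 / of_real ((norm2 e1)\<^sup>2)"
    define d where "d = (\<lambda>x. 1 * e2 x + (- s) * e1 x)"
    have dE: "d \<in> E"
    proof -
      have "d \<in> K" unfolding d_def using e1 e2 by (intro closed_subspaceD(3)[OF K]) (auto simp: E_def)
      moreover have "inner2 d h = 0" if h: "h \<in> bK" for h
        unfolding d_def using e1(1) e2(1) h KL[OF bK_sub[OF h]]
        by (subst inner2_lincomb_left) (auto simp: E_def intro: KL)
      ultimately show ?thesis by (simp add: E_def)
    qed
    have "inner2 d e1 = 1 * inner2 e2 e1 + (- s) * inner2 e1 e1"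
      unfolding d_def using e1 e2 by (intro inner2_lincomb_left E_L)
    then have "inner2 d e1 = 0" using False by (simp add: inner2_self s_def)
    then have a1: "AE x in lborel. d x * cnj (e1 x) = 0"
      using E_AE[OF dE e1(1) dE e1(1), of 1 0] by simp
    have a2: "AE x in lborel. of_real ((norm2 e1)\<^sup>2) * (d x * cnj (d x)) + (- of_real ((norm2 d)\<^sup>2)) * (e1 x * cnj (e1 x)) = 0"
      by (rule E_AE[OF dE dE e1(1) e1(1)]) (simp add: inner2_self)
    have "norm2 d = 0"
    proof (rule ccontr)
      assume nd: "norm2 d \<noteq> 0"
      have "AE x in lborel. e1 x = 0" using a1 a2 by eventually_elim (use nd in auto)
      then show False using False norm2_eq_0_iff[OF E_L[OF e1(1)]] by simp
    qed
    then have "AE x in lborel. d x = 0" using norm2_eq_0_iff[OF E_L[OF dE]] by simp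
    then have "AE x in lborel. e2 x = s * e1 x" by eventually_elim (simp add: d_def)
    from cz[OF this E_L[OF e1(1)] E_L[OF e2(1)]] show ?thesis
      using e1(2) e2(2) p1 p2 by simp
  qed
qed

section \<open>Exponential type of a product of translates\<close>

text \<open>The quotient away from \<open>a\<close> and the local factor near \<open>a\<close> agree
  on the overlap and glue; the point \<open>p\<close> excludes the zero function.\<close>

lemma divide_out_zero:
  assumes "open S" "connected S" "f holomorphic_on S" "a \<in> S" "f a = 0" "p \<in> S" "f p \<noteq> 0"
  obtains n g where "0 < n" "g holomorphic_on S" "g a \<noteq> 0" "\<And>w. w \<in> S \<Longrightarrow> f w = (w - a) ^ n * g w"
proof -
  have nc: "\<not> f constant_on S"
    using assms unfolding constant_on_def by metis
  obtain h r n where h: "0 < n" "0 < r" "ball a r \<subseteq> S" "h holomorphic_on ball a r"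
      "\<And>w. w \<in> ball a r \<Longrightarrow> f w = (w - a)^n * h w" "\<And>w. w \<in> ball a r \<Longrightarrow> h w \<noteq> 0"
    using holomorphic_factor_zero_nonconstant[OF assms(3,1,2,4,5) nc] by metis
  define g where "g = (\<lambda>w. if w = a then h a else f w / (w - a) ^ n)"
  have "g holomorphic_on (S - {a})"
  proof (rule holomorphic_transform)
    show "(\<lambda>w. f w / (w - a) ^ n) holomorphic_on (S - {a})"
      using assms(3) by (intro holomorphic_intros) (auto elim: holomorphic_on_subset)
  qed (auto simp: g_def)
  moreover have "g holomorphic_on (ball a r)"
    by (rule holomorphic_transform[OF h(4)]) (auto simp: g_def h(5))
  ultimately have "g holomorphic_on ((S - {a}) \<union> ball a r)"
    using assms(1) by (intro holomorphic_on_Un) (auto simp: open_delete)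
  moreover have "(S - {a}) \<union> ball a r = S"
    using h(2,3) assms(4) by auto
  ultimately have hol: "g holomorphic_on S" by simp
  show ?thesis
  proof (rule that[OF h(1) hol])
    show "g a \<noteq> 0" using h(2) h(6)[of a] by (auto simp: g_def)
    show "f w = (w - a) ^ n * g w" if "w \<in> S" for w
      using h(1) assms(5) by (auto simp: g_def)
  qed
qed

text \<open>The sign of the right side inside the unit disc, and its vanishing on the circle, give
  the two properties of Blaschke factors below.\<close>

lemma blaschke_identity:
  "(cmod (1 - cnj a * w))\<^sup>2 - (cmod (w - a))\<^sup>2 = (1 - (cmod a)\<^sup>2) * (1 - (cmod w)\<^sup>2)"
  unfolding cmod_power2 by (simp add: power2_eq_square algebra_simps)

lemma blaschke_le:
  assumes "cmod a \<le> 1" "cmod w \<le> 1"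
  shows "cmod (w - a) \<le> cmod (1 - cnj a * w)"
proof -
  have "0 \<le> (1 - (cmod a)\<^sup>2) * (1 - (cmod w)\<^sup>2)"
    using assms by (intro mult_nonneg_nonneg) (auto simp: power_le_one)
  then show ?thesis
    using blaschke_identity[of a w] power2_le_imp_le[OF _ norm_ge_zero] by (metis diff_ge_0_iff_ge)
qed

lemma blaschke_eq:
  assumes "cmod w = 1"
  shows "cmod (1 - cnj a * w) = cmod (w - a)"
  using blaschke_identity[of a w] assms power2_eq_imp_eq[OF _ norm_ge_zero norm_ge_zero] by simp

text \<open>For each zero \<open>a\<close> in the open disc, the factor w - a is exchanged for 1 -
  cnj(a) w, which has the same modulus on the circle, at least the same inside, and no zero there.
  Zeros on the circle stay.\<close>

lemma zero_free_majorant: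
  assumes "open S" "connected S" "cball 0 1 \<subseteq> S" "f holomorphic_on S" "p \<in> S" "f p \<noteq> 0"
  shows "\<exists>g. g holomorphic_on S \<and> (\<forall>w\<in>ball 0 1. g w \<noteq> 0)
           \<and> (\<forall>w\<in>ball 0 1. cmod (f w) \<le> cmod (g w)) \<and> (\<forall>w\<in>sphere 0 1. cmod (g w) = cmod (f w))"
proof -
  have "finite Z \<Longrightarrow> f holomorphic_on S \<Longrightarrow> (\<exists>p\<in>S. f p \<noteq> 0) \<Longrightarrow> {w\<in>ball 0 1. f w = 0} = Z \<Longrightarrow>
      \<exists>g. g holomorphic_on S \<and> (\<forall>w\<in>ball 0 1. g w \<noteq> 0)
           \<and> (\<forall>w\<in>ball 0 1. cmod (f w) \<le> cmod (g w)) \<and> (\<forall>w\<in>sphere 0 1. cmod (g w) = cmod (f w))" for Z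
  proof (induction Z arbitrary: f rule: finite_induct)
    case empty
    then show ?case by (intro exI[of _ f]) auto
  next
    case (insert a Z)
    then obtain p where p: "p \<in> S" "f p \<noteq> 0" by blast
    have a: "a \<in> ball 0 1" "f a = 0"
      using insert.prems by blast+
    then have a: "a \<in> ball 0 1" "f a = 0" "a \<in> S"
      using assms(3) by auto
    obtain n g where g: "0 < n" "g holomorphic_on S" "g a \<noteq> 0" "\<And>w. w \<in> S \<Longrightarrow> f w = (w - a) ^ n * g w"
      using divide_out_zero[OF assms(1,2) insert.prems(1) a(3,2) p] by metis
    define k where "k = (\<lambda>w. (1 - cnj a * w) ^ n * g w)"
    have nz: "1 - cnj a * w \<noteq> 0" if "cmod w < 1" for w
    proof
      assume "1 - cnj a * w = 0"
      then have "cmod (cnj a * w) = 1" by (metis eq_iff_diff_eq_0 norm_one)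
      moreover have "cmod a * cmod w < 1"
        using that a(1) mult_left_le[of "cmod w" "cmod a"] by simp
      ultimately show False by (simp add: norm_mult)
    qed
    have khol: "k holomorphic_on S"
      unfolding k_def using g(2) by (intro holomorphic_intros)
    have kz: "{w\<in>ball 0 1. k w = 0} = Z"
    proof -
      have "w \<in> ball 0 1 \<and> k w = 0 \<longleftrightarrow> w \<in> Z" for w
      proof (cases "w = a")
        case True
        then show ?thesis using insert.hyps nz a g(3) by (auto simp: k_def)
      next
        case False
        have "w \<in> ball 0 1 \<Longrightarrow> (k w = 0 \<longleftrightarrow> f w = 0)"
          using g(4)[of w] nz[of w] assms(3) False by (force simp: k_def)
        then show ?thesis using insert.prems(3) False by blast
      qed
      then show ?thesis by blast
    qed
    have "\<exists>p\<in>S. k p \<noteq> 0"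
      using a nz g(3) by (intro bexI[of _ a]) (auto simp: k_def)
    from insert.IH[OF khol this kz] obtain m where m: "m holomorphic_on S" "\<forall>w\<in>ball 0 1. m w \<noteq> 0"
       "\<forall>w\<in>ball 0 1. cmod (k w) \<le> cmod (m w)" "\<forall>w\<in>sphere 0 1. cmod (m w) = cmod (k w)" by blast
    have 1: "cmod (f w) \<le> cmod (k w)" if "w \<in> ball 0 1" for w
    proof -
      have "w \<in> S" using that assms(3) by auto
      then show ?thesis
        unfolding k_def using g(4)[of w] that a(1)
        by (auto simp: norm_mult norm_power intro!: mult_right_mono power_mono blaschke_le)
    qed
    have 2: "cmod (k w) = cmod (f w)" if "w \<in> sphere 0 1" for w
    proof -
      have "w \<in> S" using that assms(3) by auto
      then show ?thesis
        unfolding k_def using g(4)[of w] that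
        by (auto simp: norm_mult norm_power blaschke_eq)
    qed
    show ?case
      using m 1 2 by (intro exI[of _ m] conjI ballI) (auto intro: order_trans[OF 1])
  qed
  \<comment> \<open>The closed disc is compact in \<open>S\<close>, so a nonconstant
    \<open>f\<close> has only finitely many zeros there and the induction reaches all of
    them.\<close>
  moreover have "finite {w\<in>ball 0 1. f w = 0}"
  proof (cases "f constant_on S")
    case True
    then obtain k where k: "\<And>w. w \<in> S \<Longrightarrow> f w = k" by (auto simp: constant_on_def)
    then have "k \<noteq> 0" using assms(5,6) by metis
    moreover have "f w = k" if "w \<in> ball 0 1" for w
      using k[of w] that subsetD[OF assms(3), of w] by auto
    ultimately have "{w\<in>ball 0 1. f w = 0} = {}" by auto
    then show ?thesis by (simp only: finite.emptyI)
  next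
    case False
    have "finite {w\<in>cball 0 1. f w = 0}"
      using holomorphic_compact_finite_zeros[OF assms(4,1,2) compact_cball assms(3) False] .
    then show ?thesis by (rule rev_finite_subset) auto
  qed
  ultimately show ?thesis using assms by blast
qed

text \<open>Harnack's inequality for the positive harmonic function - ln |g|. A logarithm
  \<open>h\<close> of \<open>g\<close> maps the disc to the left half-plane; a Moebius map taking
  \<open>h 0\<close> to 0 reduces the bound to the Schwarz lemma.\<close>

lemma Harnack_zero_free:
  assumes "g holomorphic_on ball 0 1" "\<And>w. w \<in> ball 0 1 \<Longrightarrow> g w \<noteq> 0" "\<And>w. w \<in> ball 0 1 \<Longrightarrow> cmod (g w) < 1"
    and w: "cmod w < 1"
  shows "ln (cmod (g w)) \<le> (1 - cmod w) / (1 + cmod w) * ln (cmod (g 0))"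
proof -
  obtain h where h: "h holomorphic_on ball 0 1" "\<And>z. z \<in> ball 0 1 \<Longrightarrow> g z = exp (h z)"
    using contractible_imp_holomorphic_log[OF assms(1) convex_imp_contractible[OF convex_ball] assms(2)] by metis
  have Re: "ln (cmod (g z)) = Re (h z)" if "cmod z < 1" for z
    using h(2)[of z] that by simp
  have neg: "Re (h z) < 0" if "cmod z < 1" for z
    using assms(3)[of z] h(2)[of z] that by simp
  define p where "p = - Re (h 0)"
  have p: "p > 0" using neg[of 0] by (simp add: p_def)
  define \<phi> where "\<phi> = (\<lambda>z. (h z - h 0) / (h z + cnj (h 0)))"
  have den: "h z + cnj (h 0) \<noteq> 0" if "cmod z < 1" for z
  proof -
    have "Re (h z + cnj (h 0)) < 0" using neg[of z] neg[of 0] that by simp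
    then show ?thesis by force
  qed
  have "\<phi> holomorphic_on ball 0 1"
    unfolding \<phi>_def using h(1) den by (intro holomorphic_intros) auto
  moreover have "\<phi> 0 = 0" by (simp add: \<phi>_def)
  moreover have "cmod (\<phi> z) < 1" if "cmod z < 1" for z
  proof -
    have "(cmod (h z + cnj (h 0)))\<^sup>2 - (cmod (h z - h 0))\<^sup>2 = 4 * (Re (h z) * Re (h 0))"
      unfolding cmod_power2 by (simp add: power2_eq_square algebra_simps)
    moreover have "Re (h z) * Re (h 0) > 0" using neg[of z] neg[of 0] that by (simp add: mult_neg_neg)
    ultimately have "(cmod (h z - h 0))\<^sup>2 < (cmod (h z + cnj (h 0)))\<^sup>2" by linarith
    then have "cmod (h z - h 0) < cmod (h z + cnj (h 0))"
      by (rule power2_less_imp_less) simp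
    then show ?thesis
      using den[OF that] by (simp add: \<phi>_def norm_divide)
  qed
  ultimately have S: "cmod (\<phi> w) \<le> cmod w"
    using Schwarz_Lemma(1)[of \<phi> w] w by blast
  define u where "u = \<phi> w"
  define r where "r = cmod w"
  have u: "cmod u \<le> r" "r < 1" "0 \<le> r" using S w by (auto simp: u_def r_def)
  have u1: "1 - u \<noteq> 0" using u by (metis norm_one not_le right_minus_eq)
  have e: "u * (h w + cnj (h 0)) = h w - h 0"
    using den[OF w] by (simp add: u_def \<phi>_def)
  have "(h w + cnj (h 0)) * (1 - u) = cnj (h 0) + h 0"
    using e by (simp add: algebra_simps)
  also have "\<dots> = of_real (- 2 * p)"
    by (simp add: p_def complex_eq_iff)
  finally have "h w = of_real (- 2 * p) * inverse (1 - u) - cnj (h 0)"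
    using u1 by (simp add: field_simps)
  then have hw: "Re (h w) = - 2 * p * Re (inverse (1 - u)) + p"
    by (simp add: p_def)
  \<comment> \<open>The extreme case is \<open>u = - r\<close>.\<close>
  have Re1: "Re (inverse (1 - u)) \<ge> 1 / (1 + r)"
  proof -
    have d: "(cmod (1 - u))\<^sup>2 > 0" using u1 by simp
    have "(cmod (1 - u))\<^sup>2 = 1 - 2 * Re u + (cmod u)\<^sup>2"
      unfolding cmod_power2 by (simp add: power2_eq_square algebra_simps)
    also have "\<dots> \<le> (1 - Re u) * (1 + r)"
    proof -
      have "(cmod u)\<^sup>2 \<le> r\<^sup>2" using u by (intro power_mono) auto
      moreover have "- Re u \<le> r" "Re u \<le> r" using u abs_Re_le_cmod[of u] by auto
      then have "0 \<le> (1 - r) * (r + Re u)" using u by (intro mult_nonneg_nonneg) auto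
      ultimately show ?thesis by (simp add: algebra_simps power2_eq_square)
    qed
    finally have "1 / (1 + r) \<le> (1 - Re u) / (cmod (1 - u))\<^sup>2"
      using d u by (simp add: field_simps)
    also have "\<dots> = Re (inverse (1 - u))"
      unfolding inverse_complex.simps cmod_power2 by simp
    finally show ?thesis .
  qed
  have "Re (h w) \<le> - 2 * p * (1 / (1 + r)) + p"
    unfolding hw using mult_left_mono[OF Re1, of "2 * p"] p by linarith
  also have "\<dots> = (1 - r) / (1 + r) * (- p)"
    using u by (simp add: field_simps)
  finally show ?thesis
    using Re[OF w] Re[of 0] by (simp add: p_def r_def)
qed

text \<open>The translates \<open>F\<close> and \<open>F(\<cdot> - \<mu>)\<close> contribute the same exponential type to their product:
  on a disc of radius comparable to the height, remove the zeros of both functions by Blaschke factors;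
  by Harnack's inequality the logarithms of the zero-free parts change by a bounded amount under
  the translation.\<close>

lemma exponential_decay_of_translate_product:
  fixes F :: "complex \<Rightarrow> complex"
  assumes hol: "F holomorphic_on {z. 0 < Im z}" and c: "0 < c" and m: "0 \<le> m"
    and bd: "\<And>z. 1 \<le> Im z \<Longrightarrow> cmod (F z) \<le> C1"
    and pr: "\<And>z. 1 \<le> Im z \<Longrightarrow> cmod (F z * F (z - of_real m)) \<le> C2 * exp (- c * Im z)"
  shows "\<exists>C y0. \<forall>z. y0 \<le> Im z \<longrightarrow> cmod (F z) \<le> C * exp (- c * Im z / 2)"
proof -
  \<comment> \<open>Normalisation: F / A has modulus less than 1 from height 1 upwards, so that the
    logarithms below are negative.\<close>
  define A where "A = 2 * \<bar>C1\<bar> + 2"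
  have A: "A > 0" by (simp add: A_def add_nonneg_pos)
  define B where "B = max 1 (C2 / A\<^sup>2)"
  have B: "B \<ge> 1" by (simp add: B_def)
  define f where "f = (\<lambda>z. F z / of_real A)"
  have f_hol: "f holomorphic_on {z. 0 < Im z}"
    unfolding f_def using hol A by (intro holomorphic_intros) auto
  have f_bd: "cmod (f z) < 1" if "1 \<le> Im z" for z
  proof -
    have "cmod (F z) < A" using bd[OF that] by (simp add: A_def)
    then show ?thesis using A by (simp add: f_def norm_divide)
  qed
  have f_pr: "cmod (f z * f (z - of_real m)) \<le> B * exp (- c * Im z)" if "1 \<le> Im z" for z
  proof -
    have "cmod (f z * f (z - of_real m)) = cmod (F z * F (z - of_real m)) / A\<^sup>2"
      using A by (simp add: f_def norm_mult norm_divide power2_eq_square)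
    also have "\<dots> \<le> C2 / A\<^sup>2 * exp (- c * Im z)"
      using pr[OF that] A by (simp add: divide_right_mono)
    also have "\<dots> \<le> B * exp (- c * Im z)"
      by (intro mult_right_mono) (auto simp: B_def)
    finally show ?thesis .
  qed
  \<comment> \<open>Half of the two losses in the final comparison: \<open>ln B\<close> from the
    maximum principle and \<open>4 * m * c\<close> from Harnack's inequality.\<close>
  define D where "D = ln B / 2 + 2 * m * c"
  have D: "D \<ge> 0" using B m c by (simp add: D_def)
  have main: "cmod (f z0) \<le> exp (D - c * Im z0 / 2)" if z0: "4 * m + 4 \<le> Im z0" for z0
  proof (rule ccontr)
    assume neg: "\<not> cmod (f z0) \<le> exp (D - c * Im z0 / 2)"
    define Y where "Y = Im z0"
    \<comment> \<open>With this radius the disc stays above height 1, and the translation becomes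
      \<open>r = m / R\<close>, at most 1/2, with \<open>r * Y = 2 * m\<close>. The Harnack loss is
      of order \<open>r\<close> times the height and so remains bounded.\<close>
    define R where "R = Y / 2"
    have Y: "Y \<ge> 4" "m \<le> R / 2" "R > 0" using z0 m by (auto simp: Y_def R_def)
    have f0: "f z0 \<noteq> 0" using neg by force
    define T where "T = (\<lambda>w. z0 + of_real R * w)"
    define S where "S = {w. 0 < Im (T w)}"
    have ImT: "Im (T w) = Y + R * Im w" for w by (simp add: T_def Y_def)
    have S: "S = {w. Im w > - (Y / R)}"
      using Y by (auto simp: S_def ImT field_simps)
    have oS: "open S" unfolding S by (rule open_halfspace_Im_gt)
    have cS: "connected S" unfolding S by (intro convex_connected convex_halfspace_Im_gt)
    have T1: "Im (T w) \<ge> 1" if "cmod w \<le> 1" for w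
    proof -
      have "R * Im w \<ge> R * (- 1)" using Y abs_Im_le_cmod[of w] that by (intro mult_left_mono) auto
      then show ?thesis using Y by (simp add: ImT R_def)
    qed
    have bS: "cball 0 1 \<subseteq> S" using T1 by (force simp: S_def)
    define f1 where "f1 = (\<lambda>w. f (T w))"
    define f2 where "f2 = (\<lambda>w. f (T w - of_real m))"
    have h1: "f1 holomorphic_on S"
      unfolding f1_def by (rule holomorphic_on_compose_gen[OF _ f_hol, unfolded o_def])
        (auto simp: S_def T_def intro!: holomorphic_intros)
    have h2: "f2 holomorphic_on S"
      unfolding f2_def by (rule holomorphic_on_compose_gen[OF _ f_hol, unfolded o_def])
        (auto simp: S_def T_def intro!: holomorphic_intros)
    define r where "r = m / R"
    have r: "0 \<le> r" "r \<le> 1/2" using Y m by (auto simp: r_def field_simps)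
    \<comment> \<open>The same value \<open>f z0\<close> is seen by \<open>f1\<close> at 0 and by
      \<open>f2\<close> at \<open>r\<close>, whereas the product will be controlled with both
      factors at 0. Harnack's inequality for \<open>g2\<close> bridges 0 and
      \<open>r\<close>.\<close>
    have v1: "f1 0 = f z0" by (simp add: f1_def T_def)
    have v2: "f2 (of_real r) = f z0" using Y by (simp add: f2_def T_def r_def)
    have r_S: "of_real r \<in> S" "0 \<in> S" using bS r by (auto intro!: subsetD[OF bS])
    obtain g1 where g1: "g1 holomorphic_on S" "\<forall>w\<in>ball 0 1. g1 w \<noteq> 0"
        "\<forall>w\<in>ball 0 1. cmod (f1 w) \<le> cmod (g1 w)" "\<forall>w\<in>sphere 0 1. cmod (g1 w) = cmod (f1 w)"
      using zero_free_majorant[OF oS cS bS h1 r_S(2)] v1 f0 by metis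
    obtain g2 where g2: "g2 holomorphic_on S" "\<forall>w\<in>ball 0 1. g2 w \<noteq> 0"
        "\<forall>w\<in>ball 0 1. cmod (f2 w) \<le> cmod (g2 w)" "\<forall>w\<in>sphere 0 1. cmod (g2 w) = cmod (f2 w)"
      using zero_free_majorant[OF oS cS bS h2 r_S(1)] v2 f0 by metis
    have max: "cmod (h w) \<le> M" if "h holomorphic_on S" "\<And>w. cmod w = 1 \<Longrightarrow> cmod (h w) \<le> M" "cmod w < 1" for h w M
    proof (rule maximum_modulus_frontier[of h "cball 0 1"])
      show "h holomorphic_on interior (cball 0 1)"
        by (rule holomorphic_on_subset[OF that(1)]) (use bS interior_subset in blast)
      show "continuous_on (closure (cball 0 1)) h"
        using holomorphic_on_imp_continuous_on[OF holomorphic_on_subset[OF that(1) bS]] by simp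
      show "\<And>z. z \<in> frontier (cball 0 1) \<Longrightarrow> cmod (h z) \<le> M"
        using that(2) by (simp add: frontier_cball)
    qed (use that(3) in auto)
    \<comment> \<open>The supremum over the circle is attained, so the strict bound 1 survives the
      maximum principle.\<close>
    obtain \<zeta> where \<zeta>: "cmod \<zeta> = 1" "\<And>w. cmod w = 1 \<Longrightarrow> cmod (f2 w) \<le> cmod (f2 \<zeta>)"
    proof -
      have "sphere 0 1 \<subseteq> S" using bS sphere_cball by blast
      then have "continuous_on (sphere 0 1) (\<lambda>w. cmod (f2 w))"
        by (intro continuous_on_norm continuous_on_subset[OF holomorphic_on_imp_continuous_on[OF h2]])
      from continuous_attains_sup[OF compact_sphere _ this]
      obtain x where "x \<in> sphere 0 1" "\<forall>y\<in>sphere 0 1. cmod (f2 y) \<le> cmod (f2 x)" by auto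
      then show ?thesis by (intro that[of x]) auto
    qed
    have g2_lt: "cmod (g2 w) < 1" if "cmod w < 1" for w
    proof -
      have "cmod (g2 w) \<le> cmod (f2 \<zeta>)" using max[OF g2(1) _ that] g2(4) \<zeta>(2) by simp
      also have "\<dots> < 1" unfolding f2_def using f_bd T1[of \<zeta>] \<zeta>(1) by simp
      finally show ?thesis .
    qed
    \<comment> \<open>The exponential cancels the assumed decay on the circle, where
      \<open>g1\<close> and \<open>g2\<close> have the moduli of \<open>f1\<close> and
      \<open>f2\<close>. The maximum principle carries the resulting bound \<open>B\<close> to the
      centre.\<close>
    define h where "h = (\<lambda>w. g1 w * g2 w * exp (- \<i> * of_real c * T w))"
    have h_hol: "h holomorphic_on S"
      unfolding h_def T_def using g1(1) g2(1) by (intro holomorphic_intros)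
    have nh: "cmod (h w) = cmod (g1 w) * cmod (g2 w) * exp (c * Im (T w))" for w
      by (simp add: h_def norm_mult)
    have h_le: "cmod (h w) \<le> B" if "cmod w = 1" for w
    proof -
      have "cmod (g1 w) * cmod (g2 w) \<le> B * exp (- c * Im (T w))"
        using f_pr[OF T1[of w]] that g1(4) g2(4) by (simp add: f1_def f2_def norm_mult)
      then have "cmod (h w) \<le> B * exp (- c * Im (T w)) * exp (c * Im (T w))"
        unfolding nh by (intro mult_right_mono) auto
      also have "\<dots> = B" by (simp add: exp_minus field_simps)
      finally show ?thesis .
    qed
    have "cmod (h 0) \<le> B" by (rule max[OF h_hol h_le]) auto
    moreover have "Im (T 0) = Y" by (simp add: ImT)
    ultimately have prod: "cmod (g1 0) * cmod (g2 0) * exp (c * Y) \<le> B" unfolding nh by simp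
    have nz: "g1 0 \<noteq> 0" "g2 0 \<noteq> 0" using g1(2) g2(2) by auto
    define p where "p = - ln (cmod (f z0))"
    define p1 where "p1 = - ln (cmod (g1 0))"
    define p2 where "p2 = - ln (cmod (g2 0))"
    have "ln (cmod (g1 0) * cmod (g2 0) * exp (c * Y)) \<le> ln B"
      using prod nz B by (subst ln_le_cancel_iff) auto
    then have e1: "p1 + p2 \<ge> c * Y - ln B"
      using nz by (simp add: ln_mult p1_def p2_def)
    have "cmod (f z0) \<le> cmod (g1 0)" using g1(3)[rule_format, of 0] v1 by simp
    then have e2: "p1 \<le> p" using f0 nz by (simp add: p_def p1_def)
    have "g2 holomorphic_on ball 0 1"
      using g2(1) bS by (rule holomorphic_on_subset[OF _ subset_trans[OF ball_subset_cball]])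
    from Harnack_zero_free[OF this, of "of_real r"]
    have H: "ln (cmod (g2 (of_real r))) \<le> (1 - r) / (1 + r) * ln (cmod (g2 0))"
      using g2(2) g2_lt r by auto
    have "cmod (f z0) \<le> cmod (g2 (of_real r))" using g2(3)[rule_format, of "of_real r"] v2 r by simp
    then have "ln (cmod (f z0)) \<le> ln (cmod (g2 (of_real r)))" using f0 by (subst ln_le_cancel_iff) auto
    with H have "(1 - r) / (1 + r) * p2 \<le> p" by (simp add: p_def p2_def)
    then have e3: "(1 - r) * p2 \<le> (1 + r) * p" using r by (simp add: field_simps)
    have e4: "p < c * Y / 2 - D"
    proof -
      have "exp (D - c * Y / 2) < cmod (f z0)" using neg by (simp add: Y_def)
      then have "D - c * Y / 2 < ln (cmod (f z0))" using f0 by (metis exp_less_cancel_iff exp_ln zero_less_norm_iff)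
      then show ?thesis by (simp add: p_def)
    qed
    have "cmod (f z0) < 1" using f_bd z0 m by auto
    then have p0: "p > 0" using f0 by (simp add: p_def)
    \<comment> \<open>\<open>p\<^sub>2 \<le> p + 4 r p\<close> because \<open>(1 + r) / (1 - r) \<le> 1 + 4 r\<close> for \<open>r \<le> 1/2\<close>\<close>
    have "p2 \<le> p + 4 * r * p"
    proof -
      have "(1 + r) * p \<le> (1 - r) * (p + 4 * r * p)"
      proof -
        have "0 \<le> p * (2 * r * (1 - 2 * r))" using p0 r by (intro mult_nonneg_nonneg) auto
        then show ?thesis by (simp add: algebra_simps power2_eq_square)
      qed
      with e3 have "(1 - r) * p2 \<le> (1 - r) * (p + 4 * r * p)" by linarith
      then show ?thesis using r by simp
    qed
    moreover have "4 * r * p \<le> 4 * m * c"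
    proof -
      have "4 * r * p \<le> 4 * r * (c * Y / 2)" using e4 D r p0 by (intro mult_left_mono) auto
      also have "\<dots> = 4 * m * c" using Y by (simp add: r_def R_def field_simps)
      finally show ?thesis .
    qed
    ultimately have "c * Y - ln B \<le> 2 * p + 4 * m * c" using e1 e2 by linarith
    with e4 show False by (simp add: D_def)
  qed
  have "cmod (F z) \<le> A * exp D * exp (- c * Im z / 2)" if "4 * m + 4 \<le> Im z" for z
  proof -
    have "cmod (F z) \<le> A * exp (D - c * Im z / 2)"
      using main[OF that] A by (simp add: f_def norm_divide field_simps)
    also have "D - c * Im z / 2 = D + - c * Im z / 2" by simp
    finally show ?thesis unfolding exp_add by (simp only: mult.assoc)
  qed
  then show ?thesis by blast
qed

section \<open>Descent to translation invariance\<close>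

text \<open>Modulation shifts the frequency variable, and undoing the shift pulls exp(i c z) out of
  the Laplace integral. The frequencies \<open>0 < l \<le> c\<close> gained on the way contribute
  nothing, by the H^1 hypothesis.\<close>

lemma cauchy_modulate:
  assumes \<phi>: "integrable lborel \<phi>" and h: "\<And>l. 0 \<le> l \<Longrightarrow> fourier \<phi> l = 0" and c: "0 \<le> c" and z: "0 < Im z"
  shows "cauchy (\<lambda>x. exp (\<i> * of_real (c * x)) * \<phi> x) z = exp (\<i> * of_real c * z) * cauchy \<phi> z"
proof -
  define I where "I = (\<lambda>k. (indicator {0<..} k *\<^sub>R exp (\<i> * z * of_real k)) * fourier \<phi> (- k))"
  have "cauchy \<phi> z = \<i> * (LINT k|lborel. I k)"
    using cauchy_eq_laplace_fourier[OF \<phi>, of "-1" z] z by (simp add: I_def)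
  moreover have "cauchy (\<lambda>x. exp (\<i> * of_real (c * x)) * \<phi> x) z
      = \<i> * (LINT l|lborel. (indicator {0<..} l *\<^sub>R exp (\<i> * z * of_real l)) * fourier \<phi> (c - l))"
    using cauchy_eq_laplace_fourier[OF fourier_integrable[OF \<phi>], of "-1" z c] z
    by (simp only: fourier_shift_frequency) simp
  moreover have "(LINT l|lborel. (indicator {0<..} l *\<^sub>R exp (\<i> * z * of_real l)) * fourier \<phi> (c - l))
      = (LINT l|lborel. exp (\<i> * of_real c * z) * I (l - c))"
  proof (intro Bochner_Integration.integral_cong refl)
    fix l :: real
    consider "l \<le> 0" | "0 < l" "l \<le> c" | "c < l" by linarith
    then show "(indicator {0<..} l *\<^sub>R exp (\<i> * z * of_real l)) * fourier \<phi> (c - l) = exp (\<i> * of_real c * z) * I (l - c)"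
    proof cases
      case 3
      have "exp (\<i> * z * of_real l) = exp (\<i> * of_real c * z) * exp (\<i> * z * of_real (l - c))"
        by (simp add: mult_exp_exp algebra_simps)
      then show ?thesis using 3 c by (simp add: I_def)
    qed (use c h[of "c - l"] in \<open>auto simp: I_def\<close>)
  qed
  moreover have "(LINT l|lborel. exp (\<i> * of_real c * z) * I (l - c)) = exp (\<i> * of_real c * z) * (LINT k|lborel. I k)"
    using lborel_integral_shift[of I c] by simp
  ultimately show ?thesis by simp
qed

text \<open>A nonempty open set is not null; the end points follow by continuity.\<close>

lemma AE_zero_imp_zero_on_interval:
  fixes X :: "real \<Rightarrow> complex"
  assumes X: "continuous_on UNIV X" and ae: "AE x in lborel. x \<in> {0..a} \<longrightarrow> X x = 0" and a: "0 < a" and x: "x \<in> {0..a}"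
  shows "X x = 0"
proof -
  define U where "U = {x \<in> {0<..<a}. X x \<noteq> 0}"
  have "U = {0<..<a} \<inter> X -` (- {0})" by (auto simp: U_def)
  moreover have "open (X -` (- {0}))" using X by (intro open_vimage) auto
  ultimately have oU: "open U" by auto
  have "AE x in lborel. x \<notin> U" using ae by eventually_elim (auto simp: U_def)
  then have "U \<in> null_sets lborel" using oU by (subst (asm) AE_iff_null_sets[symmetric]) auto
  then have "negligible U" using null_sets_completionI[of U lborel] by (simp add: negligible_iff_null_sets)
  then have "U = {}" using oU open_not_negligible by blast
  then have z: "\<And>x. x \<in> {0<..<a} \<Longrightarrow> X x = 0" by (auto simp: U_def)
  show ?thesis
    by (rule continuous_constant_on_closure[of "{0<..<a}" X]) (use z a x X in \<open>auto intro: continuous_on_subset\<close>)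
qed

text \<open>If the Cauchy integral decays like \<open>exp (- a Im z)\<close>, then
  \<open>N(z) = \<integral>\<^sub>0\<^sup>a exp (\<i> \<xi> z) X(\<xi>) d\<xi>\<close>, with \<open>X\<close> the Fourier transform, makes \<open>exp (- \<i> a z) N(z)\<close> a bounded entire
  function tending to \<open>0\<close> along the negative imaginary axis.\<close>

lemma fourier_eq_0_of_cauchy_decay:
  assumes f: "integrable lborel \<theta>" and a: "0 < a"
    and dec: "\<And>z. y0 \<le> Im z \<Longrightarrow> cmod (cauchy \<theta> z) \<le> C * exp (- a * Im z)"
    and \<xi>: "0 \<le> \<xi>" "\<xi> \<le> a"
  shows "fourier \<theta> (- \<xi>) = 0"
proof -
  define X where "X = (\<lambda>\<xi>. fourier \<theta> (- \<xi>))"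
  define M where "M = (LINT x|lborel. cmod (\<theta> x))"
  have M: "M \<ge> 0" by (simp add: M_def)
  have XM: "cmod (X \<xi>) \<le> M" for \<xi> unfolding X_def M_def by (rule fourier_bound[OF f])
  have Xc: "continuous_on UNIV X"
    unfolding X_def by (intro continuous_on_compose2[OF fourier_continuous[OF f]] continuous_intros) auto
  have [measurable]: "X \<in> borel_measurable borel" using Xc by (rule borel_measurable_continuous_onI)
  define G where "G = (\<lambda>z \<xi>. exp (\<i> * z * of_real \<xi>) * X \<xi>)"
  have Gc: "continuous_on A (G z)" for A z
    unfolding G_def by (intro continuous_intros continuous_on_subset[OF Xc]) auto
  \<comment> \<open>High above the line, the frequencies beyond \<open>a\<close> contribute at most
    a multiple of exp(- a Im z) in any case. The decay hypothesis thus concerns this truncated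
    integral, which is entire because its frequencies are bounded.\<close>
  define N where "N = (\<lambda>z. LINT \<xi>|lborel. indicator {0..a} \<xi> *\<^sub>R G z \<xi>)"
  have Ni: "integrable lborel (\<lambda>\<xi>. indicator {0..a} \<xi> *\<^sub>R G z \<xi>)" for z
    using borel_integrable_atLeastAtMost'[OF Gc[of "{0..a}" z]] by (simp add: set_integrable_def)
  have N_HK: "N z = integral (cbox 0 a) (G z)" for z
    using set_borel_integral_eq_integral(2)[of "{0..a}" "G z"] Ni[of z]
    by (simp add: N_def set_lebesgue_integral_def set_integrable_def)
  have "N holomorphic_on UNIV"
    unfolding N_HK
  proof (rule leibniz_rule_holomorphic[where fx = "\<lambda>z \<xi>. (\<i> * of_real \<xi>) * (exp (\<i> * z * of_real \<xi>) * X \<xi>)"])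
    show "((\<lambda>z. G z t) has_field_derivative \<i> * of_real t * (exp (\<i> * z * of_real t) * X t)) (at z within UNIV)" for z t
      unfolding G_def by (auto intro!: derivative_eq_intros)
    show "G z integrable_on cbox 0 a" for z by (rule integrable_continuous[OF Gc])
    show "continuous_on (UNIV \<times> cbox 0 a) (\<lambda>(z, t). \<i> * of_real t * (exp (\<i> * z * of_real t) * X t))"
      unfolding split_beta by (intro continuous_intros continuous_on_compose2[OF Xc]) auto
  qed auto
  define P where "P = (\<lambda>z. N z * exp (- \<i> * of_real a * z))"
  have P_hol: "P holomorphic_on UNIV" unfolding P_def using \<open>N holomorphic_on UNIV\<close> by (intro holomorphic_intros)
  have nG: "cmod (G z \<xi>) \<le> exp (- Im z * \<xi>) * M" for z \<xi>
    using XM[of \<xi>] by (simp add: G_def norm_mult)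
  \<comment> \<open>For Im z \<ge> 1 and \<xi> > a one has exp(- Im z \<xi>) \<le> exp(- a Im z)
    exp(a - \<xi>); \<open>T\<close> bounds the tail after removal of the first factor.\<close>
  define T where "T = (LINT l|lborel. indicator {0<..} l * (exp (- l) * (exp a * M)))"
  define Y where "Y = max 1 y0"
  have Ti: "integrable lborel (\<lambda>l. indicator {0<..} l * (exp (- l) * (exp a * M)))"
  proof -
    have "integrable lborel (\<lambda>l::real. (indicator {0<..} l * exp (- l)) * (exp a * M))"
      using integrable_I0i_exp_mscale[of 1] by (intro integrable_mult_left) (simp add: set_integrable_def)
    then show ?thesis by (simp only: mult.assoc)
  qed
  have P1: "cmod (P z) \<le> \<bar>C\<bar> + T" if z: "Y \<le> Im z" for z
  proof -
    have y: "Im z \<ge> 1" "Im z \<ge> y0" using z by (auto simp: Y_def)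
    have G0: "integrable lborel (\<lambda>\<xi>. indicator {0<..} \<xi> *\<^sub>R G z \<xi>)"
    proof -
      have "integrable lborel (\<lambda>\<xi>. indicator {0<..} \<xi> *\<^sub>R exp (\<i> * z * of_real \<xi>))"
        using y by (intro exp_halfline(1)) simp
      from integral_abs_bound_mult(1)[OF this _ XM] show ?thesis by (simp add: G_def mult.commute)
    qed
    define R where "R = (LINT \<xi>|lborel. indicator {a<..} \<xi> *\<^sub>R G z \<xi>)"
    have Ri: "integrable lborel (\<lambda>\<xi>. indicator {a<..} \<xi> *\<^sub>R G z \<xi>)"
      by (rule Bochner_Integration.integrable_bound[OF G0]) (use a in \<open>auto simp: G_def indicator_def\<close>)
    have "cauchy \<theta> z = \<i> * (LINT \<xi>|lborel. indicator {0<..} \<xi> *\<^sub>R G z \<xi>)"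
      using cauchy_eq_laplace_fourier[OF f, of "-1" z] y by (simp add: G_def X_def)
    also have "(LINT \<xi>|lborel. indicator {0<..} \<xi> *\<^sub>R G z \<xi>) = (LINT \<xi>|lborel. indicator {0..a} \<xi> *\<^sub>R G z \<xi> + indicator {a<..} \<xi> *\<^sub>R G z \<xi>)"
    proof (rule integral_cong_AE)
      have "AE \<xi> in lborel. \<xi> \<noteq> (0::real)" by (rule AE_lborel_singleton)
      then show "AE \<xi> in lborel. indicator {0<..} \<xi> *\<^sub>R G z \<xi> = indicator {0..a} \<xi> *\<^sub>R G z \<xi> + indicator {a<..} \<xi> *\<^sub>R G z \<xi>"
        by eventually_elim (use a in \<open>auto simp: indicator_def\<close>)
    qed (auto simp: G_def)
    also have "\<dots> = N z + R" unfolding N_def R_def using Ni Ri by simp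
    finally have cN: "cauchy \<theta> z = \<i> * (N z + R)" .
    have "cmod R \<le> (LINT \<xi>|lborel. exp (- a * Im z) * (indicator {0<..} \<xi> * (exp (- \<xi>) * (exp a * M))))"
      unfolding R_def
    proof (rule order_trans[OF integral_norm_bound integral_mono])
      show "integrable lborel (\<lambda>\<xi>. norm (indicator {a<..} \<xi> *\<^sub>R G z \<xi>))" using integrable_norm[OF Ri] .
      show "integrable lborel (\<lambda>\<xi>. exp (- a * Im z) * (indicator {0<..} \<xi> * (exp (- \<xi>) * (exp a * M))))" using Ti by simp
      fix \<xi> :: real
      show "norm (indicator {a<..} \<xi> *\<^sub>R G z \<xi>) \<le> exp (- a * Im z) * (indicator {0<..} \<xi> * (exp (- \<xi>) * (exp a * M)))"
      proof (cases "a < \<xi>")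
        case True
        have "(\<xi> - a) * 1 \<le> (\<xi> - a) * Im z" using True y by (intro mult_left_mono) auto
        then have "exp (- Im z * \<xi>) \<le> exp (- a * Im z + (- \<xi> + a))" by (simp add: algebra_simps)
        then have "exp (- Im z * \<xi>) * M \<le> exp (- a * Im z + (- \<xi> + a)) * M" using M by (intro mult_right_mono)
        with nG[of z \<xi>] have "cmod (G z \<xi>) \<le> exp (- a * Im z + (- \<xi> + a)) * M" by (rule order_trans)
        also have "\<dots> = exp (- a * Im z) * (exp (- \<xi>) * (exp a * M))" by (simp only: exp_add mult.assoc)
        finally show ?thesis using True a by simp
      qed (use M in auto)
    qed
    then have "cmod R \<le> exp (- a * Im z) * T" by (simp add: T_def)
    moreover have "cmod (cauchy \<theta> z) \<le> \<bar>C\<bar> * exp (- a * Im z)"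
      using dec[OF y(2)] by (rule order_trans) (intro mult_right_mono, auto)
    moreover have "N z = - \<i> * cauchy \<theta> z - R" using cN by simp
    then have "cmod (N z) \<le> cmod (cauchy \<theta> z) + cmod R"
      using norm_triangle_ineq4[of "- \<i> * cauchy \<theta> z" R] by (simp add: norm_mult)
    ultimately have "cmod (N z) \<le> (\<bar>C\<bar> + T) * exp (- a * Im z)" by (simp add: algebra_simps)
    then have "cmod (N z) * exp (a * Im z) \<le> (\<bar>C\<bar> + T) * exp (- a * Im z) * exp (a * Im z)" by (intro mult_right_mono) auto
    also have "\<dots> = \<bar>C\<bar> + T" by (simp add: mult.assoc mult_exp_exp)
    finally show ?thesis by (simp add: P_def norm_mult)
  qed
  have Pint: "P z = (LINT \<xi>|lborel. indicator {0..a} \<xi> *\<^sub>R (exp (\<i> * z * of_real (\<xi> - a)) * X \<xi>))" for z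
  proof -
    have "P z = (LINT \<xi>|lborel. indicator {0..a} \<xi> *\<^sub>R G z \<xi> * exp (- \<i> * of_real a * z))"
      unfolding P_def N_def by (rule integral_mult_left_zero[symmetric])
    also have "\<dots> = (LINT \<xi>|lborel. indicator {0..a} \<xi> *\<^sub>R (exp (\<i> * z * of_real (\<xi> - a)) * X \<xi>))"
    proof (intro Bochner_Integration.integral_cong refl)
      fix \<xi> :: real
      have "exp (\<i> * z * of_real (\<xi> - a)) = exp (\<i> * z * of_real \<xi>) * exp (- \<i> * of_real a * z)"
        by (simp add: mult_exp_exp algebra_simps)
      then show "indicator {0..a} \<xi> *\<^sub>R G z \<xi> * exp (- \<i> * of_real a * z) = indicator {0..a} \<xi> *\<^sub>R (exp (\<i> * z * of_real (\<xi> - a)) * X \<xi>)"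
        by (simp add: G_def mult.commute mult.left_commute)
    qed
    finally show ?thesis .
  qed
  have ia: "integrable lborel (\<lambda>\<xi>. indicator {0..a} \<xi> *\<^sub>R K)" for K :: real
    using a by (intro integrable_scaleR_left integrable_real_indicator) auto
  have nI: "norm (indicator {0..a} \<xi> *\<^sub>R (exp (\<i> * z * of_real (\<xi> - a)) * X \<xi>)) \<le> indicator {0..a} \<xi> *\<^sub>R (exp (a * Y) * M)" if "Im z \<le> Y" for z \<xi>
  proof (cases "\<xi> \<in> {0..a}")
    case True
    have "Im z * (a - \<xi>) \<le> Y * (a - \<xi>)" using that True by (intro mult_right_mono) auto
    also have "\<dots> \<le> Y * a" using True by (intro mult_left_mono) (auto simp: Y_def)
    finally have "exp (Im z * (a - \<xi>)) \<le> exp (a * Y)" by (simp add: mult.commute)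
    then have "exp (Im z * (a - \<xi>)) * cmod (X \<xi>) \<le> exp (a * Y) * M" using XM by (intro mult_mono) auto
    then show ?thesis using True by (simp add: norm_mult algebra_simps)
  qed auto
  \<comment> \<open>In \<open>P\<close> the frequencies are \<xi> - a \<le> 0, so the integrand is
    bounded on every lower half-plane. This complements \<open>P1\<close>.\<close>
  have P2: "cmod (P z) \<le> (LINT \<xi>|lborel. indicator {0..a} \<xi> *\<^sub>R (exp (a * Y) * M))" if z: "Im z \<le> Y" for z
    unfolding Pint
  proof (rule order_trans[OF integral_norm_bound integral_mono])
    show "integrable lborel (\<lambda>\<xi>. norm (indicator {0..a} \<xi> *\<^sub>R (exp (\<i> * z * of_real (\<xi> - a)) * X \<xi>)))"
    proof (rule Bochner_Integration.integrable_bound[OF ia[of "exp (a * Y) * M"]])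
      show "AE \<xi> in lborel. norm (norm (indicator {0..a} \<xi> *\<^sub>R (exp (\<i> * z * of_real (\<xi> - a)) * X \<xi>)))
          \<le> norm (indicator {0..a} \<xi> *\<^sub>R (exp (a * Y) * M))"
        using order_trans[OF nI[OF z] abs_ge_self] by (intro AE_I2) (simp only: real_norm_def abs_norm_cancel)
    qed simp
  qed (use ia nI[OF z] in auto)
  have "bounded (range P)"
  proof (rule boundedI)
    fix w assume "w \<in> range P"
    then obtain z where w: "w = P z" by blast
    show "norm w \<le> max (\<bar>C\<bar> + T) (LINT \<xi>|lborel. indicator {0..a} \<xi> *\<^sub>R (exp (a * Y) * M))"
      unfolding w using P1[of z] P2[of z] by (cases "Y \<le> Im z") (auto simp: le_max_iff_disj)
  qed
  then have "P constant_on UNIV" using Liouville_theorem P_hol by blast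
  then obtain \<kappa> where \<kappa>: "P z = \<kappa>" for z by (auto simp: constant_on_def)
  have "(\<lambda>n. P (Complex 0 (- real n))) \<longlonglongrightarrow> (LINT \<xi>|(lborel :: real measure). (0::complex))"
    unfolding Pint
  proof (rule integral_dominated_convergence[where w = "\<lambda>\<xi>. indicator {0..a} \<xi> *\<^sub>R (exp (a * Y) * M)"])
    have e: "exp (\<i> * Complex 0 (- real n) * of_real (\<xi> - a)) = of_real (exp (real n * (\<xi> - a)))" for n \<xi>
    proof -
      have "\<i> * Complex 0 (- real n) * of_real (\<xi> - a) = of_real (real n * (\<xi> - a))" by (simp add: complex_eq_iff)
      then show ?thesis by (simp only: exp_of_real)
    qed
    have "AE \<xi> in lborel. \<xi> \<noteq> a" by (rule AE_lborel_singleton)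
    then show "AE \<xi> in lborel. (\<lambda>n. indicator {0..a} \<xi> *\<^sub>R (exp (\<i> * Complex 0 (- real n) * of_real (\<xi> - a)) * X \<xi>)) \<longlonglongrightarrow> 0"
    proof eventually_elim
      case (elim \<xi>)
      show ?case
      proof (cases "\<xi> \<in> {0..a}")
        case True
        then have "\<xi> - a < 0" using elim by simp
        then have "(\<lambda>n. exp (real n * (\<xi> - a))) \<longlonglongrightarrow> 0" by real_asymp
        then have "(\<lambda>n. indicator {0..a} \<xi> *\<^sub>R (complex_of_real (exp (real n * (\<xi> - a))) * X \<xi>)) \<longlonglongrightarrow> indicator {0..a} \<xi> *\<^sub>R (of_real 0 * X \<xi>)"
          by (intro tendsto_intros)
        then show ?thesis by (simp only: e) simp
      qed auto
    qed
    show "AE \<xi> in lborel. norm (indicator {0..a} \<xi> *\<^sub>R (exp (\<i> * Complex 0 (- real n) * of_real (\<xi> - a)) * X \<xi>)) \<le> indicator {0..a} \<xi> *\<^sub>R (exp (a * Y) * M)" for n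
      by (intro AE_I2 nI) (simp add: Y_def)
    show "integrable lborel (\<lambda>\<xi>. indicator {0..a} \<xi> *\<^sub>R (exp (a * Y) * M))" by (rule ia)
  qed auto
  then have "\<kappa> = 0" by (simp add: \<kappa> LIMSEQ_const_iff)
  then have N0: "N z = 0" for z using \<kappa>[of z] by (simp add: P_def)
  \<comment> \<open>On the real line \<open>N\<close> is the Fourier transform of the truncated
    \<open>X\<close>.\<close>
  have "AE \<xi> in lborel. indicator {0..a} \<xi> *\<^sub>R X \<xi> = 0"
  proof (rule AE_eq_0_of_fourier_eq_0)
    show "integrable lborel (\<lambda>\<xi>. indicator {0..a} \<xi> *\<^sub>R X \<xi>)" using Ni[of 0] by (simp add: G_def)
    show "fourier (\<lambda>\<xi>. indicator {0..a} \<xi> *\<^sub>R X \<xi>) l = 0" for l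
      using N0[of "of_real l"] by (simp add: N_def fourier_def G_def mult.assoc)
  qed
  then have "AE \<xi> in lborel. \<xi> \<in> {0..a} \<longrightarrow> X \<xi> = 0" by eventually_elim (auto simp: indicator_def)
  then have "X \<xi> = 0" using AE_zero_imp_zero_on_interval[OF Xc _ a, of \<xi>] \<xi> by auto
  then show ?thesis by (simp add: X_def)
qed

section \<open>Modulations, translations and the halving step\<close>

lemma Dop_L2: "f \<in> L2 \<Longrightarrow> Dop m f \<in> L2"
  unfolding Dop_def by (rule L2_shift)

lemma Mop_Mop: "Mop a (Mop b f) = Mop (a + b) f"
proof
  fix x
  have "exp (\<i> * complex_of_real (a * x)) * exp (\<i> * of_real (b * x)) = exp (\<i> * of_real ((a + b) * x))"
    by (simp add: mult_exp_exp algebra_simps)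
  then show "Mop a (Mop b f) x = Mop (a + b) f x" by (simp only: Mop_def mult.assoc[symmetric])
qed

lemma Mop_0 [simp]: "Mop 0 f = f"
  by (simp add: Mop_def)

lemma Dop_0 [simp]: "Dop 0 f = f"
  by (simp add: Dop_def)

lemma fourier_translate: "fourier (\<lambda>x. \<phi> (x - m)) l = exp (\<i> * of_real (l * m)) * fourier \<phi> l"
proof -
  have e: "exp (\<i> * complex_of_real (l * x)) = exp (\<i> * of_real (l * m)) * exp (\<i> * of_real (l * (x - m)))" for x
    by (simp add: mult_exp_exp algebra_simps)
  have "fourier (\<lambda>x. \<phi> (x - m)) l = (LINT x|lborel. exp (\<i> * of_real (l * m)) * (exp (\<i> * of_real (l * (x - m))) * \<phi> (x - m)))"
    unfolding fourier_def by (intro Bochner_Integration.integral_cong refl) (subst e, simp only: mult.assoc)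
  also have "\<dots> = exp (\<i> * of_real (l * m)) * (LINT x|lborel. exp (\<i> * of_real (l * (x - m))) * \<phi> (x - m))"
    by (rule integral_mult_right_zero)
  also have "(LINT x|lborel. exp (\<i> * of_real (l * (x - m))) * \<phi> (x - m)) = fourier \<phi> l"
    unfolding fourier_def by (rule lborel_integral_shift)
  finally show ?thesis .
qed

lemma cauchy_translate: "cauchy (\<lambda>x. \<phi> (x - m)) z = cauchy \<phi> (z - of_real m)"
proof -
  have "cauchy (\<lambda>x. \<phi> (x - m)) z = (LINT x|lborel. inverse (of_real (x - m) - (z - of_real m)) * \<phi> (x - m))"
    by (simp add: cauchy_def)
  also have "\<dots> = cauchy \<phi> (z - of_real m)"
    unfolding cauchy_def by (rule lborel_integral_shift)
  finally show ?thesis .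
qed

text \<open>Pairing \<open>g1\<close> and \<open>g2\<close> with \<open>\<psi>\<close> and
  \<open>Dop m \<psi>\<close>, the rank one identity says that, up to a unimodular constant,
  \<open>cauchy \<theta> z * cauchy \<theta> (z - of_real m)\<close> is the product of the Cauchy
  integral of exp(i c x) \<phi>_2m, the factor exp(i c z) and the Cauchy integral of the translated
  \<phi>_0. Both Cauchy integrals are bounded for Im z \<ge> 1, which leaves the decay exp(- c Im
  z).\<close>

lemma halve_modulation:
  assumes K: "closed_subspace K" and MK: "\<And>l f. 0 \<le> l \<Longrightarrow> f \<in> K \<Longrightarrow> Mop l f \<in> K"
    and c: "0 < c" and MD: "\<And>l m f. c \<le> l \<Longrightarrow> 0 \<le> m \<Longrightarrow> f \<in> K \<Longrightarrow> Mop l (Dop m f) \<in> K"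
    and l: "c / 2 \<le> l" and m: "0 \<le> m" and f: "f \<in> K"
  shows "Mop l (Dop m f) \<in> K"
proof -
  have fL: "f \<in> L2" using f closed_subspaceD(1)[OF K] by blast
  have "inner2 (Mop l (Dop m f)) \<psi> = 0" if \<psi>: "\<psi> \<in> L2" and perp: "\<forall>h\<in>K. inner2 h \<psi> = 0" for \<psi>
  proof -
    define \<phi> where "\<phi> = (\<lambda>m x. f (x - m) * cnj (\<psi> x))"
    have \<phi>i: "integrable lborel (\<phi> m)" for m
      unfolding \<phi>_def by (intro L2_integrable_inner L2_shift fL \<psi>)
    have \<phi>f: "fourier (\<phi> m) l = inner2 (Mop l (Dop m f)) \<psi>" for m l
      by (simp add: inner2_Mop \<phi>_def Dop_def)
    have H0: "fourier (\<phi> 0) l = 0" if "0 \<le> l" for l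
      using perp MK[OF that f] by (simp add: \<phi>f)
    have Hc: "fourier (\<phi> m) l = 0" if "c \<le> l" "0 \<le> m" for m l
      using perp MD[OF that f] by (simp add: \<phi>f)
    define E where "E = (\<lambda>x. exp (\<i> * complex_of_real (c * x)))"
    have E_shift: "E x = E m * E (x - m)" for x
      by (simp add: E_def mult_exp_exp algebra_simps)
    define \<theta> where "\<theta> = (\<lambda>x. E x * \<phi> m x)"
    have \<theta>i: "integrable lborel \<theta>" unfolding \<theta>_def E_def by (rule fourier_integrable[OF \<phi>i])
    define \<Psi> where "\<Psi> = {\<psi>, Dop m \<psi>}"
    have \<Psi>: "\<Psi> \<subseteq> L2" using \<psi> Dop_L2 by (auto simp: \<Psi>_def)
    define g1 where "g1 = Mop c (Dop m f)"
    define g2 where "g2 = Mop c (Dop (m + m) f)"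
    have gL: "g1 \<in> L2" "g2 \<in> L2" unfolding g1_def g2_def by (intro Mop_L2 Dop_L2 fL)+
    \<comment> \<open>Translating both vectors translates the product, which multiplies its Fourier
      transform by unimodular scalars. Vanishing frequencies against \<open>\<psi>\<close> thus
      carry over to \<open>Dop m \<psi>\<close>.\<close>
    have sh: "(\<lambda>x. Dop (k + m) f x * cnj (Dop m \<psi> x)) = (\<lambda>x. \<phi> k (x - m))" for k
      by (simp add: \<phi>_def Dop_def algebra_simps)
    have g1H: "g1 \<in> hardy_annihilator \<Psi>"
    proof -
      have "inner2 (Mop l g1) \<psi> = 0" if "0 \<le> l" for l
        using Hc[of "l + c" m] that m by (simp add: g1_def Mop_Mop \<phi>f)
      moreover have "inner2 (Mop l g1) (Dop m \<psi>) = 0" if "0 \<le> l" for l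
        using sh[of 0] H0[of "l + c"] that c by (simp add: g1_def Mop_Mop inner2_Mop fourier_translate)
      ultimately show ?thesis using gL by (auto simp: hardy_annihilator_def \<Psi>_def)
    qed
    have g2H: "g2 \<in> hardy_annihilator \<Psi>"
    proof -
      have "inner2 (Mop l g2) \<psi> = 0" if "0 \<le> l" for l
        unfolding g2_def Mop_Mop \<phi>f[symmetric] by (rule Hc) (use that m in auto)
      moreover have "inner2 (Mop l g2) (Dop m \<psi>) = 0" if "0 \<le> l" for l
        unfolding g2_def Mop_Mop inner2_Mop sh fourier_translate using Hc[of "l + c" m] that m by simp
      ultimately show ?thesis using gL by (auto simp: hardy_annihilator_def \<Psi>_def)
    qed
    define M where "M = (LINT x|lborel. cmod (\<theta> x))"
    define M2 where "M2 = (LINT x|lborel. cmod (g2 x * cnj (\<psi> x)))"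
    define M0 where "M0 = (LINT x|lborel. cmod (\<phi> 0 (x - m)))"
    have Mnn: "0 \<le> M" "0 \<le> M2" "0 \<le> M0" by (auto simp: M_def M2_def M0_def)
    have \<phi>0s: "integrable lborel (\<lambda>x. \<phi> 0 (x - m))"
      using lborel_integrable_real_affine[OF \<phi>i[of 0], of 1 "-m"] by simp
    have scale: "cauchy (\<lambda>x. a * u x) z = a * cauchy u z" for a u z
      by (simp add: cauchy_def mult.left_commute)
    have bd: "cmod (cauchy \<theta> z) \<le> M" if "1 \<le> Im z" for z
      unfolding M_def by (rule cauchy_bound_Im_ge_1[OF \<theta>i that])
    have pr: "cmod (cauchy \<theta> z * cauchy \<theta> (z - of_real m)) \<le> (M2 * M0) * exp (- c * Im z)" if z: "1 \<le> Im z" for z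
    proof -
      have z0: "0 < Im z" using z by simp
      have r: "cauchy (\<lambda>x. g1 x * cnj (\<psi> x)) z * cauchy (\<lambda>x. g2 x * cnj (Dop m \<psi> x)) z
          = cauchy (\<lambda>x. g2 x * cnj (\<psi> x)) z * cauchy (\<lambda>x. g1 x * cnj (Dop m \<psi> x)) z"
        by (rule cauchy_rank_one[OF \<Psi> g1H g2H _ _ z0]) (auto simp: \<Psi>_def)
      have e1: "(\<lambda>x. g1 x * cnj (\<psi> x)) = \<theta>"
        by (simp add: g1_def \<theta>_def \<phi>_def Mop_def Dop_def E_def mult.assoc)
      have "(\<lambda>x. g2 x * cnj (Dop m \<psi> x)) = (\<lambda>x. E x * \<phi> m (x - m))"
        using sh[of m] unfolding g2_def Mop_def E_def mult.assoc fun_eq_iff by simp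
      also have "\<dots> = (\<lambda>x. E m * \<theta> (x - m))"
        by (subst E_shift) (simp add: \<theta>_def mult.assoc)
      finally have e2: "cauchy (\<lambda>x. g2 x * cnj (Dop m \<psi> x)) z = E m * cauchy \<theta> (z - of_real m)"
        by (simp only: scale cauchy_translate)
      have "(\<lambda>x. g1 x * cnj (Dop m \<psi> x)) = (\<lambda>x. E x * \<phi> 0 (x - m))"
        using sh[of 0] by (simp add: g1_def Mop_def E_def mult.assoc fun_eq_iff)
      then have "cauchy (\<lambda>x. g1 x * cnj (Dop m \<psi> x)) z = cauchy (\<lambda>x. exp (\<i> * of_real (c * x)) * \<phi> 0 (x - m)) z"
        by (simp add: E_def)
      \<comment> \<open>\<open>\<phi> 0\<close> is in H^1 before modulation, so modulating it yields
        the decisive factor of modulus exp(- c Im z).\<close>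
      also have "\<dots> = exp (\<i> * of_real c * z) * cauchy (\<lambda>x. \<phi> 0 (x - m)) z"
        using c H0 z0 by (intro cauchy_modulate \<phi>0s) (auto simp: fourier_translate)
      finally have e3: "cauchy (\<lambda>x. g1 x * cnj (Dop m \<psi> x)) z = exp (\<i> * of_real c * z) * cauchy (\<lambda>x. \<phi> 0 (x - m)) z" .
      have b2: "cmod (cauchy (\<lambda>x. g2 x * cnj (\<psi> x)) z) \<le> M2"
        unfolding M2_def by (rule cauchy_bound_Im_ge_1[OF L2_integrable_inner[OF gL(2) \<psi>] z])
      have b0: "cmod (cauchy (\<lambda>x. \<phi> 0 (x - m)) z) \<le> M0"
        unfolding M0_def by (rule cauchy_bound_Im_ge_1[OF \<phi>0s z])
      have "cmod (cauchy \<theta> z * cauchy \<theta> (z - of_real m)) = cmod (cauchy \<theta> z * (E m * cauchy \<theta> (z - of_real m)))"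
        by (simp add: norm_mult E_def del: of_real_mult)
      also have "\<dots> = cmod (cauchy (\<lambda>x. g2 x * cnj (\<psi> x)) z) * (exp (- c * Im z) * cmod (cauchy (\<lambda>x. \<phi> 0 (x - m)) z))"
        using r by (simp add: e1 e2 e3 norm_mult)
      also have "\<dots> \<le> M2 * (exp (- c * Im z) * M0)"
        using Mnn by (intro mult_mono b2 b0 mult_nonneg_nonneg) auto
      finally show ?thesis by (simp add: algebra_simps)
    qed
    obtain C y0 where dec: "\<And>z. y0 \<le> Im z \<Longrightarrow> cmod (cauchy \<theta> z) \<le> C * exp (- c * Im z / 2)"
      using exponential_decay_of_translate_product[OF cauchy_holomorphic[OF \<theta>i] c m bd pr] by blast
    show ?thesis
    proof (cases "c \<le> l")
      case True
      then show ?thesis using Hc[of l m] m by (simp add: \<phi>f)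
    next
      case False
      \<comment> \<open>The frequency \<open>l\<close> of \<open>\<phi> m\<close> is the frequency
        \<open>l - c\<close> of \<open>\<theta>\<close>, and the decay rate \<open>c / 2\<close>
        covers the range \<open>c - l \<le> c / 2\<close>.\<close>
      have "fourier \<theta> (- (c - l)) = 0"
        by (rule fourier_eq_0_of_cauchy_decay[OF \<theta>i, of "c / 2" y0 C]) (use dec c l False in auto)
      moreover have "fourier \<theta> (- (c - l)) = fourier (\<phi> m) l"
        unfolding \<theta>_def E_def fourier_shift_frequency by simp
      ultimately show ?thesis by (simp add: \<phi>f)
    qed
  qed
  then show ?thesis
    using closed_subspace_mem_iff[OF K Mop_L2[OF Dop_L2[OF fL]]] by blast
qed

text \<open>Iterated halving leaves modulations by \<open>c / 2 ^ n\<close>. Their inner products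
  with a vector orthogonal to \<open>K\<close> are values of one Fourier transform, which is
  continuous at 0.\<close>

lemma translation_invariant:
  assumes K: "closed_subspace K" and MK: "\<And>l f. 0 \<le> l \<Longrightarrow> f \<in> K \<Longrightarrow> Mop l f \<in> K"
    and c: "0 < c" and MD: "\<And>l m f. c \<le> l \<Longrightarrow> 0 \<le> m \<Longrightarrow> f \<in> K \<Longrightarrow> Mop l (Dop m f) \<in> K"
    and m: "0 \<le> m" and f: "f \<in> K"
  shows "Dop m f \<in> K"
proof -
  have fL: "f \<in> L2" using f closed_subspaceD(1)[OF K] by blast
  have step: "\<forall>l m f. c / 2 ^ n \<le> l \<longrightarrow> 0 \<le> m \<longrightarrow> f \<in> K \<longrightarrow> Mop l (Dop m f) \<in> K" for n
  proof (induction n)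
    case 0 then show ?case using MD by simp
  next
    case (Suc n)
    then show ?case
      using halve_modulation[OF K MK, of "c / 2 ^ n"] c by (auto simp: mult.commute)
  qed
  have "inner2 (Dop m f) \<psi> = 0" if \<psi>: "\<psi> \<in> L2" and perp: "\<forall>h\<in>K. inner2 h \<psi> = 0" for \<psi>
  proof -
    define \<phi> where "\<phi> = (\<lambda>x. Dop m f x * cnj (\<psi> x))"
    have "integrable lborel \<phi>" unfolding \<phi>_def by (intro L2_integrable_inner Dop_L2 fL \<psi>)
    moreover have "(\<lambda>n. c / 2 ^ n) \<longlonglongrightarrow> 0" by real_asymp
    ultimately have "(\<lambda>n. fourier \<phi> (c / 2 ^ n)) \<longlonglongrightarrow> fourier \<phi> 0" by (rule fourier_tendsto)
    moreover have "fourier \<phi> (c / 2 ^ n) = 0" for n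
      using step[of n] m f perp by (auto simp: \<phi>_def inner2_Mop[symmetric])
    ultimately have "fourier \<phi> 0 = 0" by (simp add: LIMSEQ_const_iff)
    then show ?thesis by (simp add: \<phi>_def fourier_def inner2_def)
  qed
  then show ?thesis using closed_subspace_mem_iff[OF K Dop_L2[OF fL]] by blast
qed

section \<open>Bounded analytic functions on the half-plane\<close>

lemma path_image_upper_half_circle:
  assumes "0 \<le> R" "w \<in> path_image (part_circlepath 0 R 0 pi)"
  shows "0 \<le> Im w" "cmod w = R"
proof -
  obtain t where t: "t \<in> {0..pi}" "w = of_real R * exp (\<i> * of_real t)"
    using assms by (auto simp: path_image_part_circlepath)
  have "Im w = R * sin t" by (simp add: t(2) Im_exp)
  then show "0 \<le> Im w" using assms(1) t(1) by (simp add: sin_ge_zero)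
  show "cmod w = R" using assms(1) by (simp add: t(2) norm_mult)
qed

text \<open>Cauchy's theorem on a segment closed by an upper half circle, whose contribution is of
  order 1 / R. The margin \<open>e\<close> provides a convex open neighbourhood of the
  contour.\<close>

lemma integral_real_line_eq_0:
  assumes e: "0 < e" and hol: "g holomorphic_on {z. - e < Im z}" and int: "integrable lborel (\<lambda>x. g (of_real x))"
    and bd: "\<And>z. 0 \<le> Im z \<Longrightarrow> R0 \<le> cmod z \<Longrightarrow> cmod (g z) \<le> C / (cmod z)\<^sup>2"
  shows "(LINT x|lborel. g (of_real x)) = 0"
proof -
  have cont: "continuous_on {z. - e < Im z} g" using hol by (rule holomorphic_on_imp_continuous_on)
  have gc: "continuous_on A (\<lambda>x. g (complex_of_real x))" for A
    by (rule continuous_on_compose2[OF cont]) (use e in \<open>auto intro!: continuous_intros\<close>)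
  have eq: "(LINT x|lborel. indicator {-R..R} x *\<^sub>R g (of_real x)) = - contour_integral (part_circlepath 0 R 0 pi) g"
    if R: "0 < R" for R
  proof -
    define \<gamma> where "\<gamma> = linepath (- complex_of_real R) (of_real R) +++ part_circlepath 0 R 0 pi"
    have im: "path_image (linepath (- complex_of_real R) (of_real R)) \<subseteq> {z. - e < Im z}"
      unfolding path_image_linepath using e by (intro closed_segment_subset convex_halfspace_Im_gt) auto
    have ip: "path_image (part_circlepath 0 R 0 pi) \<subseteq> {z. - e < Im z}"
      using path_image_upper_half_circle(1)[of R] R e by force
    have pf: "pathfinish (linepath (- complex_of_real R) (of_real R)) = pathstart (part_circlepath 0 R 0 pi)"
      by simp
    have vp: "valid_path \<gamma>" unfolding \<gamma>_def using pf by (intro valid_path_join) auto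
    have "(g has_contour_integral 0) \<gamma>"
    proof (rule Cauchy_theorem_convex_simple[OF hol])
      show "convex {z. - e < Im z}" by (rule convex_halfspace_Im_gt)
      show "path_image \<gamma> \<subseteq> {z. - e < Im z}" unfolding \<gamma>_def using im ip by (intro subset_path_image_join)
      show "pathfinish \<gamma> = pathstart \<gamma>" by (simp add: \<gamma>_def exp_pi_i)
    qed (rule vp)
    then have "contour_integral \<gamma> g = 0" by (rule contour_integral_unique)
    moreover have cl: "g contour_integrable_on linepath (- complex_of_real R) (of_real R)"
      using continuous_on_subset[OF cont im] by (intro contour_integrable_continuous_linepath) simp
    moreover have "g contour_integrable_on part_circlepath 0 R 0 pi"
      by (intro contour_integrable_continuous_part_circlepath continuous_on_subset[OF cont ip])
    ultimately have 1: "contour_integral (linepath (- complex_of_real R) (of_real R)) g = - contour_integral (part_circlepath 0 R 0 pi) g"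
      unfolding \<gamma>_def using pf by (subst (asm) contour_integral_join) (auto simp: eq_neg_iff_add_eq_0)
    have "((\<lambda>x. g (of_real x)) has_integral contour_integral (linepath (- complex_of_real R) (of_real R)) g) {-R..R}"
      using has_contour_integral_linepath_Reals_iff[of "- complex_of_real R" "of_real R" g] has_contour_integral_integral[OF cl] R
      by (auto simp: Reals_minus_iff)
    then have "integral {-R..R} (\<lambda>x. g (of_real x)) = contour_integral (linepath (- complex_of_real R) (of_real R)) g"
      by (rule integral_unique)
    moreover have "set_integrable lborel {-R..R} (\<lambda>x. g (of_real x))"
      by (rule borel_integrable_atLeastAtMost'[OF gc])
    then have "(LINT x|lborel. indicator {-R..R} x *\<^sub>R g (of_real x)) = integral {-R..R} (\<lambda>x. g (of_real x))"
      using set_borel_integral_eq_integral(2) by (simp add: set_lebesgue_integral_def)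
    ultimately show ?thesis using 1 by simp
  qed
  define n0 where "n0 = nat \<lceil>max 1 R0\<rceil>"
  have "(\<lambda>n. LINT x|lborel. indicator {- real n..real n} x *\<^sub>R g (of_real x)) \<longlonglongrightarrow> 0"
  proof (rule Lim_null_comparison)
    have "\<forall>\<^sub>F n in sequentially. n0 \<le> n" by (rule eventually_ge_at_top)
    then show "\<forall>\<^sub>F n in sequentially. norm (LINT x|lborel. indicator {- real n..real n} x *\<^sub>R g (of_real x)) \<le> \<bar>C\<bar> / (real n)\<^sup>2 * real n * pi"
    proof eventually_elim
      case (elim n)
      then have n: "real n \<ge> 1" "real n \<ge> R0" by (auto simp: n0_def)
      have "cmod (contour_integral (part_circlepath 0 (real n) 0 pi) g) \<le> \<bar>C\<bar> / (real n)\<^sup>2 * real n * \<bar>pi - 0\<bar>"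
      proof (rule contour_integral_bound_part_circlepath)
        show "g contour_integrable_on part_circlepath 0 (real n) 0 pi"
          using path_image_upper_half_circle(1)[of "real n"] e
          by (intro contour_integrable_continuous_part_circlepath continuous_on_subset[OF cont]) force
        fix w assume "w \<in> path_image (part_circlepath 0 (real n) 0 pi)"
        then have "0 \<le> Im w" "cmod w = real n" using path_image_upper_half_circle[of "real n" w] by auto
        then have "cmod (g w) \<le> C / (real n)\<^sup>2" using bd[of w] n by simp
        also have "\<dots> \<le> \<bar>C\<bar> / (real n)\<^sup>2" by (intro divide_right_mono) auto
        finally show "cmod (g w) \<le> \<bar>C\<bar> / (real n)\<^sup>2" .
      qed auto
      then show ?case using eq[of "real n"] n by simp
    qed
    show "(\<lambda>n. \<bar>C\<bar> / (real n)\<^sup>2 * real n * pi) \<longlonglongrightarrow> 0" by real_asymp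
  qed
  moreover have "(\<lambda>n. LINT x|lborel. indicator {- real n..real n} x *\<^sub>R g (of_real x)) \<longlonglongrightarrow> (LINT x|lborel. g (of_real x))"
  proof (rule integral_dominated_convergence[where w = "\<lambda>x. cmod (g (of_real x))"])
    have [measurable]: "(\<lambda>x. g (complex_of_real x)) \<in> borel_measurable borel" using gc[of UNIV] by (rule borel_measurable_continuous_onI)
    show "(\<lambda>x. g (complex_of_real x)) \<in> borel_measurable lborel" by simp
    show "(\<lambda>x. indicator {- real n..real n} x *\<^sub>R g (complex_of_real x)) \<in> borel_measurable lborel" for n by simp
    show "integrable lborel (\<lambda>x. cmod (g (of_real x)))" using int by simp
    show "AE x in lborel. (\<lambda>n. indicator {- real n..real n} x *\<^sub>R g (complex_of_real x)) \<longlonglongrightarrow> g (of_real x)"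
    proof (rule AE_I2, rule tendsto_eventually)
      fix x :: real
      obtain N where "\<bar>x\<bar> < real N" using reals_Archimedean2 by blast
      then show "\<forall>\<^sub>F n in sequentially. indicator {- real n..real n} x *\<^sub>R g (of_real x) = g (of_real x)"
        by (intro eventually_sequentiallyI[of N]) (auto simp: indicator_def)
    qed
    show "AE x in lborel. norm (indicator {- real n..real n} x *\<^sub>R g (complex_of_real x)) \<le> cmod (g (of_real x))" for n
      by (auto simp: indicator_def)
  qed
  ultimately show ?thesis by (rule LIMSEQ_unique[symmetric])
qed

lemma poisson_integral:
  assumes y: "0 < y"
  shows "integrable lborel (\<lambda>s. 1 / ((s - x)\<^sup>2 + y\<^sup>2))" and "(LINT s|lborel. 1 / ((s - x)\<^sup>2 + y\<^sup>2)) = pi / y"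
proof -
  have U: "einterval (- \<infinity>) \<infinity> = UNIV" by (auto simp: einterval_def)
  have i: "integrable lborel (\<lambda>s::real. inverse (1 + s\<^sup>2))"
    using integrable_inverse_1_plus_square by (simp add: U set_integrable_def)
  have p: "(LINT s|lborel. inverse (1 + s\<^sup>2)) = pi"
    using LBINT_inverse_1_plus_square by (simp add: interval_lebesgue_integral_def U set_lebesgue_integral_def)
  have e: "1 / ((s - x)\<^sup>2 + y\<^sup>2) = inverse (y\<^sup>2) * inverse (1 + (- x / y + 1 / y * s)\<^sup>2)" for s
  proof -
    have "- x / y + 1 / y * s = (s - x) / y" using y by (simp add: field_simps)
    then have "1 + (- x / y + 1 / y * s)\<^sup>2 = ((s - x)\<^sup>2 + y\<^sup>2) / y\<^sup>2"
      using y by (simp only: power_divide) (simp add: field_simps)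
    then show ?thesis using y by (simp only:) (simp add: inverse_eq_divide)
  qed
  show "integrable lborel (\<lambda>s. 1 / ((s - x)\<^sup>2 + y\<^sup>2))"
    unfolding e using lborel_integrable_real_affine[OF i, of "1 / y" "- x / y"] y by (intro integrable_mult_right) simp
  define J where "J = (LINT s|lborel. inverse (1 + (- x / y + 1 / y * s)\<^sup>2))"
  have "pi = (1 / y) * J"
    using lborel_integral_real_affine[of "1 / y" "\<lambda>s. inverse (1 + s\<^sup>2)" "- x / y"] y p by (simp add: J_def)
  then have "J = pi * y" using y by (simp add: field_simps)
  moreover have "(LINT s|lborel. 1 / ((s - x)\<^sup>2 + y\<^sup>2)) = inverse (y\<^sup>2) * J"
    unfolding e J_def by (rule integral_mult_right_zero)
  ultimately show "(LINT s|lborel. 1 / ((s - x)\<^sup>2 + y\<^sup>2)) = pi / y"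
    using y by (simp add: field_simps power2_eq_square)
qed

text \<open>The pole at \<open>p\<close> is removed by subtracting from \<open>G\<close> the
  multiple of 1 / (z - cnj p) with the same value at \<open>p\<close>. After division by z - p the
  difference has integral 0 over the line, and the subtracted part gives an explicit Poisson
  integral.\<close>

lemma half_plane_Cauchy_formula:
  assumes e: "0 < e" and hol: "G holomorphic_on {z. - e < Im z}"
    and bd: "\<And>z. 0 \<le> Im z \<Longrightarrow> cmod (G z) \<le> C / (1 + (cmod z)\<^sup>2)" and p: "0 < Im p"
  shows "integrable lborel (\<lambda>s. G (of_real s))"
    and "(LINT s|lborel. G (of_real s) * inverse (of_real s - p)) = 2 * of_real pi * \<i> * G p"
proof -
  define y where "y = Im p"
  have y: "y > 0" using p by (simp add: y_def)
  have C: "0 \<le> C" using order_trans[OF norm_ge_zero bd[of 0]] by simp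
  have cont: "continuous_on {z. - e < Im z} G" using hol by (rule holomorphic_on_imp_continuous_on)
  have "continuous_on UNIV (\<lambda>x. G (complex_of_real x))"
    by (rule continuous_on_compose2[OF cont]) (use e in \<open>auto intro!: continuous_intros\<close>)
  then have [measurable]: "(\<lambda>x. G (complex_of_real x)) \<in> borel_measurable borel" by (rule borel_measurable_continuous_onI)
  show Gi: "integrable lborel (\<lambda>s. G (of_real s))"
  proof (rule Bochner_Integration.integrable_bound)
    show "integrable lborel (\<lambda>s. C * (1 / ((s - 0)\<^sup>2 + 1\<^sup>2)))"
      using poisson_integral(1)[of 1 0] by (intro integrable_mult_right) simp
    show "AE s in lborel. norm (G (of_real s)) \<le> norm (C * (1 / ((s - 0)\<^sup>2 + 1\<^sup>2)))"
      using bd[of "of_real _"] C by (intro AE_I2) (simp add: add.commute)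
  qed simp
  define q where "q = cnj p"
  define k where "k = (\<lambda>z. G z - G p * (2 * \<i> * of_real y) * inverse (z - q))"
  define S where "S = {z. - min e y < Im z}"
  have oS: "open S" unfolding S_def by (rule open_halfspace_Im_gt)
  have qS: "z - q \<noteq> 0" if "z \<in> S" for z
    using that by (auto simp: S_def q_def y_def)
  have k_hol: "k holomorphic_on S"
    unfolding k_def using qS by (intro holomorphic_intros holomorphic_on_subset[OF hol]) (auto simp: S_def)
  have pq: "p - q = 2 * \<i> * of_real y" by (simp add: q_def y_def complex_eq_iff)
  have kp: "k p = 0"
  proof -
    have "p - q \<noteq> 0" using y by (simp add: pq)
    then have "(2 * \<i> * of_real y) * inverse (p - q) = 1" unfolding pq[symmetric] by (rule right_inverse)
    then show ?thesis by (simp only: k_def mult.assoc) simp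
  qed
  define H where "H = (\<lambda>z. if z = p then deriv k p else k z / (z - p))"
  have H_hol: "H holomorphic_on S"
    by (rule pole_theorem_open_0[OF k_hol oS, where a = p]) (auto simp: H_def kp)
  have sp: "complex_of_real s \<noteq> p" "complex_of_real s - q \<noteq> 0" for s using p by (auto simp: q_def complex_eq_iff)
  have Hs: "H (of_real s) = G (of_real s) * inverse (of_real s - p) - (G p * (2 * \<i> * of_real y)) * of_real (1 / ((s - Re p)\<^sup>2 + y\<^sup>2))" for s
  proof -
    have "(of_real s - q) * (of_real s - p) = of_real ((s - Re p)\<^sup>2 + y\<^sup>2)"
      by (simp add: complex_eq_iff q_def y_def power2_eq_square algebra_simps)
    then have "inverse (of_real s - q) * inverse (of_real s - p) = of_real (1 / ((s - Re p)\<^sup>2 + y\<^sup>2))"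
      by (simp only: inverse_mult_distrib[symmetric]) (simp add: inverse_eq_divide)
    moreover have "H (of_real s) = k (of_real s) * inverse (of_real s - p)"
      using sp by (simp add: H_def divide_inverse)
    ultimately show ?thesis by (simp only: k_def left_diff_distrib mult.assoc)
  qed
  have i1: "integrable lborel (\<lambda>s. G (of_real s) * inverse (of_real s - p))"
  proof -
    have "integrable lborel (\<lambda>s. inverse (of_real s - p) * G (of_real s))" using Gi p by (intro cauchy_integrable) auto
    then show ?thesis by (simp only: mult.commute)
  qed
  have i2: "integrable lborel (\<lambda>s. (G p * (2 * \<i> * of_real y)) * complex_of_real (1 / ((s - Re p)\<^sup>2 + y\<^sup>2)))"
    by (intro integrable_mult_right integrable_of_real poisson_integral(1) y)
  have "(LINT s|lborel. H (of_real s)) = 0"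
  proof (rule integral_real_line_eq_0)
    show "0 < min e y" using e y by simp
    show "H holomorphic_on {z. - min e y < Im z}" using H_hol by (simp add: S_def)
    show "integrable lborel (\<lambda>x. H (of_real x))" unfolding Hs using i1 i2 by simp
    \<comment> \<open>From this radius on, \<open>z\<close> keeps distance at least
      \<open>cmod z / 2\<close> from both \<open>p\<close> and \<open>cnj p\<close>.\<close>
    fix z assume z: "0 \<le> Im z" "2 * cmod p + 1 \<le> cmod z"
    have z1: "cmod z \<ge> 1" "cmod p \<le> cmod z / 2" using z(2) norm_ge_zero[of p] by linarith+
    have dp: "cmod z / 2 \<le> cmod (z - p)" using norm_triangle_ineq2[of z p] z1 by simp
    have dq: "cmod z / 2 \<le> cmod (z - q)" using norm_triangle_ineq2[of z q] z1 by (simp add: q_def)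
    have zp: "z \<noteq> p" using z1 by auto
    have "cmod (k z) \<le> cmod (G z) + cmod (G p * (2 * \<i> * of_real y) * inverse (z - q))"
      unfolding k_def by (rule norm_triangle_ineq4)
    also have "cmod (G p * (2 * \<i> * of_real y) * inverse (z - q)) = cmod (G p) * 2 * y / cmod (z - q)"
      using y by (simp add: norm_mult norm_inverse divide_inverse)
    also have "\<dots> \<le> cmod (G p) * 2 * y / (cmod z / 2)"
      using dq z1 y by (intro divide_left_mono mult_pos_pos) auto
    also have "cmod (G z) \<le> C / cmod z"
    proof -
      have "cmod z \<le> (cmod z)\<^sup>2" using z1 by (simp add: power2_eq_square mult_le_cancel_right1)
      then have "C / (1 + (cmod z)\<^sup>2) \<le> C / cmod z" using C z1 by (intro divide_left_mono mult_pos_pos add_pos_nonneg) auto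
      then show ?thesis using bd[OF z(1)] by linarith
    qed
    finally have "cmod (k z) \<le> (C + 4 * cmod (G p) * y) / cmod z" by (simp add: add_divide_distrib mult.commute mult.left_commute)
    moreover have "cmod (H z) = cmod (k z) / cmod (z - p)" using zp by (simp add: H_def norm_divide)
    ultimately have "cmod (H z) \<le> ((C + 4 * cmod (G p) * y) / cmod z) / (cmod z / 2)"
      using dp z1 C y by (simp only:) (intro frac_le, auto)
    then show "cmod (H z) \<le> (2 * (C + 4 * cmod (G p) * y)) / (cmod z)\<^sup>2"
      by (simp add: power2_eq_square mult.commute)
  qed
  then have "(LINT s|lborel. G (of_real s) * inverse (of_real s - p)) =
     (LINT s|lborel. (G p * (2 * \<i> * of_real y)) * complex_of_real (1 / ((s - Re p)\<^sup>2 + y\<^sup>2)))"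
    unfolding Hs using i1 i2 by simp
  also have "\<dots> = (G p * (2 * \<i> * of_real y)) * of_real (LINT s|lborel. 1 / ((s - Re p)\<^sup>2 + y\<^sup>2))"
    by (simp only: integral_mult_right_zero integral_complex_of_real)
  also have "\<dots> = 2 * of_real pi * \<i> * G p"
    unfolding poisson_integral(2)[OF y] using y by simp
  finally show "(LINT s|lborel. G (of_real s) * inverse (of_real s - p)) = 2 * of_real pi * \<i> * G p" .
qed

section \<open>Integrals of bounded analytic functions against H^1\<close>

lemma Hinf_bounded:
  assumes "h \<in> Hinf" shows "\<exists>B. AE x in lborel. cmod (h x) \<le> B"
proof -
  obtain F where F: "bounded (F ` {z. 0 < Im z})" "AE x in lborel. ((\<lambda>y. F (Complex x y)) \<longlongrightarrow> h x) (at_right 0)"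
    using assms by (auto simp: Hinf_def)
  obtain B where B: "\<And>z. 0 < Im z \<Longrightarrow> cmod (F z) \<le> B" using F(1) by (auto simp: bounded_iff)
  have "AE x in lborel. cmod (h x) \<le> B"
    using F(2)
  proof eventually_elim
    case (elim x)
    have "\<forall>\<^sub>F y in at_right 0. cmod (F (Complex x y)) \<le> B"
      using eventually_at_right_less by eventually_elim (simp add: B)
    then show ?case using tendsto_norm[OF elim] by (intro tendsto_upperbound[where F = "at_right 0"]) auto
  qed
  then show ?thesis by blast
qed

text \<open>\<open>F\<close> need not extend past the line or decay. Raised by \<open>d n\<close>
  and damped by an inverse square, it obeys the Cauchy formula; Fubini then expresses its integral
  against \<open>\<phi>\<close> through Cauchy integrals of \<open>\<phi>\<close> below the line,
  which vanish. Dominated convergence removes the regularisation.\<close>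

lemma integral_Hinf_eq_0:
  assumes \<phi>: "integrable lborel \<phi>" and f0: "\<And>l. 0 \<le> l \<Longrightarrow> fourier \<phi> l = 0" and h: "h \<in> Hinf"
  shows "(LINT x|lborel. h x * \<phi> x) = 0"
proof -
  have [measurable]: "\<phi> \<in> borel_measurable borel" using \<phi> borel_measurable_integrable by force
  have [measurable]: "h \<in> borel_measurable borel" using h by (simp add: Hinf_def)
  obtain F where F: "F holomorphic_on {z. 0 < Im z}" "bounded (F ` {z. 0 < Im z})"
      "AE x in lborel. ((\<lambda>y. F (Complex x y)) \<longlongrightarrow> h x) (at_right 0)"
    using h by (auto simp: Hinf_def)
  obtain B where B: "\<And>z. 0 < Im z \<Longrightarrow> cmod (F z) \<le> B" using F(2) by (auto simp: bounded_iff)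
  have B0: "0 \<le> B" using order_trans[OF norm_ge_zero B[of \<i>]] by simp
  define d where "d = (\<lambda>n. 1 / real (Suc n))"
  have d: "0 < d n" "d n \<le> 1" for n by (auto simp: d_def)
  \<comment> \<open>The damping factor tends to 1 and has modulus at most 1 above the line. Its pole
    is at - i / d n, which lies outside the half-plane Im z > - d n because
    \<open>d n \<le> 1\<close>.\<close>
  define G where "G = (\<lambda>n z. F (z + \<i> * of_real (d n)) * (inverse (1 - \<i> * of_real (d n) * z))\<^sup>2)"
  have Re_den: "Re (1 - \<i> * of_real (d n) * z) = 1 + d n * Im z" for n z by simp
  have den1: "cmod (inverse (1 - \<i> * of_real (d n) * z)) \<le> 1" if "0 \<le> Im z" for n z
  proof -
    have "1 \<le> cmod (1 - \<i> * of_real (d n) * z)"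
      using complex_Re_le_cmod[of "1 - \<i> * of_real (d n) * z"] Re_den[of n z] d[of n] that
      by (smt (verit, best) mult_nonneg_nonneg)
    then show ?thesis by (simp add: norm_inverse inverse_le_1_iff)
  qed
  have GB: "cmod (G n z) \<le> B" if "0 \<le> Im z" for n z
  proof -
    have "cmod (G n z) \<le> B * 1\<^sup>2"
      unfolding G_def norm_mult norm_power using d[of n] that B0
      by (intro mult_mono B power_mono den1) auto
    then show ?thesis by simp
  qed
  have G_hol: "G n holomorphic_on {z. - d n < Im z}" for n
  proof -
    have "(\<lambda>z. F (z + \<i> * of_real (d n))) holomorphic_on {z. - d n < Im z}"
      by (rule holomorphic_on_compose_gen[OF _ F(1), unfolded o_def]) (auto intro!: holomorphic_intros)
    moreover have "1 - \<i> * of_real (d n) * z \<noteq> 0" if "- d n < Im z" for z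
    proof -
      have "d n * (- d n) < d n * Im z" using that d[of n] by (intro mult_strict_left_mono) auto
      moreover have "d n * d n \<le> 1" using d[of n] by (simp add: mult_le_one)
      ultimately have "Re (1 - \<i> * of_real (d n) * z) > 0" unfolding Re_den by simp
      then show ?thesis by force
    qed
    ultimately show ?thesis unfolding G_def by (intro holomorphic_intros) auto
  qed
  have G_bd: "cmod (G n z) \<le> (B / (d n)\<^sup>2) / (1 + (cmod z)\<^sup>2)" if z: "0 \<le> Im z" for n z
  proof -
    have "(cmod (1 - \<i> * of_real (d n) * z))\<^sup>2 = (1 + d n * Im z)\<^sup>2 + (d n * Re z)\<^sup>2"
      unfolding cmod_power2 by simp
    moreover have "(1 + d n * Im z)\<^sup>2 \<ge> (d n)\<^sup>2 + (d n)\<^sup>2 * (Im z)\<^sup>2"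
    proof -
      have "(1 + d n * Im z)\<^sup>2 = 1 + 2 * (d n * Im z) + (d n)\<^sup>2 * (Im z)\<^sup>2" by (simp add: power2_eq_square algebra_simps)
      moreover have "(d n)\<^sup>2 \<le> 1" using d[of n] by (simp add: power_le_one)
      moreover have "0 \<le> d n * Im z" using d[of n] z by (intro mult_nonneg_nonneg) auto
      ultimately show ?thesis by linarith
    qed
    ultimately have "(d n)\<^sup>2 * (1 + (cmod z)\<^sup>2) \<le> (cmod (1 - \<i> * of_real (d n) * z))\<^sup>2"
      by (simp add: cmod_power2 power_mult_distrib algebra_simps)
    moreover have "0 < (d n)\<^sup>2 * (1 + (cmod z)\<^sup>2)" using d[of n] by (intro mult_pos_pos add_pos_nonneg) auto
    ultimately have "1 / (cmod (1 - \<i> * of_real (d n) * z))\<^sup>2 \<le> 1 / ((d n)\<^sup>2 * (1 + (cmod z)\<^sup>2))" by (intro frac_le) auto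
    then have "cmod ((inverse (1 - \<i> * of_real (d n) * z))\<^sup>2) \<le> 1 / ((d n)\<^sup>2 * (1 + (cmod z)\<^sup>2))"
      by (simp add: norm_power norm_inverse power_inverse inverse_eq_divide[of "_ ^ 2 :: real"])
    then have "cmod (G n z) \<le> B * (1 / ((d n)\<^sup>2 * (1 + (cmod z)\<^sup>2)))"
      unfolding G_def norm_mult using d[of n] z B0 by (intro mult_mono B) auto
    then show ?thesis by simp
  qed
  \<comment> \<open>The Cauchy formula needs an interior point, so the evaluation lies another
    \<open>d n\<close> above the line; hence the heights \<open>2 * d n\<close> in the limit
    below.\<close>
  have zero: "(LINT t|lborel. G n (Complex t (d n)) * \<phi> t) = 0" for n
  proof -
    \<comment> \<open>Seen as a function of \<open>s\<close>, the kernel has its pole above the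
      line; seen as a function of \<open>t\<close>, below it, where \<open>cauchy \<phi>\<close>
      vanishes.\<close>
    have ki: "inverse (of_real s - Complex t (d n)) = - inverse (of_real t - Complex s (- d n))" for s t
    proof -
      have "of_real s - Complex t (d n) = - (of_real t - Complex s (- d n))" by (simp add: complex_eq_iff)
      then show ?thesis by (simp only: inverse_minus_eq)
    qed
    have "(LINT s|lborel. G n (of_real s) * (LINT t|lborel. inverse (of_real s - Complex t (d n)) * \<phi> t))
       = (LINT t|lborel. (LINT s|lborel. G n (of_real s) * inverse (of_real s - Complex t (d n))) * \<phi> t)"
    proof (rule Fubini_kernel[OF \<phi>, where C = "1 / d n"])
      show "integrable lborel (\<lambda>s. G n (of_real s))"
        using d[of n] by (intro half_plane_Cauchy_formula(1)[OF _ G_hol G_bd, of n \<i>]) auto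
      show "cmod (inverse (of_real s - Complex t (d n))) \<le> 1 / d n" for s t
        using cauchy_kernel_bound[of "Complex t (d n)" s] d[of n] by simp
      have "(\<lambda>(s, t). inverse (complex_of_real s - (of_real t + \<i> * of_real (d n)))) \<in> borel_measurable (borel \<Otimes>\<^sub>M borel)" by measurable
      then show "(\<lambda>(s, t). inverse (complex_of_real s - Complex t (d n))) \<in> borel_measurable (borel \<Otimes>\<^sub>M borel)"
        by (simp add: Complex_eq)
    qed
    moreover have "(LINT t|lborel. inverse (of_real s - Complex t (d n)) * \<phi> t) = 0" for s
    proof -
      have "(LINT t|lborel. inverse (of_real s - Complex t (d n)) * \<phi> t) = - cauchy \<phi> (Complex s (- d n))"
        unfolding ki by (simp add: cauchy_def)
      also have "\<dots> = 0" using cauchy_eq_0_of_fourier_eq_0[OF \<phi> f0, of "Complex s (- d n)"] d[of n] by simp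
      finally show ?thesis .
    qed
    moreover have "(LINT s|lborel. G n (of_real s) * inverse (of_real s - Complex t (d n))) = 2 * of_real pi * \<i> * G n (Complex t (d n))" for t
      using d[of n] by (intro half_plane_Cauchy_formula(2)[OF _ G_hol G_bd]) auto
    ultimately have "(LINT t|lborel. (2 * of_real pi * \<i>) * (G n (Complex t (d n)) * \<phi> t)) = 0"
      by (simp only: mult.assoc) simp
    then show ?thesis by (simp only: integral_mult_right_zero) simp
  qed
  have Gm: "(\<lambda>t. G n (Complex t (d n))) \<in> borel_measurable borel" for n
  proof (rule borel_measurable_continuous_onI, rule continuous_on_compose2[OF holomorphic_on_imp_continuous_on[OF G_hol[of n]]])
    show "continuous_on UNIV (\<lambda>t. Complex t (d n))" by (intro continuous_intros)
  qed (use d[of n] in \<open>auto intro: less_trans[of _ 0]\<close>)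
  have "(\<lambda>n. LINT t|lborel. G n (Complex t (d n)) * \<phi> t) \<longlonglongrightarrow> (LINT x|lborel. h x * \<phi> x)"
  proof (rule integral_dominated_convergence[where w = "\<lambda>x. B * cmod (\<phi> x)"])
    show "(\<lambda>x. h x * \<phi> x) \<in> borel_measurable lborel" by simp
    show "(\<lambda>x. G n (Complex x (d n)) * \<phi> x) \<in> borel_measurable lborel" for n using Gm[of n] by simp
    show "integrable lborel (\<lambda>x. B * cmod (\<phi> x))" using \<phi> by simp
    show "AE x in lborel. norm (G n (Complex x (d n)) * \<phi> x) \<le> B * cmod (\<phi> x)" for n
      using d[of n] by (intro AE_I2) (auto simp: norm_mult intro!: mult_right_mono GB)
    show "AE x in lborel. (\<lambda>n. G n (Complex x (d n)) * \<phi> x) \<longlonglongrightarrow> h x * \<phi> x"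
      using F(3)
    proof eventually_elim
      case (elim x)
      have d0: "d \<longlonglongrightarrow> 0" unfolding d_def by real_asymp
      have "filterlim (\<lambda>n. 2 * d n) (at_right 0) sequentially"
        unfolding d_def by real_asymp
      then have "(\<lambda>n. F (Complex x (2 * d n))) \<longlonglongrightarrow> h x" by (rule filterlim_compose[OF elim])
      moreover have "(\<lambda>n. (inverse (1 - \<i> * of_real (d n) * (of_real x + \<i> * of_real (d n))))\<^sup>2) \<longlonglongrightarrow> (inverse (1 - \<i> * of_real 0 * (of_real x + \<i> * of_real 0)))\<^sup>2"
        by (intro tendsto_intros d0) auto
      ultimately have "(\<lambda>n. F (Complex x (2 * d n)) * (inverse (1 - \<i> * of_real (d n) * (of_real x + \<i> * of_real (d n))))\<^sup>2 * \<phi> x) \<longlonglongrightarrow> h x * 1 * \<phi> x"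
        by (intro tendsto_mult) auto
      moreover have "G n (Complex x (d n)) = F (Complex x (2 * d n)) * (inverse (1 - \<i> * of_real (d n) * (of_real x + \<i> * of_real (d n))))\<^sup>2" for n
      proof -
        have "Complex x (d n) + \<i> * of_real (d n) = Complex x (2 * d n)" by (simp add: complex_eq_iff)
        then show ?thesis by (simp only: G_def) (simp only: Complex_eq)
      qed
      ultimately show ?case by simp
    qed
  qed
  then show ?thesis unfolding zero by (simp add: LIMSEQ_const_iff)
qed

section \<open>The smaller algebra\<close>

lemma norm2_mono_AE:
  assumes "f \<in> L2" "g \<in> L2" "AE x in lborel. cmod (f x) \<le> B * cmod (g x)" "0 \<le> B"
  shows "norm2 f \<le> B * norm2 g"
proof -
  have "(norm2 f)\<^sup>2 \<le> (LINT x|lborel. B\<^sup>2 * (cmod (g x))\<^sup>2)"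
    unfolding norm2_sq
  proof (rule integral_mono_AE)
    show "AE x in lborel. (cmod (f x))\<^sup>2 \<le> B\<^sup>2 * (cmod (g x))\<^sup>2"
      using assms(3) by eventually_elim (auto simp: power_mult_distrib[symmetric] intro!: power_mono)
  qed (use assms L2_sq_integrable in auto)
  also have "\<dots> = (B * norm2 g)\<^sup>2" by (simp add: norm2_sq power_mult_distrib)
  finally show ?thesis by (rule power2_le_imp_le) (use assms(4) in simp)
qed

lemma bopD:
  assumes "bop T"
  shows "\<And>f. f \<in> L2 \<Longrightarrow> T f \<in> L2"
    "\<And>f g. f \<in> L2 \<Longrightarrow> g \<in> L2 \<Longrightarrow> aeq f g \<Longrightarrow> aeq (T f) (T g)"
    "\<And>f g a b. f \<in> L2 \<Longrightarrow> g \<in> L2 \<Longrightarrow> aeq (T (\<lambda>x. a * f x + b * g x)) (\<lambda>x. a * T f x + b * T g x)"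
    "\<exists>C\<ge>0. \<forall>f\<in>L2. norm2 (T f) \<le> C * norm2 f"
proof -
  obtain C where C: "\<forall>f\<in>L2. norm2 (T f) \<le> C * norm2 f" using assms by (auto simp: bop_def)
  have "norm2 (T f) \<le> \<bar>C\<bar> * norm2 f" if "f \<in> L2" for f
    using C that mult_right_mono[OF abs_ge_self[of C] norm2_nonneg[of f]] by fastforce
  then show "\<exists>C\<ge>0. \<forall>f\<in>L2. norm2 (T f) \<le> C * norm2 f" by (intro exI[of _ "\<bar>C\<bar>"]) auto
qed (use assms in \<open>auto simp: bop_def\<close>)

lemma bop_mult_op:
  assumes [measurable]: "h \<in> borel_measurable lborel" and b: "AE x in lborel. cmod (h x) \<le> B"
  shows "bop (mult_op h)"
  unfolding bop_def
proof (intro conjI ballI allI impI)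
  show L: "mult_op h f \<in> L2" if "f \<in> L2" for f
    unfolding mult_op_def by (rule L2_bounded_mult[OF that assms])
  show "aeq (mult_op h f) (mult_op h g)" if "aeq f g" for f g
    using that unfolding aeq_def by eventually_elim (simp add: mult_op_def)
  show "aeq (mult_op h (\<lambda>x. a * f x + b * g x)) (\<lambda>x. a * mult_op h f x + b * mult_op h g x)" for f g a b
    by (simp add: aeq_def mult_op_def algebra_simps)
  have "norm2 (mult_op h f) \<le> \<bar>B\<bar> * norm2 f" if "f \<in> L2" for f
  proof (rule norm2_mono_AE[OF L[OF that] that])
    show "AE x in lborel. cmod (mult_op h f x) \<le> \<bar>B\<bar> * cmod (f x)"
      using b by eventually_elim (auto simp: mult_op_def norm_mult intro!: mult_right_mono)
  qed simp
  then show "\<exists>C. \<forall>f\<in>L2. norm2 (mult_op h f) \<le> C * norm2 f" by blast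
qed

lemma Mop_eq_mult_op: "Mop l = mult_op (\<lambda>x. exp (\<i> * of_real (l * x)))"
  by (simp add: Mop_def mult_op_def fun_eq_iff)

lemma bop_Mop: "bop (Mop l)"
  unfolding Mop_eq_mult_op by (rule bop_mult_op[where B = 1]) (auto simp del: of_real_mult)

lemma AE_lborel_shift:
  assumes "AE x in lborel. P (x :: real)" shows "AE x in lborel. P (x - m)"
proof -
  have "AE x in distr lborel borel ((+) (- m)). P x"
    by (subst lborel_distr_plus) (rule assms)
  then have "AE x in lborel. P (- m + x)" by (rule AE_distrD[rotated]) simp
  then show ?thesis by simp
qed

lemma bop_Dop: "bop (Dop m)"
  unfolding bop_def
proof (intro conjI ballI allI impI)
  show "aeq (Dop m f) (Dop m g)" if "aeq f g" for f g
    using AE_lborel_shift[of "\<lambda>x. f x = g x" m] that by (simp add: aeq_def Dop_def)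
  show "aeq (Dop m (\<lambda>x. a * f x + b * g x)) (\<lambda>x. a * Dop m f x + b * Dop m g x)" for f g a b
    by (simp add: aeq_def Dop_def)
  have "norm2 (Dop m f) = norm2 f" for f
    unfolding norm2_def Dop_def by (subst lborel_integral_shift[of "\<lambda>x. (cmod (f x))\<^sup>2"]) simp
  then show "\<exists>C. \<forall>f\<in>L2. norm2 (Dop m f) \<le> C * norm2 f" by (intro exI[of _ 1]) simp
qed (rule Dop_L2)

lemma bop_add:
  assumes T: "bop T" and S: "bop S" shows "bop (\<lambda>f x. T f x + S f x)"
  unfolding bop_def
proof (intro conjI ballI allI impI)
  show "(\<lambda>x. T f x + S f x) \<in> L2" if "f \<in> L2" for f using that bopD(1)[OF T] bopD(1)[OF S] by (intro L2_add)
  show "aeq (\<lambda>x. T f x + S f x) (\<lambda>x. T g x + S g x)" if "f \<in> L2" "g \<in> L2" "aeq f g" for f g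
    using bopD(2)[OF T that] bopD(2)[OF S that] unfolding aeq_def by eventually_elim simp
  show "aeq (\<lambda>x. T (\<lambda>x. a * f x + b * g x) x + S (\<lambda>x. a * f x + b * g x) x) (\<lambda>x. a * (T f x + S f x) + b * (T g x + S g x))"
    if "f \<in> L2" "g \<in> L2" for f g a b
    using bopD(3)[OF T that, of a b] bopD(3)[OF S that, of a b] unfolding aeq_def by eventually_elim (simp add: algebra_simps)
  obtain C D where CD: "\<forall>f\<in>L2. norm2 (T f) \<le> C * norm2 f" "\<forall>f\<in>L2. norm2 (S f) \<le> D * norm2 f"
    using bopD(4)[OF T] bopD(4)[OF S] by blast
  have "norm2 (\<lambda>x. T f x + S f x) \<le> (C + D) * norm2 f" if "f \<in> L2" for f
    using norm2_triangle[OF bopD(1)[OF T that] bopD(1)[OF S that]] CD that by (fastforce simp: distrib_right)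
  then show "\<exists>C. \<forall>f\<in>L2. norm2 (\<lambda>x. T f x + S f x) \<le> C * norm2 f" by blast
qed

lemma bop_scale:
  assumes T: "bop T" shows "bop (\<lambda>f x. c * T f x)"
  unfolding bop_def
proof (intro conjI ballI allI impI)
  show "(\<lambda>x. c * T f x) \<in> L2" if "f \<in> L2" for f using that bopD(1)[OF T] by (intro L2_scale)
  show "aeq (\<lambda>x. c * T f x) (\<lambda>x. c * T g x)" if "f \<in> L2" "g \<in> L2" "aeq f g" for f g
    using bopD(2)[OF T that] unfolding aeq_def by eventually_elim simp
  show "aeq (\<lambda>x. c * T (\<lambda>x. a * f x + b * g x) x) (\<lambda>x. a * (c * T f x) + b * (c * T g x))"
    if "f \<in> L2" "g \<in> L2" for f g a b
    using bopD(3)[OF T that, of a b] unfolding aeq_def by eventually_elim (simp add: algebra_simps)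
  obtain C where C: "\<forall>f\<in>L2. norm2 (T f) \<le> C * norm2 f" using bopD(4)[OF T] by blast
  have "norm2 (\<lambda>x. c * T f x) \<le> (cmod c * C) * norm2 f" if "f \<in> L2" for f
    using C that by (simp add: norm2_scale mult.assoc mult_left_mono)
  then show "\<exists>C. \<forall>f\<in>L2. norm2 (\<lambda>x. c * T f x) \<le> C * norm2 f" by blast
qed

lemma bop_comp:
  assumes T: "bop T" and S: "bop S" shows "bop (T \<circ> S)"
  unfolding bop_def o_def
proof (intro conjI ballI allI impI)
  show "T (S f) \<in> L2" if "f \<in> L2" for f using that bopD(1)[OF T] bopD(1)[OF S] by blast
  show "aeq (T (S f)) (T (S g))" if "f \<in> L2" "g \<in> L2" "aeq f g" for f g
    by (intro bopD(2)[OF T] bopD(1)[OF S] bopD(2)[OF S] that)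
  show "aeq (T (S (\<lambda>x. a * f x + b * g x))) (\<lambda>x. a * T (S f) x + b * T (S g) x)"
    if "f \<in> L2" "g \<in> L2" for f g a b
  proof -
    have "aeq (T (S (\<lambda>x. a * f x + b * g x))) (T (\<lambda>x. a * S f x + b * S g x))"
      by (intro bopD(2)[OF T] bopD(1)[OF S] bopD(3)[OF S] L2_lincomb that)
    moreover have "aeq (T (\<lambda>x. a * S f x + b * S g x)) (\<lambda>x. a * T (S f) x + b * T (S g) x)"
      by (intro bopD(3)[OF T] bopD(1)[OF S] that)
    ultimately show ?thesis unfolding aeq_def by eventually_elim simp
  qed
  obtain C where C: "C \<ge> 0" "\<forall>f\<in>L2. norm2 (T f) \<le> C * norm2 f" using bopD(4)[OF T] by blast
  obtain D where D: "\<forall>f\<in>L2. norm2 (S f) \<le> D * norm2 f" using bopD(4)[OF S] by blast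
  have "norm2 (T (S f)) \<le> (C * D) * norm2 f" if "f \<in> L2" for f
  proof -
    have "norm2 (T (S f)) \<le> C * norm2 (S f)" using C bopD(1)[OF S that] by blast
    also have "\<dots> \<le> C * (D * norm2 f)" using C D that by (intro mult_left_mono) auto
    finally show ?thesis by simp
  qed
  then show "\<exists>C. \<forall>f\<in>L2. norm2 (T (S f)) \<le> C * norm2 f" by blast
qed

section \<open>The bipolar of the semigroup\<close>

definition MDop :: "real \<Rightarrow> real \<Rightarrow> op" where
  "MDop l m = Mop l \<circ> Dop m"

definition index_semigroup :: "real \<Rightarrow> (real \<times> real) set" where
  "index_semigroup c = {(l, m). 0 \<le> l \<and> 0 \<le> m \<and> (m = 0 \<or> c \<le> l)}"

text \<open>On bounded operators these are the linear functionals continuous in the weak operator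
  topology.\<close>

definition finite_functional :: "(fn \<times> fn) list \<Rightarrow> op \<Rightarrow> complex" where
  "finite_functional vs T = (\<Sum>(f, g)\<leftarrow>vs. inner2 (T f) g)"

text \<open>The bipolar of \<open>{M\<^sub>l D\<^sub>m | (l, m) \<in> index_semigroup c}\<close>, that is, the closure of its
  linear span in the weak operator topology.\<close>

definition small_algebra :: "real \<Rightarrow> op set" where
  "small_algebra c = {T. bop T \<and> (\<forall>vs. set vs \<subseteq> L2 \<times> L2 \<longrightarrow>
     (\<forall>(l, m)\<in>index_semigroup c. finite_functional vs (MDop l m) = 0) \<longrightarrow> finite_functional vs T = 0)}"

lemma bop_MDop: "bop (MDop l m)"
  unfolding MDop_def by (intro bop_comp bop_Mop bop_Dop)

lemma index_semigroup_add:
  assumes "(l, m) \<in> index_semigroup c" "(l', m') \<in> index_semigroup c"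
  shows "(l + l', m + m') \<in> index_semigroup c"
  using assms by (auto simp: index_semigroup_def)

text \<open>Weyl commutation. The scalar is harmless for spans, so products of generators stay in
  the span of the generators.\<close>

lemma MDop_MDop: "MDop l m (MDop l' m' f) = (\<lambda>x. exp (- \<i> * of_real (l' * m)) * MDop (l + l') (m + m') f x)"
proof
  fix x
  have "exp (\<i> * complex_of_real (l * x)) * exp (\<i> * of_real (l' * (x - m)))
      = exp (- \<i> * of_real (l' * m)) * exp (\<i> * of_real ((l + l') * x))"
    by (simp add: mult_exp_exp algebra_simps)
  moreover have "x - m - m' = x - (m + m')" by simp
  ultimately show "MDop l m (MDop l' m' f) x = exp (- \<i> * of_real (l' * m)) * MDop (l + l') (m + m') f x"
    by (simp only: MDop_def Mop_def Dop_def o_def mult.assoc[symmetric])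
qed

lemma MDop_adjoint: "inner2 (MDop l m f) g = inner2 f (Dop (- m) (Mop (- l) g))"
proof -
  have "inner2 (MDop l m f) g = (LINT x|lborel. (\<lambda>x. f x * cnj (Dop (- m) (Mop (- l) g) x)) (x - m))"
    unfolding inner2_def
    by (intro Bochner_Integration.integral_cong refl) (simp add: MDop_def Mop_def Dop_def exp_cnj mult.left_commute)
  also have "\<dots> = inner2 f (Dop (- m) (Mop (- l) g))"
    unfolding inner2_def by (rule lborel_integral_shift)
  finally show ?thesis .
qed

lemma finite_functional_Nil [simp]: "finite_functional [] T = 0"
  by (simp add: finite_functional_def)

lemma finite_functional_Cons [simp]: "finite_functional ((f, g) # vs) T = inner2 (T f) g + finite_functional vs T"
  by (simp add: finite_functional_def)

lemma finite_functional_add: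
  assumes "bop T" "bop S" "set vs \<subseteq> L2 \<times> L2"
  shows "finite_functional vs (\<lambda>f x. T f x + S f x) = finite_functional vs T + finite_functional vs S"
  using assms(3) by (induction vs) (auto simp: inner2_add_left bopD(1)[OF assms(1)] bopD(1)[OF assms(2)])

lemma finite_functional_scale:
  "finite_functional vs (\<lambda>f x. c * T f x) = c * finite_functional vs T"
  by (induction vs) (auto simp: inner2_scale_left distrib_left)

lemma finite_functional_map_left:
  "finite_functional (map (\<lambda>(f, g). (S f, g)) vs) T = finite_functional vs (T \<circ> S)"
  by (induction vs) auto

lemma finite_functional_map_right:
  assumes "\<And>f g. inner2 (S f) g = inner2 f (S' g)"
  shows "finite_functional (map (\<lambda>(f, g). (f, S' g)) vs) T = finite_functional vs (S \<circ> T)"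
  by (induction vs) (auto simp: assms)

lemma finite_functional_MDop_MDop:
  "finite_functional vs (MDop l m \<circ> MDop l' m') = exp (- \<i> * of_real (l' * m)) * finite_functional vs (MDop (l + l') (m + m'))"
  unfolding o_def MDop_MDop by (rule finite_functional_scale)

lemma small_algebraD:
  assumes "T \<in> small_algebra c"
  shows "bop T" "\<And>vs. set vs \<subseteq> L2 \<times> L2 \<Longrightarrow>
     (\<And>l m. (l, m) \<in> index_semigroup c \<Longrightarrow> finite_functional vs (MDop l m) = 0) \<Longrightarrow> finite_functional vs T = 0"
  using assms by (auto simp: small_algebra_def)

lemma small_algebraI:
  assumes "bop T" "\<And>vs. set vs \<subseteq> L2 \<times> L2 \<Longrightarrow>
     (\<And>l m. (l, m) \<in> index_semigroup c \<Longrightarrow> finite_functional vs (MDop l m) = 0) \<Longrightarrow> finite_functional vs T = 0"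
  shows "T \<in> small_algebra c"
  unfolding small_algebra_def using assms(1)
  by (intro CollectI conjI allI impI) (simp, erule assms(2), auto)

lemma MDop_in_small_algebra: "(l, m) \<in> index_semigroup c \<Longrightarrow> MDop l m \<in> small_algebra c"
  by (intro small_algebraI bop_MDop)

text \<open>The adjoint of a generator is moved to the second vectors of the functional. The new
  functional still annihilates all generators because they form a semigroup up to scalars.\<close>

lemma MDop_comp_small_algebra:
  assumes T: "T \<in> small_algebra c" and lm: "(l, m) \<in> index_semigroup c"
  shows "MDop l m \<circ> T \<in> small_algebra c"
proof (rule small_algebraI)
  show "bop (MDop l m \<circ> T)" by (intro bop_comp bop_MDop small_algebraD(1)[OF T])
  fix vs assume vs: "set vs \<subseteq> L2 \<times> L2"
    and z: "\<And>l m. (l, m) \<in> index_semigroup c \<Longrightarrow> finite_functional vs (MDop l m) = 0"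
  let ?ws = "map (\<lambda>(f, g). (f, Dop (- m) (Mop (- l) g))) vs"
  have e: "finite_functional ?ws R = finite_functional vs (MDop l m \<circ> R)" for R
    by (rule finite_functional_map_right) (rule MDop_adjoint)
  have "finite_functional ?ws T = 0"
  proof (rule small_algebraD(2)[OF T])
    show "set ?ws \<subseteq> L2 \<times> L2" using vs by (auto intro: Dop_L2 Mop_L2)
    show "finite_functional ?ws (MDop l' m') = 0" if "(l', m') \<in> index_semigroup c" for l' m'
      unfolding e finite_functional_MDop_MDop using z[OF index_semigroup_add[OF lm that]] by simp
  qed
  then show "finite_functional vs (MDop l m \<circ> T) = 0" by (simp only: e)
qed

text \<open>Products are handled in two rounds: a generator times an operator by adjoints, as above,
  then \<open>T \<circ> S\<close> by moving \<open>S\<close> onto the first vectors and applying the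
  first round to \<open>S\<close>.\<close>

lemma op_algebra_small_algebra: "op_algebra (small_algebra c)"
  unfolding op_algebra_def
proof (intro conjI ballI allI)
  have "(0, 0) \<in> index_semigroup c" by (simp add: index_semigroup_def)
  then show "small_algebra c \<noteq> {}" using MDop_in_small_algebra by blast
  fix T assume T: "T \<in> small_algebra c"
  show "bop T" using small_algebraD(1)[OF T] .
  show "(\<lambda>f x. a * T f x) \<in> small_algebra c" for a
    by (rule small_algebraI) (auto simp: finite_functional_scale small_algebraD(2)[OF T] intro: bop_scale small_algebraD(1)[OF T])
  fix S assume S: "S \<in> small_algebra c"
  show "(\<lambda>f x. T f x + S f x) \<in> small_algebra c"
    by (rule small_algebraI)
      (auto simp: finite_functional_add small_algebraD(1)[OF T] small_algebraD(1)[OF S] small_algebraD(2)[OF T] small_algebraD(2)[OF S]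
        intro: bop_add)
  show "T \<circ> S \<in> small_algebra c"
  proof (rule small_algebraI)
    show "bop (T \<circ> S)" by (intro bop_comp small_algebraD(1)[OF T] small_algebraD(1)[OF S])
    fix vs assume vs: "set vs \<subseteq> L2 \<times> L2"
      and z: "\<And>l m. (l, m) \<in> index_semigroup c \<Longrightarrow> finite_functional vs (MDop l m) = 0"
    have "finite_functional (map (\<lambda>(f, g). (S f, g)) vs) T = 0"
    proof (rule small_algebraD(2)[OF T])
      show "set (map (\<lambda>(f, g). (S f, g)) vs) \<subseteq> L2 \<times> L2" using vs bopD(1)[OF small_algebraD(1)[OF S]] by auto
      show "finite_functional (map (\<lambda>(f, g). (S f, g)) vs) (MDop l m) = 0" if "(l, m) \<in> index_semigroup c" for l m
        unfolding finite_functional_map_left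
        by (rule small_algebraD(2)[OF MDop_comp_small_algebra[OF S that] vs z])
    qed
    then show "finite_functional vs (T \<circ> S) = 0" by (simp only: finite_functional_map_left)
  qed
qed

lemma inner2_zero_right [simp]: "inner2 f (\<lambda>x. 0) = 0"
  by (simp add: inner2_def)

lemma norm2_zero [simp]: "norm2 (\<lambda>x. 0) = 0"
  by (simp add: norm2_def)

lemma weak_star_closed_small_algebra: "weak_star_closed (small_algebra c)"
  unfolding weak_star_closed_def
proof (intro conjI allI impI)
  show "small_algebra c \<subseteq> Collect bop" by (auto dest: small_algebraD(1))
  fix T assume bT: "bop T" and approx: "\<forall>ps. \<forall>e>0. (\<forall>(x, y)\<in>set ps. ultraweak_data x y) \<longrightarrow>
      (\<exists>S\<in>small_algebra c. \<forall>(x, y)\<in>set ps. cmod (ultraweak_fun x y S - ultraweak_fun x y T) < e)"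
  show "T \<in> small_algebra c"
  proof (rule small_algebraI[OF bT])
    fix vs assume vs: "set vs \<subseteq> L2 \<times> L2"
      and z: "\<And>l m. (l, m) \<in> index_semigroup c \<Longrightarrow> finite_functional vs (MDop l m) = 0"
    \<comment> \<open>Padding a vector with zeros gives ultraweak data, so that each rank one
      functional is among the ultraweak ones and closedness follows from the definition by
      annihilators.\<close>
    define u :: "fn \<Rightarrow> nat \<Rightarrow> fn" where "u = (\<lambda>f n. if n = 0 then f else (\<lambda>x. 0))"
    have ud: "ultraweak_data (u f) (u g)" if "f \<in> L2" "g \<in> L2" for f g
    proof -
      have "summable (\<lambda>n. (norm2 (u f n))\<^sup>2)" for f
        by (rule summable_finite[of "{0}"]) (auto simp: u_def)
      then show ?thesis using that by (auto simp: ultraweak_data_def u_def)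
    qed
    have uf: "ultraweak_fun (u f) (u g) S = inner2 (S f) g" for f g S
    proof -
      have "(\<Sum>n. inner2 (S (u f n)) (u g n)) = (\<Sum>n\<in>{0}. inner2 (S (u f n)) (u g n))"
        by (rule suminf_finite) (auto simp: u_def)
      then show ?thesis by (simp add: ultraweak_fun_def u_def)
    qed
    have le: "cmod (finite_functional vs T) \<le> real (length vs) * e" if e: "e > 0" for e
    proof -
      have "\<forall>(x, y)\<in>set (map (\<lambda>(f, g). (u f, u g)) vs). ultraweak_data x y" using vs ud by auto
      then obtain S where S: "S \<in> small_algebra c"
          "\<forall>(x, y)\<in>set (map (\<lambda>(f, g). (u f, u g)) vs). cmod (ultraweak_fun x y S - ultraweak_fun x y T) < e"
        using approx e by blast
      have b: "\<forall>(f, g)\<in>set vs. cmod (inner2 (S f) g - inner2 (T f) g) < e" using S(2) by (auto simp: uf)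
      have "cmod (finite_functional vs S - finite_functional vs T) \<le> real (length vs) * e"
        using b
      proof (induction vs)
        case (Cons p vs)
        obtain f g where p: "p = (f, g)" by force
        have "cmod (finite_functional (p # vs) S - finite_functional (p # vs) T)
          \<le> cmod (inner2 (S f) g - inner2 (T f) g) + cmod (finite_functional vs S - finite_functional vs T)"
          unfolding p finite_functional_Cons by (metis add_diff_add norm_triangle_ineq)
        also have "\<dots> \<le> e + real (length vs) * e" using Cons p by fastforce
        finally show ?case by (simp add: algebra_simps)
      qed simp
      moreover have "finite_functional vs S = 0" by (rule small_algebraD(2)[OF S(1) vs z])
      ultimately show ?thesis by simp
    qed
    have "cmod (finite_functional vs T) \<le> 0 + e" if e: "e > 0" for e
    proof -
      \<comment> \<open>The summand 1 covers the empty list.\<close>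
      have "cmod (finite_functional vs T) \<le> real (length vs) * (e / (real (length vs) + 1))"
        using e by (intro le) (simp add: add_nonneg_pos)
      also have "\<dots> \<le> 0 + e" using e by (simp add: field_simps)
      finally show ?thesis .
    qed
    then have "cmod (finite_functional vs T) \<le> 0" by (rule field_le_epsilon)
    then show "finite_functional vs T = 0" by simp
  qed
qed

text \<open>The integrable function is the sum of \<open>f x * cnj (g x)\<close> over the list; one
  function serves all multipliers.\<close>

lemma finite_functional_mult_op:
  assumes "set vs \<subseteq> L2 \<times> L2"
  shows "\<exists>\<phi>. integrable lborel \<phi> \<and> (\<forall>h B. h \<in> borel_measurable lborel \<longrightarrow> (AE x in lborel. cmod (h x) \<le> B) \<longrightarrow>
     finite_functional vs (mult_op h) = (LINT x|lborel. h x * \<phi> x))"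
  using assms
proof (induction vs)
  case Nil
  show ?case by (intro exI[of _ "\<lambda>x. 0"]) simp
next
  case (Cons p vs)
  obtain f g where p: "p = (f, g)" by force
  obtain \<phi> where \<phi>: "integrable lborel \<phi>" "\<And>h B. h \<in> borel_measurable lborel \<Longrightarrow> (AE x in lborel. cmod (h x) \<le> B) \<Longrightarrow>
     finite_functional vs (mult_op h) = (LINT x|lborel. h x * \<phi> x)"
    using Cons by auto
  have fg: "f \<in> L2" "g \<in> L2" using Cons.prems p by auto
  have i: "integrable lborel (\<lambda>x. f x * cnj (g x))" by (rule L2_integrable_inner[OF fg])
  have "finite_functional (p # vs) (mult_op h) = (LINT x|lborel. h x * (f x * cnj (g x) + \<phi> x))"
    if h[measurable]: "h \<in> borel_measurable lborel" and b: "AE x in lborel. cmod (h x) \<le> B" for h B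
  proof -
    have i1: "integrable lborel (\<lambda>x. h x * (f x * cnj (g x)))"
      using L2_integrable_inner[OF L2_bounded_mult[OF fg(1) h b] fg(2)] by (simp add: mult.assoc)
    have [measurable]: "\<phi> \<in> borel_measurable lborel" using \<phi>(1) by simp
    have i2: "integrable lborel (\<lambda>x. h x * \<phi> x)"
    proof (rule Bochner_Integration.integrable_bound)
      show "integrable lborel (\<lambda>x. B * cmod (\<phi> x))" using \<phi>(1) by simp
      show "AE x in lborel. norm (h x * \<phi> x) \<le> norm (B * cmod (\<phi> x))"
        using b by eventually_elim (auto simp: norm_mult abs_mult intro!: mult_right_mono)
    qed simp
    have "inner2 (mult_op h f) g = (LINT x|lborel. h x * (f x * cnj (g x)))"
      by (simp add: inner2_def mult_op_def mult.assoc)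
    then show ?thesis
      using i1 i2 \<phi>(2)[OF h b] by (simp add: p distrib_left)
  qed
  moreover have "integrable lborel (\<lambda>x. f x * cnj (g x) + \<phi> x)" using i \<phi>(1) by simp
  ultimately show ?case by blast
qed

text \<open>The indices \<open>(l, 0)\<close> force the function that represents an annihilating
  functional on multipliers into H^1, and its integral against a bounded analytic function
  vanishes.\<close>

lemma mult_op_in_small_algebra:
  assumes h: "h \<in> Hinf" shows "mult_op h \<in> small_algebra c"
proof -
  have hm: "h \<in> borel_measurable lborel" using h by (simp add: Hinf_def)
  obtain B where B: "AE x in lborel. cmod (h x) \<le> B" using Hinf_bounded[OF h] by blast
  show ?thesis
  proof (rule small_algebraI)
    show "bop (mult_op h)" by (rule bop_mult_op[OF hm B])
    fix vs assume vs: "set vs \<subseteq> L2 \<times> L2"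
      and z: "\<And>l m. (l, m) \<in> index_semigroup c \<Longrightarrow> finite_functional vs (MDop l m) = 0"
    obtain \<phi> where \<phi>: "integrable lborel \<phi>" "\<And>h B. h \<in> borel_measurable lborel \<Longrightarrow> (AE x in lborel. cmod (h x) \<le> B) \<Longrightarrow>
       finite_functional vs (mult_op h) = (LINT x|lborel. h x * \<phi> x)"
      using finite_functional_mult_op[OF vs] by blast
    have "fourier \<phi> l = 0" if "0 \<le> l" for l
    proof -
      have "MDop l 0 = mult_op (\<lambda>x. exp (\<i> * of_real (l * x)))"
        by (simp add: MDop_def Mop_eq_mult_op fun_eq_iff)
      moreover have "finite_functional vs (MDop l 0) = 0" using that by (intro z) (simp add: index_semigroup_def)
      moreover have "finite_functional vs (mult_op (\<lambda>x. exp (\<i> * of_real (l * x)))) = (LINT x|lborel. exp (\<i> * of_real (l * x)) * \<phi> x)"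
        by (rule \<phi>(2)[where B = 1]) (auto simp del: of_real_mult)
      ultimately show ?thesis by (simp add: fourier_def)
    qed
    then show "finite_functional vs (mult_op h) = 0"
      unfolding \<phi>(2)[OF hm B] by (intro integral_Hinf_eq_0[OF \<phi>(1) _ h])
  qed
qed

text \<open>From left to right this is the descent in \<open>c\<close>. Conversely, for
  \<open>f\<close> in \<open>K\<close> and \<open>g\<close> orthogonal to \<open>K\<close>, the
  single pair \<open>(f, g)\<close> gives a functional that annihilates the generators.\<close>

lemma Lat_small_algebra:
  assumes c: "0 < c"
  shows "K \<in> Lat (small_algebra c) \<longleftrightarrow> closed_subspace K \<and>
    (\<forall>l\<ge>0. \<forall>f\<in>K. Mop l f \<in> K) \<and> (\<forall>m\<ge>0. \<forall>f\<in>K. Dop m f \<in> K)" (is "?L \<longleftrightarrow> ?R")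
proof
  assume L: ?L
  then have K: "closed_subspace K" by (simp add: Lat_def)
  have inv: "MDop l m f \<in> K" if "(l, m) \<in> index_semigroup c" "f \<in> K" for l m f
    using L MDop_in_small_algebra[OF that(1)] that(2) by (auto simp: Lat_def)
  have M: "Mop l f \<in> K" if "0 \<le> l" "f \<in> K" for l f
    using inv[of l 0 f] that by (simp add: index_semigroup_def MDop_def)
  have MD: "Mop l (Dop m f) \<in> K" if "c \<le> l" "0 \<le> m" "f \<in> K" for l m f
    using inv[of l m f] that c by (simp add: index_semigroup_def MDop_def)
  show ?R using K M translation_invariant[OF K M c MD] by blast
next
  assume R: ?R
  then have K: "closed_subspace K" by blast
  have "T f \<in> K" if T: "T \<in> small_algebra c" and f: "f \<in> K" for T f
  proof -
    have fL: "f \<in> L2" using f closed_subspaceD(1)[OF K] by blast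
    have TL: "T f \<in> L2" by (rule bopD(1)[OF small_algebraD(1)[OF T] fL])
    have "inner2 (T f) g = 0" if g: "g \<in> L2" "\<forall>h\<in>K. inner2 h g = 0" for g
    proof -
      have "finite_functional [(f, g)] T = 0"
        by (rule small_algebraD(2)[OF T]) (use fL g R f in \<open>auto simp: index_semigroup_def MDop_def\<close>)
      then show ?thesis by simp
    qed
    then show ?thesis using closed_subspace_mem_iff[OF K TL] by blast
  qed
  then show ?L using K by (simp add: Lat_def)
qed

section \<open>Invariant subspaces of the parabolic algebra\<close>

text \<open>Alg of the single subspace \<open>K\<close>. When \<open>K\<close> is invariant under
  the generators, this is one of the algebras whose intersection is
  \<open>parabolic_algebra\<close>, hence an upper bound for it.\<close>

definition leaving_invariant :: "fn set \<Rightarrow> op set" where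
  "leaving_invariant K = {T. bop T \<and> (\<forall>f\<in>K. T f \<in> K)}"

lemma op_algebra_leaving_invariant:
  assumes K: "closed_subspace K"
  shows "op_algebra (leaving_invariant K)"
  unfolding op_algebra_def
proof (intro conjI ballI allI)
  have "Mop 0 \<in> leaving_invariant K" by (simp add: leaving_invariant_def bop_Mop)
  then show "leaving_invariant K \<noteq> {}" by blast
  fix T assume T: "T \<in> leaving_invariant K"
  then show "bop T" by (simp add: leaving_invariant_def)
  show "(\<lambda>f x. a * T f x) \<in> leaving_invariant K" for a
    using T closed_subspaceD(3)[OF K, of _ _ a 0] by (auto simp: leaving_invariant_def intro: bop_scale)
  fix S assume S: "S \<in> leaving_invariant K"
  show "(\<lambda>f x. T f x + S f x) \<in> leaving_invariant K"
    using T S closed_subspaceD(3)[OF K, of _ _ 1 1] by (auto simp: leaving_invariant_def intro: bop_add)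
  show "T \<circ> S \<in> leaving_invariant K"
    using T S by (auto simp: leaving_invariant_def intro: bop_comp)
qed

lemma wot_closed_leaving_invariant:
  assumes K: "closed_subspace K"
  shows "wot_closed (leaving_invariant K)"
  unfolding wot_closed_def
proof (intro conjI allI impI)
  fix T assume bT: "bop T" and approx: "\<forall>vs :: (fn \<times> fn) list. \<forall>e>0. set vs \<subseteq> L2 \<times> L2 \<longrightarrow>
     (\<exists>S\<in>leaving_invariant K. \<forall>(f, g)\<in>set vs. cmod (inner2 (S f) g - inner2 (T f) g) < e)"
  have "T f \<in> K" if f: "f \<in> K" for f
  proof -
    have fL: "f \<in> L2" using f closed_subspaceD(1)[OF K] by blast
    have "inner2 (T f) g = 0" if g: "g \<in> L2" "\<forall>h\<in>K. inner2 h g = 0" for g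
    proof -
      have "cmod (inner2 (T f) g) \<le> 0 + e" if e: "e > 0" for e
      proof -
        have "set [(f, g)] \<subseteq> L2 \<times> L2" using fL g by simp
        then obtain S where S: "\<forall>f\<in>K. S f \<in> K" "cmod (inner2 (S f) g - inner2 (T f) g) < e"
          using approx[rule_format, OF e, of "[(f, g)]"] by (auto simp: leaving_invariant_def)
        then show ?thesis using g f by simp
      qed
      then have "cmod (inner2 (T f) g) \<le> 0" by (rule field_le_epsilon)
      then show ?thesis by simp
    qed
    then show ?thesis using closed_subspace_mem_iff[OF K bopD(1)[OF bT fL]] by blast
  qed
  then show "T \<in> leaving_invariant K" using bT by (simp add: leaving_invariant_def)
qed (auto simp: leaving_invariant_def)

lemma parabolic_algebra_generators:
  "0 \<le> l \<Longrightarrow> Mop l \<in> parabolic_algebra" "0 \<le> m \<Longrightarrow> Dop m \<in> parabolic_algebra"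
  by (auto simp: parabolic_algebra_def)

lemma Lat_parabolic_algebra:
  "K \<in> Lat parabolic_algebra \<longleftrightarrow> closed_subspace K \<and>
    (\<forall>l\<ge>0. \<forall>f\<in>K. Mop l f \<in> K) \<and> (\<forall>m\<ge>0. \<forall>f\<in>K. Dop m f \<in> K)" (is "?L \<longleftrightarrow> ?R")
proof
  assume ?L then show ?R using parabolic_algebra_generators by (auto simp: Lat_def)
next
  assume R: ?R
  then have K: "closed_subspace K" by blast
  have "parabolic_algebra \<subseteq> leaving_invariant K"
    unfolding parabolic_algebra_def
    using op_algebra_leaving_invariant[OF K] wot_closed_leaving_invariant[OF K] R
    by (intro Inter_lower) (auto simp: leaving_invariant_def bop_Mop bop_Dop)
  then show ?L using K by (auto simp: Lat_def leaving_invariant_def)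
qed

lemma MDop_in_parabolic_algebra:
  assumes "0 \<le> l" "0 \<le> m" shows "MDop l m \<in> parabolic_algebra"
  using assms by (auto simp: parabolic_algebra_def MDop_def op_algebra_def)

section \<open>A functional separating the two algebras\<close>

text \<open>The pole lies below the line, so this is a boundary function of Hardy class, and it has
  no zeros on the line.\<close>

definition resolvent :: fn where
  "resolvent x = inverse (of_real x + \<i>)"

lemma resolvent_in_L2: "resolvent \<in> L2"
proof (rule L2_I)
  show "resolvent \<in> borel_measurable lborel" unfolding resolvent_def by measurable
  have "(cmod (resolvent x))\<^sup>2 = 1 / ((x - 0)\<^sup>2 + 1\<^sup>2)" for x
  proof -
    have "(cmod (of_real x + \<i>))\<^sup>2 = x\<^sup>2 + 1" unfolding cmod_power2 by simp
    then show ?thesis by (simp add: resolvent_def norm_inverse power_inverse divide_inverse)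
  qed
  then show "integrable lborel (\<lambda>x. (cmod (resolvent x))\<^sup>2)"
    using poisson_integral(1)[of 1 0] by simp
qed

lemma resolvent_product_integrable: "integrable lborel (\<lambda>x. resolvent (x - m) * resolvent x)"
  by (intro L2_integrable_mult L2_shift resolvent_in_L2)

text \<open>Both poles lie below the line and the exponential is bounded above it, so the contour
  closes in the upper half-plane.\<close>

lemma fourier_resolvent_product:
  assumes s: "0 \<le> s"
  shows "fourier (\<lambda>x. resolvent (x - m) * resolvent x) s = 0"
proof -
  define g where "g = (\<lambda>z. exp (\<i> * of_real s * z) * (inverse (z - of_real m + \<i>) * inverse (z + \<i>)))"
  have eq: "g (of_real x) = exp (\<i> * of_real (s * x)) * (resolvent (x - m) * resolvent x)" for x
    by (simp add: g_def resolvent_def mult.assoc)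
  have "(LINT x|lborel. g (of_real x)) = 0"
  proof (rule integral_real_line_eq_0[where e = 1])
    have "z - of_real m + \<i> \<noteq> 0" "z + \<i> \<noteq> 0" if "- 1 < Im z" for z
      using that by (auto simp: complex_eq_iff)
    then show "g holomorphic_on {z. - 1 < Im z}"
      unfolding g_def by (intro holomorphic_intros) auto
    show "integrable lborel (\<lambda>x. g (of_real x))"
      unfolding eq by (rule fourier_integrable[OF resolvent_product_integrable])
    fix z assume z: "0 \<le> Im z" "2 * \<bar>m\<bar> + 1 \<le> cmod z"
    have up: "cmod w \<le> cmod (w + \<i>)" if "0 \<le> Im w" for w
    proof -
      have "(cmod w)\<^sup>2 \<le> (cmod (w + \<i>))\<^sup>2"
        unfolding cmod_power2 using that by (simp add: power2_eq_square algebra_simps)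
      then show ?thesis by (rule power2_le_imp_le) simp
    qed
    have z1: "cmod z > 0" using z by linarith
    have "cmod z / 2 \<le> cmod z - \<bar>m\<bar>" using z by linarith
    also have "\<dots> \<le> cmod (z - of_real m)" using norm_triangle_ineq2[of z "of_real m"] by simp
    also have "\<dots> \<le> cmod (z - of_real m + \<i>)" using z by (intro up) simp
    finally have a: "cmod (inverse (z - of_real m + \<i>)) \<le> inverse (cmod z / 2)"
      unfolding norm_inverse using z1 by (intro le_imp_inverse_le) auto
    have b: "cmod (inverse (z + \<i>)) \<le> inverse (cmod z)"
      unfolding norm_inverse using z1 up[OF z(1)] by (intro le_imp_inverse_le) auto
    have c: "cmod (exp (\<i> * of_real s * z)) \<le> 1" using z s by simp
    have "cmod (g z) \<le> 1 * (inverse (cmod z / 2) * inverse (cmod z))"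
      unfolding g_def norm_mult using z1 by (intro mult_mono a b c) auto
    also have "\<dots> = 2 / (cmod z)\<^sup>2" using z1 by (simp add: power2_eq_square field_simps)
    finally show "cmod (g z) \<le> 2 / (cmod z)\<^sup>2" .
  qed simp
  then show ?thesis by (simp only: fourier_def eq)
qed

text \<open>The product has no zeros, so by uniqueness its Fourier transform is not identically
  zero; only negative frequencies can survive. This is the origin of the constant \<open>c\<close>
  of the counterexample.\<close>

lemma fourier_resolvent_product_nonzero:
  "\<exists>c>0. fourier (\<lambda>x. resolvent (x - m) * resolvent x) (- c) \<noteq> 0"
proof (rule ccontr)
  assume "\<not> ?thesis"
  then have "fourier (\<lambda>x. resolvent (x - m) * resolvent x) l = 0" for l
    using fourier_resolvent_product[of l m] by (metis add.inverse_inverse neg_0_less_iff_less not_le)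
  then have "AE x in lborel. resolvent (x - m) * resolvent x = 0"
    by (intro AE_eq_0_of_fourier_eq_0 resolvent_product_integrable)
  moreover have "resolvent x \<noteq> 0" for x
  proof -
    have "complex_of_real x + \<i> \<noteq> 0" by (simp add: complex_eq_iff)
    then show ?thesis by (simp add: resolvent_def)
  qed
  ultimately have "AE x in (lborel :: real measure). False" by simp
  then have "(UNIV :: real set) \<in> null_sets lborel" by (subst AE_iff_null_sets) auto
  then show False by (auto simp: null_sets_def emeasure_lborel_UNIV)
qed

text \<open>The functional is \<open>T \<mapsto> \<langle>T q, g\<rangle> - \<langle>T (M\<^bsub>-\<pi>\<^esub> q), M\<^bsub>-\<pi>\<^esub> g\<rangle>\<close> with \<open>q\<close> the resolvent function and
  \<open>g\<^sup>* = M\<^bsub>-c\<^esub> q\<close>; on \<open>M\<^sub>l D\<^sub>m\<close> it takes the value \<open>1 - exp (\<i> \<pi> m)\<close> times the Fourier transform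
  of \<open>q(x - m) q(x)\<close> at \<open>l - c\<close>.\<close>

lemma small_algebra_ne_parabolic_algebra: "\<exists>c>0. small_algebra c \<noteq> parabolic_algebra"
proof -
  obtain c where c: "c > 0" "fourier (\<lambda>x. resolvent (x - 1) * resolvent x) (- c) \<noteq> 0"
    using fourier_resolvent_product_nonzero by blast
  define g where "g = (\<lambda>x. cnj (Mop (- c) resolvent x))"
  have gL: "g \<in> L2" unfolding g_def by (intro L2_cnj Mop_L2 resolvent_in_L2)
  define vs where "vs = [(resolvent, g), (Mop (- pi) resolvent, \<lambda>x. - 1 * Mop (- pi) g x)]"
  have vs: "set vs \<subseteq> L2 \<times> L2"
    using gL Mop_L2 resolvent_in_L2 L2_scale[of "Mop (- pi) g" "- 1"] by (auto simp: vs_def)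
  have val: "finite_functional vs (MDop l m) = (1 - exp (\<i> * of_real (pi * m))) * fourier (\<lambda>x. resolvent (x - m) * resolvent x) (l - c)" for l m
  proof -
    have "inner2 (MDop l m resolvent) g = fourier (\<lambda>x. resolvent (x - m) * resolvent x) (l - c)"
    proof -
      have e: "exp (\<i> * complex_of_real (l * x)) * exp (\<i> * of_real (- c * x)) = exp (\<i> * of_real ((l - c) * x))" for x
        by (simp add: mult_exp_exp algebra_simps)
      have "MDop l m resolvent x * cnj (g x)
          = (exp (\<i> * complex_of_real (l * x)) * exp (\<i> * of_real (- c * x))) * (resolvent (x - m) * resolvent x)" for x
        by (simp add: MDop_def Mop_def Dop_def g_def ac_simps)
      then have "MDop l m resolvent x * cnj (g x) = exp (\<i> * of_real ((l - c) * x)) * (resolvent (x - m) * resolvent x)" for x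
        by (simp only: e)
      then show ?thesis by (simp only: inner2_def fourier_def)
    qed
    moreover have "inner2 (MDop l m (Mop (- pi) resolvent)) (\<lambda>x. - 1 * Mop (- pi) g x) = - exp (\<i> * of_real (pi * m)) * inner2 (MDop l m resolvent) g"
    proof -
      have e: "exp (\<i> * complex_of_real (- pi * (x - m))) * exp (\<i> * complex_of_real (pi * x)) = exp (\<i> * of_real (pi * m))" for x
        by (simp add: mult_exp_exp algebra_simps)
      have "cnj (Mop (- pi) g x) = exp (\<i> * complex_of_real (pi * x)) * cnj (g x)" for x
        by (simp add: Mop_def exp_cnj)
      then have "MDop l m (Mop (- pi) resolvent) x * cnj (- 1 * Mop (- pi) g x)
          = - (exp (\<i> * complex_of_real (- pi * (x - m))) * exp (\<i> * complex_of_real (pi * x))) * (MDop l m resolvent x * cnj (g x))" for x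
        by (simp only: MDop_def Mop_def Dop_def o_def complex_cnj_mult complex_cnj_minus complex_cnj_one) simp
      then have "inner2 (MDop l m (Mop (- pi) resolvent)) (\<lambda>x. - 1 * Mop (- pi) g x)
          = (LINT x|lborel. - exp (\<i> * of_real (pi * m)) * (MDop l m resolvent x * cnj (g x)))"
        by (simp only: inner2_def e)
      then show ?thesis by (simp only: inner2_def integral_mult_right_zero)
    qed
    ultimately show ?thesis by (simp add: vs_def algebra_simps)
  qed
  \<comment> \<open>Either \<open>m = 0\<close> and the first factor of \<open>val\<close> vanishes,
    or \<open>l - c \<ge> 0\<close> and the Fourier transform does.\<close>
  have z: "finite_functional vs (MDop l m) = 0" if "(l, m) \<in> index_semigroup c" for l m
    using that fourier_resolvent_product[of "l - c" m] by (auto simp: val index_semigroup_def)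
  \<comment> \<open>The modulation by \<pi> is tuned to the translation by 1: 1 - exp(i \<pi>) =
    2.\<close>
  have "finite_functional vs (MDop 0 1) = 2 * fourier (\<lambda>x. resolvent (x - 1) * resolvent x) (- c)"
    by (simp add: val)
  then have "finite_functional vs (MDop 0 1) \<noteq> 0" using c(2) by simp
  then have "MDop 0 1 \<notin> small_algebra c" using small_algebraD(2)[OF _ vs z] by blast
  then show ?thesis using c(1) MDop_in_parabolic_algebra[of 0 1] by auto
qed

theorem theorem3p1:
  shows "\<exists>A. op_algebra A \<and> weak_star_closed A \<and>
           (\<forall>h\<in>Hinf. mult_op h \<in> A) \<and>
           Lat A = Lat parabolic_algebra \<and> A \<noteq> parabolic_algebra"
proof -
  obtain c where c: "c > 0" "small_algebra c \<noteq> parabolic_algebra"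
    using small_algebra_ne_parabolic_algebra by blast
  have "Lat (small_algebra c) = Lat parabolic_algebra"
    by (intro set_eqI) (simp only: Lat_small_algebra[OF c(1)] Lat_parabolic_algebra)
  then show ?thesis
    using op_algebra_small_algebra weak_star_closed_small_algebra mult_op_in_small_algebra c(2)
    by (intro exI[of _ "small_algebra c"] conjI ballI)
qed

end
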